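(* Let $V$ be an admissible, unimodular family of vectors in $\mathbb{Z}^d\setminus\{0\}$ and let $\beta\in\mathbb{Z}_{\ge 0}^d$ be a multi-index with $|\beta|=\varrho_V+1$. Then $L_\beta(x)=P([\,]^\beta)(x)-x^\beta$ is a linear combination of Bernoulli splines: $$L_\beta(x)=P([\,]^\beta)(x)-x^\beta=\sum_{U\in\Lambda} C(\beta,U)\,B(V,U)(x),$$ where the constants are $$C(\beta,U)=D^\beta\Big(\prod_{v\in U}(x\cdot v)\Big)$$ (this is a constant, since the polynomial $\prod_{v\in U}(x\cdot v)$ is homogeneous of degree $\varrho_V+1=|\beta|$). The identity holds for every $x\in\mathbb{R}^d$ if $\varrho_V\ge 1$, and at every point of continuity $x$ of $L_\beta$ if $\varrho_V=0$.
   Context: Notation. $V=\{v_1,\dots,v_n\}$ is a finite family of not necessarily distinct vectors in $\mathbb{Z}^d\setminus\{0\}$; subsets $U\subset V$ are taken with multiplicity (i.e. as subsets of the index set) and $\#U$ is the number of elements counted with multiplicity. $V$ is admissible if $\operatorname{span} V=\mathbb{R}^d$. $V$ is unimodular if $|\det W|\le 1$ for all $W\subset V$ with $\#W=d$. The dot is the scalar product in $\mathbb{R}^d$; $|\beta|=\beta_1+\dots+\beta_d$; $D^\beta$ is the usual partial derivative; $[\,]^\beta$ denotes the monomial function $x\mapsto x^\beta$. The box spline $B_V$ is the compactly supported piecewise polynomial function determined by $\int_{\mathbb{R}^d} f(x)B_V(x)\,dx=\int_{[0,1]^n} f(u_1v_1+\dots+u_nv_n)\,du$ for every continuous $f$ on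 $\mathbb{R}^d$. $\varrho_V=\max\{r:\ \operatorname{span}(V\setminus W)=\mathbb{R}^d \text{ for all } W\subset V \text{ with } \#W=r\}$. $P$ is the orthogonal projection of $L^2(\mathbb{R}^d)$ onto the $L^2$-closure $S$ of $\operatorname{span}\{B_V(\cdot-\alpha):\alpha\in\mathbb{Z}^d\}$. For unimodular $V$ the translates $B_V(\cdot-\alpha)$, $\alpha\in\mathbb{Z}^d$, form a Riesz basis of $S$, and the dual basis has the form $\phi(\cdot-\alpha)$ with $\phi\in S$ exponentially decaying, so $Pf=\sum_{\alpha\in\mathbb{Z}^d}\left(\int_{\mathbb{R}^d} f\,\overline{\phi(\cdot-\alpha)}\right)B_V(\cdot-\alpha)$; by this formula $P$ is extended to functions of polynomial growth, in particular to monomials. $\Lambda=\{U\subset V:\ \#U=\varrho_V+1,\ \operatorname{span}(V\setminus U)\ne\mathbb{R}^d\}$. For $\alpha\in\mathbb{Z}^d$, $\alpha\perp(V\setminus U)$ means $v\cdot\alpha=0$ for all $v\in V\setminus U$. For $U\in\Lambda$ and nonzero $\alpha\perp (V\setminus U)$ one has $v\cdot\alpha\neq0$ for all $v\in U$. The Bernoulli spline for $U\in\Lambda$ is $$B(V,U)(x)=\sum_{\alpha\in\mathbb{Z}^d,\ \alpha\ne0,\ \alpha\perp(V\setminus U)}\ \Big(\prod_{v\in U}\frac{1}{2\pi i\,\alpha\cdot v}\Big)e^{2\pi i\,\alpha\cdot x}.$$ The index set is $\{k\alpha_U: k\in\mathbb{Z}\setminus\{0\}\}$ for some $\alpha_U\in\mathbb{Z}^d\setminus\{0\}$;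 when $\varrho_V=0$ the series is understood as the limit of symmetric partial sums over $0<|k|\le N$. *)

theory Defs
  imports "HOL-Analysis.Analysis"
begin

text \<open>
  A finite family of vectors, repetitions allowed, is a function \<open>v\<close> together with a finite
  index set \<open>I\<close>. Subfamilies, counted with multiplicity, are subsets of \<open>I\<close>.
\<close>

definition int_vecs :: "(real ^ 'd) set" where
  "int_vecs = {x. \<forall>j. x $ j \<in> \<int>}"

definition admissible_family :: "('i \<Rightarrow> real ^ 'd) \<Rightarrow> 'i set \<Rightarrow> bool" where
  "admissible_family v I \<longleftrightarrow> span (v ` I) = UNIV"

text \<open>
  The absolute value of the determinant does not depend on the enumeration \<open>\<sigma>\<close> of \<open>W\<close>.
\<close>
definition unimodular_family :: "('i \<Rightarrow> real ^ 'd) \<Rightarrow> 'i set \<Rightarrow> bool" where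
  "unimodular_family v I \<longleftrightarrow>
     (\<forall>W\<subseteq>I. card W = CARD('d) \<longrightarrow>
       (\<forall>\<sigma> :: 'd \<Rightarrow> 'i. bij_betw \<sigma> UNIV W \<longrightarrow> \<bar>det (\<chi> i j. v (\<sigma> j) $ i)\<bar> \<le> 1))"

text \<open>
  The bound \<open>r \<le> card I\<close> is implicit in the usual definition: for larger \<open>r\<close> the condition
  would hold vacuously.
\<close>
definition rho :: "('i \<Rightarrow> real ^ 'd) \<Rightarrow> 'i set \<Rightarrow> nat" where
  "rho v I = Max {r. r \<le> card I \<and> (\<forall>W\<subseteq>I. card W = r \<longrightarrow> span (v ` (I - W)) = UNIV)}"

definition piecewise_polynomial :: "(real ^ 'd \<Rightarrow> real) \<Rightarrow> bool" where
  "piecewise_polynomial f \<longleftrightarrow>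
     (\<exists>H :: ((real ^ 'd) \<times> real) set. finite H \<and> (\<forall>(a, b)\<in>H. a \<noteq> 0) \<and>
       (\<forall>C\<in>components (- (\<Union>(a, b)\<in>H. {x. a \<bullet> x = b})).
          \<exists>p. real_polynomial_function p \<and> (\<forall>x\<in>C. f x = p x)))"

text \<open>
  The integral identity determines a box spline only up to a null set. The last clause fixes
  the representative: if there is a continuous one, then that one is meant. (The
  discontinuous case leaves a choice of values on finitely many hyperplanes.)
\<close>
definition is_box_spline :: "('i \<Rightarrow> real ^ 'd) \<Rightarrow> 'i set \<Rightarrow> (real ^ 'd \<Rightarrow> real) \<Rightarrow> bool" where
  "is_box_spline v I B \<longleftrightarrow>
     compact (closure {x. B x \<noteq> 0}) \<and>
     piecewise_polynomial B \<and>
     integrable lborel B \<and>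
     (\<forall>f :: real ^ 'd \<Rightarrow> real. continuous_on UNIV f \<longrightarrow>
        (LINT x|lborel. f x * B x) =
        (LINT u:(\<Pi>\<^sub>E i\<in>I. {0..1})|(\<Pi>\<^sub>M i\<in>I. lborel). f (\<Sum>i\<in>I. u i *\<^sub>R v i))) \<and>
     ((\<exists>g. continuous_on UNIV g \<and> (AE x in lborel. B x = g x)) \<longrightarrow> continuous_on UNIV B)"

text \<open>Membership in the \<open>L\<^sup>2\<close>-closure of the linear span of the integer translates of \<open>B\<close>.\<close>
definition in_shift_space :: "(real ^ 'd \<Rightarrow> real) \<Rightarrow> (real ^ 'd \<Rightarrow> complex) \<Rightarrow> bool" where
  "in_shift_space B f \<longleftrightarrow>
     f \<in> borel_measurable lborel \<and> integrable lborel (\<lambda>x. (cmod (f x))\<^sup>2) \<and>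
     (\<forall>\<epsilon>>0. \<exists>A c. finite A \<and> A \<subseteq> int_vecs \<and>
        integrable lborel
          (\<lambda>x. (cmod (f x - (\<Sum>\<alpha>\<in>A. c \<alpha> * complex_of_real (B (x - \<alpha>)))))\<^sup>2) \<and>
        (LINT x|lborel. (cmod (f x - (\<Sum>\<alpha>\<in>A. c \<alpha> * complex_of_real (B (x - \<alpha>)))))\<^sup>2) < \<epsilon>)"

definition exponentially_decaying :: "(real ^ 'd \<Rightarrow> complex) \<Rightarrow> bool" where
  "exponentially_decaying f \<longleftrightarrow>
     (\<exists>K c. c > 0 \<and> (AE x in lborel. cmod (f x) \<le> K * exp (- c * norm x)))"

text \<open>
  The translates \<open>\<phi>(\<cdot> - \<alpha>)\<close> are the basis dual to the translates \<open>B(\<cdot> - \<alpha>)\<close>.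
  These conditions determine \<open>\<phi>\<close> up to a null set.
\<close>
definition is_dual_generator ::
    "(real ^ 'd \<Rightarrow> real) \<Rightarrow> (real ^ 'd \<Rightarrow> complex) \<Rightarrow> bool" where
  "is_dual_generator B \<phi> \<longleftrightarrow>
     in_shift_space B \<phi> \<and> exponentially_decaying \<phi> \<and>
     (\<forall>\<alpha>\<in>int_vecs. \<forall>\<gamma>\<in>int_vecs.
        (LINT x|lborel. complex_of_real (B (x - \<alpha>)) * cnj (\<phi> (x - \<gamma>))) =
        (if \<alpha> = \<gamma> then 1 else 0))"

text \<open>
  The orthogonal projection onto the shift space, in the form that extends to functions of
  polynomial growth. For compactly supported \<open>B\<close> the sum has finitely many nonzero terms.
\<close>
definition box_projection ::
    "(real ^ 'd \<Rightarrow> real) \<Rightarrow> (real ^ 'd \<Rightarrow> complex) \<Rightarrow>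
     (real ^ 'd \<Rightarrow> complex) \<Rightarrow> real ^ 'd \<Rightarrow> complex" where
  "box_projection B \<phi> f x =
     (\<Sum>\<^sub>\<infinity>\<alpha>\<in>int_vecs. (LINT y|lborel. f y * cnj (\<phi> (y - \<alpha>))) * complex_of_real (B (x - \<alpha>)))"

definition monomial :: "nat ^ 'd \<Rightarrow> real ^ 'd \<Rightarrow> complex" where
  "monomial \<beta> x = complex_of_real (\<Prod>j\<in>UNIV. (x $ j) ^ (\<beta> $ j))"

definition proj_error ::
    "(real ^ 'd \<Rightarrow> real) \<Rightarrow> (real ^ 'd \<Rightarrow> complex) \<Rightarrow> nat ^ 'd \<Rightarrow> real ^ 'd \<Rightarrow> complex" where
  "proj_error B \<phi> \<beta> x = box_projection B \<phi> (monomial \<beta>) x - monomial \<beta> x"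

definition Lambda_sets :: "('i \<Rightarrow> real ^ 'd) \<Rightarrow> 'i set \<Rightarrow> 'i set set" where
  "Lambda_sets v I = {U. U \<subseteq> I \<and> card U = rho v I + 1 \<and> span (v ` (I - U)) \<noteq> UNIV}"

definition bernoulli_index :: "('i \<Rightarrow> real ^ 'd) \<Rightarrow> 'i set \<Rightarrow> 'i set \<Rightarrow> (real ^ 'd) set" where
  "bernoulli_index v I U = {\<alpha>\<in>int_vecs. \<alpha> \<noteq> 0 \<and> (\<forall>i\<in>I - U. v i \<bullet> \<alpha> = 0)}"

text \<open>
  For \<open>U \<in> Lambda_sets v I\<close> the index set consists of the nonzero multiples of such a vector,
  which is unique up to sign; the sign does not affect symmetric partial sums.
\<close>
definition bernoulli_direction :: "('i \<Rightarrow> real ^ 'd) \<Rightarrow> 'i set \<Rightarrow> 'i set \<Rightarrow> real ^ 'd" where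
  "bernoulli_direction v I U =
     (SOME a. a \<in> int_vecs \<and> a \<noteq> 0 \<and>
        bernoulli_index v I U = {of_int k *\<^sub>R a | k :: int. k \<noteq> 0})"

definition bernoulli_term ::
    "('i \<Rightarrow> real ^ 'd) \<Rightarrow> 'i set \<Rightarrow> real ^ 'd \<Rightarrow> real ^ 'd \<Rightarrow> complex" where
  "bernoulli_term v U x \<alpha> =
     (\<Prod>i\<in>U. 1 / (2 * of_real pi * \<i> * of_real (\<alpha> \<bullet> v i))) *
     exp (2 * of_real pi * \<i> * of_real (\<alpha> \<bullet> x))"

definition bernoulli_spline ::
    "('i \<Rightarrow> real ^ 'd) \<Rightarrow> 'i set \<Rightarrow> 'i set \<Rightarrow> real ^ 'd \<Rightarrow> complex" where
  "bernoulli_spline v I U x =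
     (if rho v I \<ge> 1 then (\<Sum>\<^sub>\<infinity>\<alpha>\<in>bernoulli_index v I U. bernoulli_term v U x \<alpha>)
      else lim (\<lambda>N :: nat. \<Sum>k\<in>{- int N..int N} - {0}.
             bernoulli_term v U x (of_int k *\<^sub>R bernoulli_direction v I U)))"

definition partial_deriv :: "'d \<Rightarrow> (real ^ 'd \<Rightarrow> real) \<Rightarrow> real ^ 'd \<Rightarrow> real" where
  "partial_deriv j f x = deriv (\<lambda>t. f (x + t *\<^sub>R axis j 1)) 0"

text \<open>
  The partial derivative \<open>D\<^sup>\<beta> f\<close>. The index type carries no order, so some list of
  directions in which each \<open>j\<close> occurs \<open>\<beta> $ j\<close> times is used; for smooth \<open>f\<close> its order is
  immaterial.
\<close>
definition multi_deriv :: "nat ^ 'd \<Rightarrow> (real ^ 'd \<Rightarrow> real) \<Rightarrow> real ^ 'd \<Rightarrow> real" where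
  "multi_deriv \<beta> f = foldr partial_deriv (SOME js. \<forall>j. count_list js j = \<beta> $ j) f"

text \<open>
  The differentiated polynomial is homogeneous of degree \<open>card U\<close>; for \<open>\<beta>\<close> of that order the
  derivative is constant, so that the point of evaluation is immaterial.
\<close>
definition bernoulli_coeff ::
    "('i \<Rightarrow> real ^ 'd) \<Rightarrow> nat ^ 'd \<Rightarrow> 'i set \<Rightarrow> real" where
  "bernoulli_coeff v \<beta> U = multi_deriv \<beta> (\<lambda>x. \<Prod>i\<in>U. x \<bullet> v i) 0"

end

theory Submission
  imports Defs "HOL-Probability.Sinc_Integral"
begin

text \<open>
  Write \<open>K\<close> for a finite set of \<open>rho + 1\<close> indices and expand the monomial as a product over \<open>K\<close>.
  Since \<open>y + \<gamma> = (x + y) - (x - \<gamma>)\<close>, the projection of the monomial at \<open>x\<close> is a combination of the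
  periodizations \<open>G S\<close> of \<open>x\<^sup>S B\<close>, \<open>S \<subseteq> K\<close>. The Fourier coefficient of \<open>G S\<close> at \<open>\<alpha> \<noteq> 0\<close> is an
  integral over the unit cube; expanding the product of sums, a term survives only if it contains
  every \<open>u\<^sub>i\<close> with \<open>\<alpha> \<bullet> v i \<noteq> 0\<close>, and there are at least \<open>rho + 1\<close> of these. Hence \<open>G S\<close> is constant
  for \<open>S \<noteq> K\<close>, and \<open>G K\<close> is, up to a constant and a sign, the asserted combination of Bernoulli
  splines. The constants combine into moments: the lower ones reproduce polynomials because of
  biorthogonality, and the last one vanishes because the error is orthogonal to \<open>B\<close>.
\<close>

section \<open>Lattice periodization\<close>

text \<open>The integral identity determines \<open>B\<close> only up to a null set, so comparing
  Fourier coefficients yields every statement about periodizations almost everywhere at first. If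
  \<open>rho v I\<close> is at least 1, an explicit density of the box measure is continuous, the
  chosen representative is continuous too, the Bernoulli series converge absolutely, and equality
  holds everywhere. If \<open>rho v I = 0\<close>, the series converge conditionally to sawtooth
  functions with jumps; equality at a point of continuity is recovered by averaging over
  \<open>x + h\<close> and \<open>x - h\<close>, which the symmetric partial sums respect.

  The elements of \<open>K\<close> are positions in a list of directions. The same list governs the
  derivative, so both the constants of the theorem and the Fourier coefficients of degree
  \<open>rho v I + 1\<close> turn into sums over bijections from \<open>K\<close> to
  \<open>U\<close>.

  The sign \<open>(- 1) ^ (rho v I + 1)\<close> occurs twice, from expanding in
  \<open>x - \<gamma>\<close> and from passing between a frequency and its negative, and cancels.
  Monomials are not square integrable, so orthogonality of the error cannot be quoted from Hilbert
  space theory; the decay of \<open>\<phi>\<close> and finite sums replace it.\<close>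

definition chi :: "real ^ 'd \<Rightarrow> real ^ 'd \<Rightarrow> complex" where
  "chi a x = exp (2 * of_real pi * \<i> * of_real (a \<bullet> x))"

lemma chi_add_right: "chi a (x + y) = chi a x * chi a y"
  by (simp add: chi_def inner_add_right distrib_left exp_add)

lemma chi_add_left: "chi (a + b) x = chi a x * chi b x"
  by (simp add: chi_def inner_add_left distrib_left exp_add)

lemma chi_zero [simp]: "chi 0 x = 1" "chi a 0 = 1"
  by (simp_all add: chi_def)

lemma norm_chi [simp]: "cmod (chi a x) = 1"
  by (simp add: chi_def norm_exp_eq_Re)

lemma continuous_on_chi [continuous_intros]:
  "continuous_on S f \<Longrightarrow> continuous_on S (\<lambda>x. chi a (f x))"
  unfolding chi_def by (intro continuous_intros)

lemma borel_measurable_chi [measurable]: "chi a \<in> borel_measurable borel"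
  by (intro borel_measurable_continuous_onI continuous_on_chi continuous_on_id)

lemma chi_int:
  assumes "a \<in> int_vecs" "g \<in> int_vecs"
  shows "chi a g = 1"
proof -
  have "a \<bullet> g \<in> \<int>"
    using assms unfolding inner_vec_def int_vecs_def by (auto intro!: Ints_sum Ints_mult)
  then obtain k :: int where k: "a \<bullet> g = of_int k" by (auto elim: Ints_cases)
  have "chi a g = exp (2 * of_int k * of_real pi * \<i>)"
    by (simp add: chi_def k mult_ac)
  also have "\<dots> = 1" by (simp only: exp_eq_1, auto)
  finally show ?thesis .
qed

lemma chi_uminus_left: "chi (- a) x = cnj (chi a x)"
  unfolding chi_def by (simp add: exp_cnj)

section \<open>The integer lattice and its finite truncations\<close>

lemma int_vecs_0 [simp]: "0 \<in> int_vecs"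
  by (simp add: int_vecs_def)

lemma int_vecs_add: "a \<in> int_vecs \<Longrightarrow> b \<in> int_vecs \<Longrightarrow> a + b \<in> int_vecs"
  by (auto simp: int_vecs_def)

lemma int_vecs_diff: "a \<in> int_vecs \<Longrightarrow> b \<in> int_vecs \<Longrightarrow> a - b \<in> int_vecs"
  by (auto simp: int_vecs_def)

lemma int_vecs_uminus: "a \<in> int_vecs \<Longrightarrow> - a \<in> int_vecs"
  by (auto simp: int_vecs_def)

lemma int_vecs_uminus_iff [simp]: "- a \<in> int_vecs \<longleftrightarrow> a \<in> int_vecs"
  using int_vecs_uminus[of a] int_vecs_uminus[of "- a"] by auto

lemma int_vecs_scale: "a \<in> int_vecs \<Longrightarrow> of_int k *\<^sub>R a \<in> int_vecs"
  by (auto simp: int_vecs_def)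

lemma int_vecs_inner: "a \<in> int_vecs \<Longrightarrow> b \<in> int_vecs \<Longrightarrow> a \<bullet> b \<in> \<int>"
  unfolding inner_vec_def int_vecs_def by (auto intro!: Ints_sum Ints_mult)

lemma int_vecs_axis: "axis j 1 \<in> int_vecs"
  by (auto simp: int_vecs_def axis_def)

text \<open>The functions summed over all lattice translates vanish outside a ball, so such a sum is
  at each point a finite sum over \<open>lat r\<close> for every sufficiently large
  \<open>r\<close>. The sets grow with \<open>r\<close>, which makes \<open>lat (real n)\<close> an
  exhausting sequence.\<close>

definition lat :: "real \<Rightarrow> (real ^ 'd) set" where
  "lat r = {g \<in> int_vecs. norm g \<le> r}"

lemma lat_subset: "lat r \<subseteq> int_vecs" by (auto simp: lat_def)

lemma finite_lat [simp]: "finite (lat r :: (real ^ 'd) set)"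
proof -
  let ?F = "Pi\<^sub>E (UNIV :: 'd set) (\<lambda>_. {- \<lceil>r\<rceil>..\<lceil>r\<rceil>})"
  have "(lat r :: (real ^ 'd) set) \<subseteq> (\<lambda>f. \<chi> j. of_int (f j)) ` ?F"
  proof
    fix g :: "real ^ 'd" assume g: "g \<in> lat r"
    have 1: "of_int \<lfloor>g $ j\<rfloor> = g $ j" for j
      using g by (auto simp: lat_def int_vecs_def)
    have 2: "\<bar>g $ j\<bar> \<le> r" for j
      using g component_le_norm_cart[of g j] by (auto simp: lat_def)
    have "\<lfloor>g $ j\<rfloor> \<in> {- \<lceil>r\<rceil>..\<lceil>r\<rceil>}" for j
    proof -
      have "of_int \<lfloor>g $ j\<rfloor> \<le> r" "- r \<le> of_int \<lfloor>g $ j\<rfloor>"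
        using 1[of j] 2[of j] by linarith+
      then show ?thesis
        by (smt (verit) atLeastAtMost_iff le_of_int_ceiling of_int_le_iff of_int_minus)
    qed
    then have "(\<lambda>j. \<lfloor>g $ j\<rfloor>) \<in> ?F" by auto
    moreover have "g = (\<chi> j. of_int \<lfloor>g $ j\<rfloor>)" by (simp add: vec_eq_iff 1)
    ultimately show "g \<in> (\<lambda>f. \<chi> j. of_int (f j)) ` ?F" by (intro image_eqI[where x="\<lambda>j. \<lfloor>g $ j\<rfloor>"])
  qed
  moreover have "finite ?F" by (intro finite_PiE) auto
  ultimately show ?thesis by (meson finite_imageI finite_subset)
qed

lemma countable_int_vecs [simp]: "countable (int_vecs :: (real ^ 'd) set)"
proof -
  have "(int_vecs :: (real ^ 'd) set) \<subseteq> (\<Union>n::nat. lat (real n))"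
    using real_arch_simple by (auto simp: lat_def)
  moreover have "countable (\<Union>n::nat. (lat (real n) :: (real ^ 'd) set))"
    by (rule countable_UN[OF countableI_type countable_finite[OF finite_lat]])
  ultimately show ?thesis by (rule countable_subset)
qed

text \<open>Half-open, so that the integer translates tile the space without overlap: the shift of a
  point into the cube exists and is unique at every point, not only almost everywhere.\<close>

definition qcube :: "(real ^ 'd) set" where
  "qcube = {x. \<forall>j. 0 \<le> x $ j \<and> x $ j < 1}"

lemma qcube_borel [measurable]: "(qcube :: (real ^ 'd) set) \<in> sets borel"
proof -
  have eq: "qcube = (\<Inter>j. {x :: real ^ 'd. 0 \<le> x $ j} \<inter> {x. x $ j < 1})"
    by (auto simp: qcube_def)
  show ?thesis unfolding eq
    by (intro sets.finite_INT sets.Int borel_closed borel_open)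
       (auto intro!: closed_Collect_le open_Collect_less continuous_intros)
qed

lemma norm_qcube: "x \<in> qcube \<Longrightarrow> norm (x :: real ^ 'd) \<le> CARD('d)"
proof -
  assume x: "x \<in> qcube"
  have "norm x \<le> (\<Sum>j\<in>UNIV. \<bar>x $ j\<bar>)" by (rule norm_le_l1_cart)
  also have "\<dots> \<le> (\<Sum>j\<in>(UNIV :: 'd set). 1)"
    using x by (intro sum_mono) (auto simp: qcube_def intro: less_imp_le)
  finally show ?thesis by simp
qed

lemma box_subset_qcube: "box 0 1 \<subseteq> (qcube :: (real ^ 'd) set)"
  by (auto simp: mem_box_cart qcube_def less_imp_le)

lemma qcube_subset_cbox: "(qcube :: (real ^ 'd) set) \<subseteq> cbox 0 1"
  by (auto simp: mem_box_cart qcube_def less_imp_le)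

lemma emeasure_qcube: "emeasure lborel (qcube :: (real ^ 'd) set) = 1"
proof -
  have 1: "emeasure lborel (cbox 0 1 :: (real ^ 'd) set) = 1" "emeasure lborel (box 0 1 :: (real ^ 'd) set) = 1"
    by (simp_all add: emeasure_lborel_cbox_eq emeasure_lborel_box_eq Basis_vec_def axis_eq_axis inner_axis prod.neutral)
  have "emeasure lborel (qcube :: (real ^ 'd) set) \<le> 1"
    unfolding 1(1)[symmetric] by (intro emeasure_mono qcube_subset_cbox) auto
  moreover have "1 \<le> emeasure lborel (qcube :: (real ^ 'd) set)"
    unfolding 1(2)[symmetric] by (intro emeasure_mono box_subset_qcube) auto
  ultimately show ?thesis by (rule antisym)
qed

lemma measure_qcube: "measure lborel (qcube :: (real ^ 'd) set) = 1"
  by (simp add: measure_def emeasure_qcube)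

lemma qcube_shift_ex: "\<exists>g\<in>int_vecs. (x :: real ^ 'd) + g \<in> qcube"
proof
  let ?g = "(\<chi> j. - of_int \<lfloor>x $ j\<rfloor>) :: real ^ 'd"
  show "x + ?g \<in> qcube" by (auto simp: qcube_def) linarith
  show "?g \<in> int_vecs" by (auto simp: int_vecs_def)
qed

lemma qcube_shift_unique:
  assumes "g \<in> int_vecs" "h \<in> int_vecs" "(x :: real ^ 'd) + g \<in> qcube" "x + h \<in> qcube"
  shows "g = h"
proof -
  have "g $ j = h $ j" for j
  proof -
    have "\<bar>g $ j - h $ j\<bar> < 1" using assms(3,4) unfolding qcube_def by (auto simp: abs_if) (smt (verit))+
    moreover have "g $ j - h $ j \<in> \<int>" using assms(1,2) by (auto simp: int_vecs_def)
    ultimately show ?thesis using Ints_nonzero_abs_less1 by fastforce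
  qed
  then show ?thesis by (simp add: vec_eq_iff)
qed

definition perio :: "(real ^ 'd \<Rightarrow> complex) \<Rightarrow> real ^ 'd \<Rightarrow> complex" where
  "perio f x = (\<Sum>\<^sub>\<infinity>g\<in>int_vecs. f (x - g))"

text \<open>The radius \<open>r\<close> depends only on the support radius and on a bound for the
  point, so one finite sum represents \<open>perio f\<close> on a whole ball. Continuity and
  integrability of periodizations rest on this local finiteness.\<close>

lemma perio_eq_sum:
  fixes x :: "real ^ 'd"
  assumes "\<And>z. norm z > R \<Longrightarrow> f z = 0" "norm x \<le> s" "R + s \<le> r"
  shows "perio f x = (\<Sum>g\<in>lat r. f (x - g))"
proof -
  have "(\<Sum>\<^sub>\<infinity>g\<in>int_vecs. f (x - g)) = (\<Sum>\<^sub>\<infinity>g\<in>lat r. f (x - g))"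
  proof (rule infsum_cong_neutral)
    fix g :: "real ^ 'd" assume "g \<in> int_vecs - lat r"
    then have "norm g > R + norm x" using assms by (auto simp: lat_def)
    then have "norm (x - g) > R"
      by (smt (verit) norm_minus_commute norm_triangle_sub)
    then show "f (x - g) = 0" by (rule assms)
  qed (use lat_subset in auto)
  then show ?thesis by (simp add: perio_def)
qed

lemma perio_tendsto:
  fixes x :: "real ^ 'd"
  assumes "\<And>z. norm z > R \<Longrightarrow> f z = 0"
  shows "eventually (\<lambda>n::nat. (\<Sum>g\<in>lat (real n). f (x - g)) = perio f x) sequentially"
proof -
  obtain N :: nat where N: "R + norm x \<le> real N" using real_arch_simple by blast
  show ?thesis
    using eventually_ge_at_top[of N]
  proof eventually_elim
    case (elim n)
    then show ?case using perio_eq_sum[OF assms order_refl, where x=x and r="real n"] N by simp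
  qed
qed

lemma perio_shift: "a \<in> int_vecs \<Longrightarrow> perio f (x + a) = perio f x"
proof -
  assume a: "a \<in> int_vecs"
  have "bij_betw (\<lambda>g. g + a) int_vecs int_vecs"
    by (rule bij_betwI[where g="\<lambda>g. g - a"]) (use a in \<open>auto intro: int_vecs_add int_vecs_diff\<close>)
  from infsum_reindex_bij_betw[OF this, of "\<lambda>g. f (x + a - g)"] show ?thesis
    by (simp add: perio_def)
qed

lemma borel_measurable_perio:
  fixes f :: "real ^ 'd \<Rightarrow> complex"
  assumes "f \<in> borel_measurable borel" "\<And>z. norm z > R \<Longrightarrow> f z = 0"
  shows "perio f \<in> borel_measurable borel"
proof (rule borel_measurable_LIMSEQ_metric)
  show "(\<lambda>x. \<Sum>g\<in>lat (real n). f (x - g)) \<in> borel_measurable borel" for n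
    using assms(1) by measurable
  show "(\<lambda>n. \<Sum>g\<in>lat (real n). f (x - g)) \<longlonglongrightarrow> perio f x" for x
    by (rule tendsto_eventually) (rule perio_tendsto[OF assms(2)])
qed

lemma continuous_perio:
  fixes f :: "real ^ 'd \<Rightarrow> complex"
  assumes "continuous_on UNIV f" "\<And>z. norm z > R \<Longrightarrow> f z = 0"
  shows "continuous_on UNIV (perio f)"
proof -
  have "continuous_on (ball 0 s) (perio f)" for s
  proof -
    have "continuous_on (ball 0 s) (\<lambda>x. \<Sum>g\<in>lat (R + s). f (x - g))"
      by (intro continuous_intros continuous_on_compose2[OF assms(1)]) auto
    moreover have "\<And>x. x \<in> ball 0 s \<Longrightarrow> perio f x = (\<Sum>g\<in>lat (R + s). f (x - g))"
      by (rule perio_eq_sum[OF assms(2)]) auto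
    ultimately show ?thesis by (metis (no_types, lifting) continuous_on_cong)
  qed
  then have "isCont (perio f) x" for x
    by (meson continuous_on_eq_continuous_at mem_ball_0 open_ball gt_ex)
  then show ?thesis by (simp add: continuous_at_imp_continuous_on)
qed

lemma continuous_bounded_cball:
  fixes f :: "'a::euclidean_space \<Rightarrow> 'b::real_normed_vector"
  assumes "continuous_on UNIV f"
  obtains M where "\<And>w. norm w \<le> r \<Longrightarrow> norm (f w) \<le> M"
proof -
  have "bounded (f ` cball 0 r)"
    by (intro compact_imp_bounded compact_continuous_image continuous_on_subset[OF assms]) auto
  then obtain M where "\<forall>y\<in>f ` cball 0 r. norm y \<le> M" unfolding bounded_iff by blast
  then show thesis by (intro that[of M]) auto
qed

section \<open>Translation invariance and unfolding\<close>

lemma lborel_shift_integral: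
  fixes f :: "'a::euclidean_space \<Rightarrow> 'b::{banach,second_countable_topology}"
  assumes "f \<in> borel_measurable borel"
  shows "(LINT x|lborel. f (x + a)) = (LINT x|lborel. f x)"
  using integral_distr[of "(+) a" lborel borel f] assms
  by (simp add: lborel_distr_plus add.commute)

lemma lborel_shift_integrable:
  fixes f :: "'a::euclidean_space \<Rightarrow> 'b::{banach,second_countable_topology}"
  assumes "integrable lborel f"
  shows "integrable lborel (\<lambda>x. f (x + a))"
  using integrable_distr_eq[of "(+) a" lborel borel f] assms
  by (simp add: lborel_distr_plus add.commute)

lemma AE_lborel_shift:
  assumes "AE x in lborel. P (x :: 'a::euclidean_space)"
  shows "AE x in lborel. P (x + a)"
proof -
  have "AE x in distr lborel borel ((+) a). P x" using assms unfolding lborel_distr_plus .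
  from AE_distrD[OF _ this] show ?thesis by (simp add: add.commute)
qed

text \<open>Unfolding: translating the term of \<open>g\<close> back moves the cube instead of
  \<open>f\<close>, and the moved cubes tile the space. Bounded support keeps the sum finite, so sum
  and integral may be exchanged without a convergence theorem.\<close>

lemma periodization:
  fixes f :: "real ^ 'd \<Rightarrow> complex"
  assumes f: "integrable lborel f" and R: "\<And>z. norm z > R \<Longrightarrow> f z = 0"
  shows "set_integrable lborel qcube (perio f)"
    and "(LINT x:qcube|lborel. perio f x) = (LINT x|lborel. f x)"
proof -
  \<comment> \<open>\<open>CARD('d)\<close> bounds the norm on the cube, so this set serves twice:
    it carries all nonzero terms of \<open>perio f\<close> on the cube, and it contains the shift
    that brings any point of the ball of radius \<open>R\<close> into the cube.\<close>
  define A where "A = (lat (R + CARD('d)) :: (real ^ 'd) set)"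
  have [measurable]: "f \<in> borel_measurable borel" using f by auto
  have eq: "indicator qcube x *\<^sub>R perio f x = (\<Sum>g\<in>A. indicator qcube x *\<^sub>R f (x - g))" for x
  proof (cases "x \<in> qcube")
    case True
    then show ?thesis
      using perio_eq_sum[OF R norm_qcube[OF True] order_refl] by (simp add: A_def scaleR_sum_right)
  qed simp
  have int1: "integrable lborel (\<lambda>x. indicator qcube x *\<^sub>R f (x - g))" for g
    using lborel_shift_integrable[OF f, of "- g"]
    by (intro integrable_mult_indicator) auto
  show "set_integrable lborel qcube (perio f)"
    unfolding set_integrable_def eq using int1 by auto
  have int2: "integrable lborel (\<lambda>x. indicator qcube (x + g) *\<^sub>R f x)" for g
    using lborel_shift_integrable[OF int1[of g], of g] by simp
  have pt: "(\<Sum>g\<in>A. indicator qcube (x + g) *\<^sub>R f x) = f x" for x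
  proof (cases "norm x > R")
    case False
    obtain g where g: "g \<in> int_vecs" "x + g \<in> qcube" using qcube_shift_ex by blast
    have "norm g \<le> norm (x + g) + norm x"
      by (metis add.commute add_diff_cancel_left' norm_triangle_ineq4)
    then have gA: "g \<in> A" using norm_qcube[OF g(2)] False g by (auto simp: A_def lat_def)
    have "(\<Sum>h\<in>A. indicator qcube (x + h) *\<^sub>R f x) = (\<Sum>h\<in>A. if h = g then f x else 0)"
    proof (rule sum.cong)
      fix h assume "h \<in> A"
      then have "h \<in> int_vecs" using lat_subset by (auto simp: A_def)
      then have "x + h \<in> qcube \<longleftrightarrow> h = g" using qcube_shift_unique[of h g x] g by blast
      then show "indicator qcube (x + h) *\<^sub>R f x = (if h = g then f x else 0)"
        by (simp add: indicator_def)
    qed simp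
    then show ?thesis using gA by (simp add: A_def)
  qed (simp add: R)
  have "(LINT x:qcube|lborel. perio f x) = (\<Sum>g\<in>A. LINT x|lborel. indicator qcube x *\<^sub>R f (x - g))"
    unfolding set_lebesgue_integral_def eq using int1 by (subst Bochner_Integration.integral_sum) auto
  also have "\<dots> = (\<Sum>g\<in>A. LINT x|lborel. indicator qcube (x + g) *\<^sub>R f x)"
  proof (rule sum.cong)
    fix g
    show "(LINT x|lborel. indicator qcube x *\<^sub>R f (x - g)) = (LINT x|lborel. indicator qcube (x + g) *\<^sub>R f x)"
      using lborel_shift_integral[of "\<lambda>x. indicator qcube x *\<^sub>R f (x - g)" g] by simp
  qed simp
  also have "\<dots> = (LINT x|lborel. (\<Sum>g\<in>A. indicator qcube (x + g) *\<^sub>R f x))"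
    using int2 by (subst Bochner_Integration.integral_sum) auto
  finally show "(LINT x:qcube|lborel. perio f x) = (LINT x|lborel. f x)" by (simp add: pt)
qed

lemma set_integrable_qcube_bounded:
  fixes f :: "real ^ 'd \<Rightarrow> complex"
  assumes "f \<in> borel_measurable borel" "\<And>x. cmod (f x) \<le> K"
  shows "set_integrable lborel qcube f"
  unfolding set_integrable_def
proof (rule Bochner_Integration.integrable_bound)
  show "integrable lborel (\<lambda>x. K * indicator qcube x :: real)"
    by (intro integrable_mult_right integrable_real_indicator) (simp_all add: emeasure_qcube)
  show "AE x in lborel. norm (indicator qcube x *\<^sub>R f x) \<le> norm (K * indicator qcube x)"
    using assms(2) order_trans[OF norm_ge_zero assms(2)]
    by (auto simp: indicator_def abs_of_nonneg)
qed (use assms(1) in measurable)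

text \<open>
  A translation by \<open>y\<close> with \<open>chi a y = -1\<close> changes the sign of the integral.
\<close>
lemma integral_qcube_chi:
  assumes a: "(a :: real ^ 'd) \<in> int_vecs"
  shows "(LINT x:qcube|lborel. chi a x) = (if a = 0 then 1 else 0)"
proof (cases "a = 0")
  case True
  then show ?thesis
    using measure_qcube[where ?'d='d] by (simp add: set_lebesgue_integral_def measure_qcube scaleR_conv_of_real)
next
  case False
  then obtain j where j: "a $ j \<noteq> 0" by (metis vec_eq_iff zero_index)
  define y where "y = (axis j (1 / (2 * a $ j)) :: real ^ 'd)"
  have ay: "a \<bullet> y = 1/2" using j by (simp add: y_def inner_axis)
  then have "2 * complex_of_real pi * \<i> * of_real (a \<bullet> y) = of_real pi * \<i>" unfolding ay by simp
  then have y: "chi a y = -1" unfolding chi_def by (simp only: exp_pi_i)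
  \<comment> \<open>This is \<open>chi a\<close> cut off to the translate of the cube by
    \<open>y\<close>. That translate is again a fundamental domain, so the periodization of
    \<open>f\<close> is \<open>chi a\<close>, and the integrals over the two cubes coincide.\<close>
  define f where "f = (\<lambda>x. indicator qcube (x - y) *\<^sub>R chi a x)"
  have f0: "f z = 0" if "norm z > norm y + CARD('d)" for z
  proof -
    have "norm (z - y) > CARD('d)" using that norm_triangle_ineq2[of z y] by linarith
    then show ?thesis using norm_qcube[of "z - y"] by (auto simp: f_def indicator_def)
  qed
  have [measurable]: "f \<in> borel_measurable borel" unfolding f_def by measurable
  have s: "f (x + y) = - (indicator qcube x *\<^sub>R chi a x)" for x
    by (simp add: f_def chi_add_right y)
  have i: "integrable lborel (\<lambda>x. f (x + y))"
    unfolding s using set_integrable_qcube_bounded[of "chi a" 1]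
    by (auto simp: set_integrable_def)
  have fi: "integrable lborel f" using lborel_shift_integrable[OF i, of "- y"] by simp
  have "perio f x = chi a x" for x
  proof -
    obtain g where g: "g \<in> int_vecs" "x - y + g \<in> qcube" using qcube_shift_ex by blast
    have "perio f x = (\<Sum>\<^sub>\<infinity>h\<in>{- g}. f (x - h))"
      unfolding perio_def
    proof (rule infsum_cong_neutral)
      fix h assume "h \<in> int_vecs - {- g}"
      then have "x - y + (- h) \<notin> qcube"
        using qcube_shift_unique[of "- h" g "x - y"] g int_vecs_uminus[of h] by auto
      then show "f (x - h) = 0" by (simp add: f_def algebra_simps)
    qed (use g in auto)
    also have "\<dots> = chi a x"
      using g by (simp add: f_def algebra_simps chi_add_right chi_int[OF a])
    finally show ?thesis .
  qed
  then have "(LINT x:qcube|lborel. chi a x) = (LINT x|lborel. f x)"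
    using periodization(2)[OF fi f0] by simp
  also have "\<dots> = (LINT x|lborel. f (x + y))" by (rule lborel_shift_integral[symmetric]) measurable
  also have "\<dots> = - (LINT x:qcube|lborel. chi a x)" by (simp add: s set_lebesgue_integral_def)
  finally show ?thesis using False by simp
qed

section \<open>Uniqueness of Fourier coefficients on the torus\<close>

text \<open>The positive part of \<open>w\<close> is the density of a finite Borel measure
  \<open>M\<close>, and such a measure is inner regular. Compact sets inside the region
  \<open>P\<close> of positivity have \<open>M\<close>-measure zero by hypothesis, hence so has
  \<open>P\<close>.\<close>

lemma AE_nonpos_if_compact_integrals:
  fixes w :: "'a::euclidean_space \<Rightarrow> real"
  assumes w: "integrable lborel w" and O: "S \<in> sets borel"
    and K: "\<And>K. compact K \<Longrightarrow> K \<subseteq> S \<Longrightarrow> (LINT x|lborel. indicator K x * w x) = 0"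
  shows "AE x in lborel. x \<in> S \<longrightarrow> w x \<le> 0"
proof -
  have [measurable]: "w \<in> borel_measurable borel" "S \<in> sets borel" using w O by auto
  define M where "M = density lborel (\<lambda>x. ennreal (max 0 (w x)))"
  define P where "P = {x \<in> S. w x > 0}"
  have P[measurable]: "P \<in> sets borel" unfolding P_def by measurable
  have "emeasure M (space M) = (\<integral>\<^sup>+x. ennreal (max 0 (w x)) \<partial>lborel)"
    unfolding M_def by (subst emeasure_density) auto
  also have "\<dots> \<le> (\<integral>\<^sup>+x. ennreal (norm (w x)) \<partial>lborel)"
    by (intro nn_integral_mono ennreal_leI) auto
  also have "\<dots> < \<infinity>" using w by (simp add: integrable_iff_bounded)
  finally have fin: "emeasure M (space M) \<noteq> \<infinity>" by auto
  have "emeasure M P = (SUP K\<in>{K. K \<subseteq> P \<and> compact K}. emeasure M K)"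
    by (rule inner_regular[OF _ fin P]) (simp add: M_def)
  also have "\<dots> = (SUP K\<in>{K. K \<subseteq> P \<and> compact K}. 0)"
  proof (rule SUP_cong)
    fix K assume "K \<in> {K. K \<subseteq> P \<and> compact K}"
    then have KP: "K \<subseteq> P" "compact K" by auto
    have [measurable]: "K \<in> sets borel" using KP(2) by (rule borel_compact)
    have "emeasure M K = (\<integral>\<^sup>+x. ennreal (max 0 (w x)) * indicator K x \<partial>lborel)"
      unfolding M_def by (subst emeasure_density) auto
    also have "\<dots> = (\<integral>\<^sup>+x. ennreal (indicator K x * w x) \<partial>lborel)"
      using KP(1) by (intro nn_integral_cong) (auto simp: P_def indicator_def max_def)
    also have "\<dots> = ennreal (LINT x|lborel. indicator K x * w x)"
      using KP(1) integrable_real_mult_indicator[OF _ w, of K]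
      by (intro nn_integral_eq_integral AE_I2) (auto simp: P_def indicator_def mult.commute)
    also have "\<dots> = 0"
    proof -
      have "K \<subseteq> S" using KP(1) by (auto simp: P_def)
      then show ?thesis using K[OF KP(2)] by simp
    qed
    finally show "emeasure M K = 0" .
  qed simp
  also have "\<dots> = 0" by (simp add: SUP_constant bot_ennreal)
  finally have "(\<integral>\<^sup>+x. ennreal (max 0 (w x)) * indicator P x \<partial>lborel) = 0"
    unfolding M_def by (subst (asm) emeasure_density) auto
  then have "AE x in lborel. ennreal (max 0 (w x)) * indicator P x = 0"
    by (subst (asm) nn_integral_0_iff_AE) auto
  then show ?thesis
    by eventually_elim (auto simp: P_def indicator_def split: if_splits)
qed

lemma AE_zero_if_compact_integrals:
  fixes w :: "'a::euclidean_space \<Rightarrow> real"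
  assumes w: "integrable lborel w" and O: "S \<in> sets borel"
    and K: "\<And>K. compact K \<Longrightarrow> K \<subseteq> S \<Longrightarrow> (LINT x|lborel. indicator K x * w x) = 0"
  shows "AE x in lborel. x \<in> S \<longrightarrow> w x = 0"
proof -
  have "AE x in lborel. x \<in> S \<longrightarrow> w x \<le> 0"
    by (rule AE_nonpos_if_compact_integrals[OF assms])
  moreover have "AE x in lborel. x \<in> S \<longrightarrow> - w x \<le> 0"
    by (rule AE_nonpos_if_compact_integrals[OF _ O]) (use w K in auto)
  ultimately show ?thesis by eventually_elim auto
qed

text \<open>Equals 1 on \<open>A\<close> and, for positive \<open>n\<close>, 0 beyond distance 1/n:
  continuous approximations of the indicator of a closed set. The distance to the empty set is 0 by
  convention, so the empty set has to be treated apart.\<close>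

definition closed_bump :: "'a::metric_space set \<Rightarrow> nat \<Rightarrow> 'a \<Rightarrow> real" where
  "closed_bump A n z = max 0 (1 - real n * infdist z A)"

lemma closed_bump_bounds: "0 \<le> closed_bump A n z" "closed_bump A n z \<le> 1"
  by (auto simp: closed_bump_def infdist_nonneg)

lemma continuous_on_closed_bump: "continuous_on S (closed_bump A n)"
  unfolding closed_bump_def by (intro continuous_intros)

lemma closed_bump_tendsto:
  assumes "closed A" "A \<noteq> {}"
  shows "(\<lambda>n. closed_bump A n z) \<longlonglongrightarrow> indicator A z"
proof (cases "z \<in> A")
  case True
  then show ?thesis by (simp add: closed_bump_def)
next
  case False
  then have d: "infdist z A > 0" using infdist_pos_not_in_closed[OF assms] by simp
  obtain N :: nat where N: "1 / infdist z A \<le> real N" using real_arch_simple by blast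
  have "eventually (\<lambda>n. closed_bump A n z = 0) sequentially"
    using eventually_ge_at_top[of N]
  proof eventually_elim
    case (elim n)
    then have "1 / infdist z A \<le> real n" using N by linarith
    then have "1 \<le> real n * infdist z A" using d by (simp add: field_simps)
    then show ?case by (simp add: closed_bump_def)
  qed
  then show ?thesis using False by (simp add: tendsto_eventually)
qed

text \<open>Serves to identify \<open>B\<close> with an explicitly constructed density, since both
  have the same integrals against continuous functions. Dominated convergence passes from bumps to
  indicators of compact sets.\<close>

lemma AE_zero_if_continuous_integrals:
  fixes w :: "'a::euclidean_space \<Rightarrow> real"
  assumes w: "integrable lborel w"
    and f: "\<And>f. continuous_on UNIV f \<Longrightarrow> (LINT x|lborel. f x * w x) = 0"
  shows "AE x in lborel. w x = 0"
proof -
  have [measurable]: "w \<in> borel_measurable borel" using w by auto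
  have "(LINT x|lborel. indicator K x * w x) = 0" if K: "compact K" for K
  proof (cases "K = {}")
    case False
    have [measurable]: "closed_bump K n \<in> borel_measurable borel" for n
      by (intro borel_measurable_continuous_onI continuous_on_closed_bump)
    have [measurable]: "K \<in> sets borel" using K by (rule borel_compact)
    have "(\<lambda>n. LINT x|lborel. closed_bump K n x * w x) \<longlonglongrightarrow> (LINT x|lborel. indicator K x * w x)"
    proof (rule integral_dominated_convergence[where w="\<lambda>x. norm (w x)"])
      show "AE x in lborel. (\<lambda>n. closed_bump K n x * w x) \<longlonglongrightarrow> indicator K x * w x"
        using closed_bump_tendsto[OF compact_imp_closed[OF K] False] by (auto intro!: tendsto_mult)
      show "AE x in lborel. norm (closed_bump K n x * w x) \<le> norm (w x)" for n
        using closed_bump_bounds[of K n] by (auto simp: abs_mult mult_left_le_one_le)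
    qed (use w in auto)
    then show ?thesis
      by (simp add: f[OF continuous_on_closed_bump] LIMSEQ_const_iff)
  qed simp
  from AE_zero_if_compact_integrals[OF w _ this, of UNIV] show ?thesis by auto
qed

text \<open>Generated without reference to a set of frequencies or to coefficients, so that
  boundedness, continuity and orthogonality follow by rule induction. Products need no rule because
  frequencies add.\<close>

inductive trigp :: "(real ^ 'd \<Rightarrow> complex) \<Rightarrow> bool" where
  mono: "a \<in> int_vecs \<Longrightarrow> trigp (\<lambda>x. c * chi a x)"
| add: "trigp f \<Longrightarrow> trigp g \<Longrightarrow> trigp (\<lambda>x. f x + g x)"

lemma trigp_const: "trigp (\<lambda>x. c)"
  using trigp.mono[of 0 c] by simp

lemma trigp_mult: "trigp f \<Longrightarrow> trigp g \<Longrightarrow> trigp (\<lambda>x. f x * g x)"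
proof (induction rule: trigp.induct)
  case (mono a c)
  from mono(2) mono(1) show ?case
  proof (induction rule: trigp.induct)
    case (mono b c')
    have "(\<lambda>x. c * chi a x * (c' * chi b x)) = (\<lambda>x. (c * c') * chi (a + b) x)"
      by (auto simp: chi_add_left)
    then show ?case using trigp.mono[OF int_vecs_add[OF mono(2) mono(1)], of "c * c'"] by simp
  next
    case (add f g)
    then show ?case using trigp.add by (simp add: distrib_left)
  qed
next
  case (add f1 f2)
  then show ?case using trigp.add by (simp add: distrib_right)
qed

lemma trigp_sum: "(\<And>b. b \<in> S \<Longrightarrow> trigp (f b)) \<Longrightarrow> trigp (\<lambda>x. \<Sum>b\<in>S. f b x)"
proof (induction S rule: infinite_finite_induct)
  case (insert b S)
  then have "trigp (\<lambda>x. f b x + (\<Sum>b\<in>S. f b x))" by (intro trigp.add) auto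
  with insert show ?case by simp
qed (auto intro: trigp_const)

lemma trigp_Re: "a \<in> int_vecs \<Longrightarrow> trigp (\<lambda>x. of_real (Re (chi a x)))"
proof -
  assume a: "a \<in> int_vecs"
  have "trigp (\<lambda>x. 1/2 * chi a x + 1/2 * chi (- a) x)"
    using a by (intro trigp.intros) auto
  moreover have "of_real (Re (chi a x)) = 1/2 * chi a x + 1/2 * chi (- a) x" for x
    using complex_add_cnj[of "chi a x"] by (simp add: chi_uminus_left field_simps)
  ultimately show ?thesis by simp
qed

lemma trigp_Im: "a \<in> int_vecs \<Longrightarrow> trigp (\<lambda>x. of_real (Im (chi a x)))"
proof -
  assume a: "a \<in> int_vecs"
  have "trigp (\<lambda>x. 1/(2*\<i>) * chi a x + (- 1/(2*\<i>)) * chi (- a) x)"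
    using a by (intro trigp.intros) auto
  moreover have "of_real (Im (chi a x)) = 1/(2*\<i>) * chi a x + (- 1/(2*\<i>)) * chi (- a) x" for x
    using complex_diff_cnj[of "chi a x"] by (simp add: chi_uminus_left field_simps)
  ultimately show ?thesis by simp
qed

text \<open>Embeds the torus, the quotient by \<open>int_vecs\<close>, into a bounded part of a
  Euclidean space. Questions about periodic functions become questions about continuous functions on
  a ball, where polynomial approximation is available.\<close>

definition torus_map :: "real ^ 'd \<Rightarrow> complex ^ 'd" where
  "torus_map x = (\<chi> j. chi (axis j 1) x)"

lemma continuous_on_torus_map: "continuous_on S torus_map"
  unfolding torus_map_def by (intro continuous_intros)

lemma norm_torus_map: "norm (torus_map (x :: real ^ 'd)) \<le> CARD('d)"
proof -
  have "norm (torus_map x) \<le> (\<Sum>j\<in>UNIV. norm (torus_map x $ j))"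
    by (simp add: norm_vec_def L2_set_le_sum)
  then show ?thesis by (simp add: torus_map_def)
qed

lemma torus_map_inj:
  assumes "x \<in> qcube" "y \<in> qcube" "torus_map x = torus_map (y :: real ^ 'd)"
  shows "x = y"
proof -
  have "x $ j = y $ j" for j
  proof -
    have "chi (axis j 1) x = chi (axis j 1) y"
      using assms(3) by (simp add: torus_map_def vec_eq_iff)
    then have "exp (2 * complex_of_real pi * \<i> * of_real (x $ j)) = exp (2 * complex_of_real pi * \<i> * of_real (y $ j))"
      by (simp add: chi_def inner_axis')
    then obtain n :: int where "2 * complex_of_real pi * \<i> * of_real (x $ j) =
        2 * complex_of_real pi * \<i> * of_real (y $ j) + of_real (of_int (2 * n) * pi) * \<i>"
      unfolding exp_eq by blast
    from arg_cong[OF this, of Im] have n: "2 * pi * x $ j = 2 * pi * y $ j + of_int (2 * n) * pi"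
      by simp
    then have "2 * pi * (x $ j - y $ j - of_int n) = 0" by (simp add: algebra_simps)
    then have "x $ j - y $ j = of_int n" by simp
    moreover have "0 \<le> x $ j" "x $ j < 1" "0 \<le> y $ j" "y $ j < 1"
      using assms(1,2) by (auto simp: qcube_def)
    ultimately have "\<bar>of_int n :: real\<bar> < 1" by linarith
    then have "n = 0" by linarith
    with \<open>x $ j - y $ j = of_int n\<close> show ?thesis by simp
  qed
  then show ?thesis by (simp add: vec_eq_iff)
qed

text \<open>A real polynomial on \<open>complex ^ 'd\<close> is built from the real and imaginary
  parts of the coordinates. On the image of \<open>torus_map\<close> these are combinations of
  \<open>chi\<close> at plus and minus a unit vector.\<close>

lemma trigp_polynomial:
  "real_polynomial_function p \<Longrightarrow> trigp (\<lambda>x. of_real (p (torus_map x)))"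
proof (induction rule: real_polynomial_function.induct)
  case (linear f)
  interpret f: bounded_linear f by fact
  have f_eq: "f z = (\<Sum>b\<in>Basis. (z \<bullet> b) * f b)" for z :: "complex ^ 'a"
  proof -
    have "f z = f (\<Sum>b\<in>Basis. (z \<bullet> b) *\<^sub>R b)" by (simp add: euclidean_representation)
    then show ?thesis by (simp add: f.sum f.scaleR)
  qed
  have eq: "(\<lambda>x. complex_of_real (f (torus_map x))) =
      (\<lambda>x. \<Sum>b\<in>Basis. of_real (f b) * of_real (torus_map x \<bullet> b))"
    by (subst f_eq) (simp add: mult.commute)
  show ?case unfolding eq
  proof (rule trigp_sum)
    fix b :: "complex ^ 'a" assume "b \<in> Basis"
    then obtain j u where b: "b = axis j u" "u \<in> Basis" by (auto simp: Basis_vec_def)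
    have "u = 1 \<or> u = \<i>" using b(2) by (simp add: Basis_complex_def)
    then show "trigp (\<lambda>x. of_real (f b) * of_real (torus_map x \<bullet> b))"
      using trigp_mult[OF trigp_const trigp_Re[OF int_vecs_axis]]
        trigp_mult[OF trigp_const trigp_Im[OF int_vecs_axis]]
      by (auto simp: b(1) inner_axis torus_map_def inner_complex_def)
  qed
next
  case (const c)
  show ?case by (rule trigp_const)
next
  case (add f g)
  show ?case using trigp.add[OF add.IH] by simp
next
  case (mult f g)
  show ?case using trigp_mult[OF mult.IH] by simp
qed

lemma trigp_continuous: "trigp f \<Longrightarrow> continuous_on S f"
  by (induction rule: trigp.induct) (auto intro!: continuous_intros)

lemma set_integrable_qcube_mult:
  fixes h k :: "real ^ 'd \<Rightarrow> complex"
  assumes h: "set_integrable lborel qcube h" and "k \<in> borel_measurable borel"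
    and "\<And>x. cmod (k x) \<le> C"
  shows "set_integrable lborel qcube (\<lambda>x. h x * k x)"
  unfolding set_integrable_def
proof (rule Bochner_Integration.integrable_bound)
  show "integrable lborel (\<lambda>x. C * norm (indicator qcube x *\<^sub>R h x))"
    using h by (intro integrable_mult_right integrable_norm) (simp add: set_integrable_def)
  have [measurable]: "(\<lambda>x. indicator qcube x *\<^sub>R h x) \<in> borel_measurable borel"
    using h by (auto simp: set_integrable_def)
  have "(\<lambda>x. (indicator qcube x *\<^sub>R h x) * k x) \<in> borel_measurable borel"
    using assms(2) by measurable
  then show "(\<lambda>x. indicator qcube x *\<^sub>R (h x * k x)) \<in> borel_measurable lborel" by simp
  have "0 \<le> C" using norm_ge_zero assms(3) by (rule order_trans)
  then show "AE x in lborel. norm (indicator qcube x *\<^sub>R (h x * k x)) \<le> norm (C * norm (indicator qcube x *\<^sub>R h x))"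
    using assms(3) by (intro AE_I2) (auto simp: norm_mult indicator_def abs_mult mult.commute[of C] intro!: mult_left_mono)
qed

lemma trigp_bounded: "trigp f \<Longrightarrow> \<exists>C. \<forall>x. cmod (f x) \<le> C"
proof (induction rule: trigp.induct)
  case (mono a c)
  then show ?case by (auto simp: norm_mult)
next
  case (add f g)
  then show ?case by (metis add_mono norm_triangle_le)
qed

lemma trigp_orthogonal:
  fixes h :: "real ^ 'd \<Rightarrow> complex"
  assumes h: "set_integrable lborel qcube h"
    and z: "\<And>a. a \<in> int_vecs \<Longrightarrow> (LINT x:qcube|lborel. h x * chi a x) = 0"
    and f: "trigp f"
  shows "(LINT x:qcube|lborel. h x * f x) = 0"
  using f
proof (induction rule: trigp.induct)
  case (mono a c)
  have "(LINT x:qcube|lborel. h x * (c * chi a x)) = (LINT x:qcube|lborel. c * (h x * chi a x))"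
    by (simp add: mult_ac)
  then show ?case using z[OF mono] by simp
next
  case (add f g)
  have i: "set_integrable lborel qcube (\<lambda>x. h x * f x)" if "trigp f" for f
    using trigp_bounded[OF that]
    by (auto intro!: set_integrable_qcube_mult[OF h] borel_measurable_continuous_onI trigp_continuous[OF that])
  show ?case
    unfolding distrib_left set_integral_add(2)[OF i[OF add.hyps(1)] i[OF add.hyps(2)]]
    by (simp add: add.IH)
qed

text \<open>
  By Stone--Weierstrass, \<open>h\<close> is orthogonal to every \<open>k \<circ> torus_map\<close> with \<open>k\<close> continuous. Such functions
  approximate the indicator of any compact subset of the open cube, because \<open>torus_map\<close> is injective on \<open>qcube\<close>.
\<close>
lemma fourier_uniqueness:
  fixes h :: "real ^ 'd \<Rightarrow> complex"
  assumes h: "set_integrable lborel qcube h"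
    and z: "\<And>a. a \<in> int_vecs \<Longrightarrow> (LINT x:qcube|lborel. h x * chi a x) = 0"
  shows "AE x in lborel. x \<in> qcube \<longrightarrow> h x = 0"
proof -
  define H where "H = (\<lambda>x. indicator qcube x *\<^sub>R h x)"
  have H: "integrable lborel H" using h by (simp add: set_integrable_def H_def)
  have [measurable]: "H \<in> borel_measurable borel" using H by auto
  have [measurable]: "torus_map \<in> borel_measurable borel"
    by (intro borel_measurable_continuous_onI continuous_on_torus_map)
  define J where "J = (LINT x|lborel. norm (H x))"
  have J0: "J \<ge> 0" unfolding J_def by (intro Bochner_Integration.integral_nonneg) auto
  have cont: "(LINT x|lborel. H x * of_real (k (torus_map x))) = 0"
    if k: "continuous_on UNIV k" "\<And>z. \<bar>k z\<bar> \<le> 1" for k :: "complex ^ 'd \<Rightarrow> real"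
  proof -
    have ik: "integrable lborel (\<lambda>x. H x * of_real (k (torus_map x)))"
    proof (rule Bochner_Integration.integrable_bound[OF H])
      have [measurable]: "k \<in> borel_measurable borel" by (intro borel_measurable_continuous_onI k)
      show "(\<lambda>x. H x * of_real (k (torus_map x))) \<in> borel_measurable lborel" by simp
      show "AE x in lborel. norm (H x * of_real (k (torus_map x))) \<le> norm (H x)"
        using k(2) by (auto simp: norm_mult mult_left_le)
    qed
    have bnd: "cmod (LINT x|lborel. H x * of_real (k (torus_map x))) \<le> e * J" if e: "e > 0" for e
    proof -
      obtain p where p: "real_polynomial_function p"
          "\<And>z. z \<in> cball 0 (CARD('d)) \<Longrightarrow> \<bar>k z - p z\<bar> < e"
        using Stone_Weierstrass_real_polynomial_function[of "cball 0 (CARD('d))" k e]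
          continuous_on_subset[OF k(1)] e by auto
      have p': "\<bar>k (torus_map x) - p (torus_map x)\<bar> < e" for x :: "real ^ 'd"
        by (intro p) (simp add: norm_torus_map)
      note t = trigp_polynomial[OF p(1)]
      have ip: "integrable lborel (\<lambda>x. H x * of_real (p (torus_map x)))"
      proof -
        obtain C where "\<forall>x::real^'d. cmod (of_real (p (torus_map x))) \<le> C" using trigp_bounded[OF t] by blast
        then have "set_integrable lborel qcube (\<lambda>x. h x * of_real (p (torus_map x)))"
          by (intro set_integrable_qcube_mult[OF h, where C=C] borel_measurable_continuous_onI trigp_continuous[OF t]) auto
        then show ?thesis by (simp add: set_integrable_def H_def)
      qed
      have "(LINT x|lborel. H x * of_real (p (torus_map x))) = 0"
        using trigp_orthogonal[OF h z t] by (simp add: set_lebesgue_integral_def H_def)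
      then have "(LINT x|lborel. H x * of_real (k (torus_map x))) =
          (LINT x|lborel. H x * of_real (k (torus_map x)) - H x * of_real (p (torus_map x)))"
        using ik ip by simp
      also have "cmod \<dots> \<le> (LINT x|lborel. norm (H x * of_real (k (torus_map x)) - H x * of_real (p (torus_map x))))"
        by (rule integral_norm_bound)
      also have "\<dots> \<le> (LINT x|lborel. e * norm (H x))"
      proof (rule integral_mono)
        show "integrable lborel (\<lambda>x. norm (H x * of_real (k (torus_map x)) - H x * of_real (p (torus_map x))))"
          using ik ip by auto
        show "integrable lborel (\<lambda>x. e * norm (H x))" using H by (intro integrable_mult_right integrable_norm)
        fix x
        have "norm (H x * of_real (k (torus_map x)) - H x * of_real (p (torus_map x)))
            = norm (H x) * \<bar>k (torus_map x) - p (torus_map x)\<bar>"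
          by (metis norm_mult norm_of_real of_real_diff right_diff_distrib)
        also have "\<dots> \<le> norm (H x) * e" using p'[of x] by (intro mult_left_mono) auto
        finally show "norm (H x * of_real (k (torus_map x)) - H x * of_real (p (torus_map x))) \<le> e * norm (H x)"
          by (simp add: mult.commute)
      qed
      also have "\<dots> = e * J" by (simp add: J_def)
      finally show ?thesis .
    qed
    have "cmod (LINT x|lborel. H x * of_real (k (torus_map x))) \<le> 0 + e" if "e > 0" for e
    proof -
      \<comment> \<open>\<open>J + 1\<close> instead of \<open>J\<close> keeps the tolerance well
        chosen when \<open>H\<close> vanishes almost everywhere and \<open>J\<close> is 0.\<close>
      have "cmod (LINT x|lborel. H x * of_real (k (torus_map x))) \<le> (e / (J + 1)) * J"
        using bnd[of "e / (J + 1)"] that J0 by auto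
      also have "\<dots> \<le> e" using that J0 by (simp add: field_simps)
      finally show ?thesis by simp
    qed
    then have "cmod (LINT x|lborel. H x * of_real (k (torus_map x))) \<le> 0"
      by (rule field_le_epsilon)
    then show ?thesis by simp
  qed
  have comp: "(LINT x|lborel. H x * of_real (indicator K x)) = 0"
    if K: "compact K" "K \<subseteq> box 0 1" for K :: "(real ^ 'd) set"
  proof (cases "K = {}")
    case False
    define A where "A = torus_map ` K"
    have A: "closed A" "A \<noteq> {}" unfolding A_def
      using False compact_imp_closed[OF compact_continuous_image[OF continuous_on_torus_map K(1)]] by auto
    have KQ: "K \<subseteq> qcube" using K(2) box_subset_qcube by blast
    have [measurable]: "closed_bump A n \<in> borel_measurable borel" for n
      by (intro borel_measurable_continuous_onI continuous_on_closed_bump)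
    have [measurable]: "K \<in> sets borel" using K(1) by (rule borel_compact)
    have "(\<lambda>n. LINT x|lborel. H x * of_real (closed_bump A n (torus_map x)))
        \<longlonglongrightarrow> (LINT x|lborel. H x * of_real (indicator K x))"
    proof (rule integral_dominated_convergence[where w="\<lambda>x. norm (H x)"])
      show "AE x in lborel. (\<lambda>n. H x * of_real (closed_bump A n (torus_map x))) \<longlonglongrightarrow> H x * of_real (indicator K x)"
      proof (rule AE_I2)
        fix x
        \<comment> \<open>Off the cube both sides vanish with \<open>H\<close>, so injectivity of
          \<open>torus_map\<close> is needed on the cube only, where it holds because the cube is
          half-open.\<close>
        have "H x * of_real (indicator K x) = H x * of_real (indicator A (torus_map x))"
        proof (cases "x \<in> qcube")
          case True
          have "torus_map x \<in> A \<longleftrightarrow> x \<in> K"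
            using torus_map_inj[OF True] KQ unfolding A_def by blast
          then show ?thesis by (simp add: indicator_def)
        qed (simp add: H_def)
        then show "(\<lambda>n. H x * of_real (closed_bump A n (torus_map x))) \<longlonglongrightarrow> H x * of_real (indicator K x)"
          by (simp only:) (intro tendsto_mult tendsto_of_real tendsto_const closed_bump_tendsto A)
      qed
      show "AE x in lborel. norm (H x * of_real (closed_bump A n (torus_map x))) \<le> norm (H x)" for n
        using closed_bump_bounds[of A n] by (auto simp: norm_mult mult_left_le)
    qed (use H in auto)
    moreover have "(LINT x|lborel. H x * of_real (closed_bump A n (torus_map x))) = 0" for n
      by (intro cont continuous_on_closed_bump) (use closed_bump_bounds[of A n] in auto)
    ultimately show ?thesis by (simp add: LIMSEQ_const_iff)
  qed simp
  have iK: "integrable lborel (\<lambda>x. H x * of_real (indicator K x))" if "K \<in> sets borel" for K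
  proof (rule Bochner_Integration.integrable_bound[OF H])
    show "(\<lambda>x. H x * of_real (indicator K x)) \<in> borel_measurable lborel" using that by measurable
  qed (auto simp: norm_mult indicator_def)
  have "AE x in lborel. x \<in> box 0 1 \<longrightarrow> Re (H x) = 0"
  proof (rule AE_zero_if_compact_integrals)
    fix K :: "(real ^ 'd) set" assume K: "compact K" "K \<subseteq> box 0 1"
    have "(LINT x|lborel. indicator K x * Re (H x)) = (LINT x|lborel. Re (H x * of_real (indicator K x)))"
      by (intro Bochner_Integration.integral_cong) (auto simp: indicator_def)
    also have "\<dots> = Re (LINT x|lborel. H x * of_real (indicator K x))"
      by (rule integral_Re[OF iK]) (use K borel_compact in auto)
    finally show "(LINT x|lborel. indicator K x * Re (H x)) = 0" by (simp only: comp[OF K] zero_complex.simps)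
  qed (use H in \<open>auto intro: integrable_Re\<close>)
  moreover have "AE x in lborel. x \<in> box 0 1 \<longrightarrow> Im (H x) = 0"
  proof (rule AE_zero_if_compact_integrals)
    fix K :: "(real ^ 'd) set" assume K: "compact K" "K \<subseteq> box 0 1"
    have "(LINT x|lborel. indicator K x * Im (H x)) = (LINT x|lborel. Im (H x * of_real (indicator K x)))"
      by (intro Bochner_Integration.integral_cong) (auto simp: indicator_def)
    also have "\<dots> = Im (LINT x|lborel. H x * of_real (indicator K x))"
      by (rule integral_Im[OF iK]) (use K borel_compact in auto)
    finally show "(LINT x|lborel. indicator K x * Im (H x)) = 0" by (simp only: comp[OF K] zero_complex.simps)
  qed (use H in \<open>auto intro: integrable_Im\<close>)
  moreover have "AE x in lborel. x \<notin> (cbox 0 1 - box 0 1 :: (real ^ 'd) set)"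
    by (rule AE_not_in[OF null_sets_cbox_Diff_box])
  ultimately show ?thesis
  proof eventually_elim
    case (elim x)
    then show ?case using qcube_subset_cbox by (auto simp: complex_eq_iff H_def)
  qed
qed

text \<open>Countably many translates of the exceptional null set still form a null set, which is
  where countability of the lattice enters.\<close>

lemma periodic_AE_zero:
  fixes h :: "real ^ 'd \<Rightarrow> complex"
  assumes per: "\<And>a x. a \<in> int_vecs \<Longrightarrow> h (x + a) = h x"
    and z: "AE x in lborel. x \<in> qcube \<longrightarrow> h x = 0"
  shows "AE x in lborel. h x = 0"
proof -
  have "AE x in lborel. \<forall>a\<in>int_vecs. x + a \<in> qcube \<longrightarrow> h (x + a) = 0"
    by (subst AE_ball_countable) (auto intro!: AE_lborel_shift[OF z])
  then show ?thesis
  proof eventually_elim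
    case (elim x)
    then show ?case using qcube_shift_ex[of x] per by metis
  qed
qed

section \<open>Trigonometric series and the sawtooth function\<close>

lemma norm_set_integral_qcube_le:
  fixes f :: "real ^ 'd \<Rightarrow> complex"
  assumes f: "set_integrable lborel qcube f" and e: "\<And>x. cmod (f x) \<le> e"
  shows "cmod (LINT x:qcube|lborel. f x) \<le> e"
proof -
  have "cmod (LINT x:qcube|lborel. f x) \<le> (LINT x|lborel. norm (indicator qcube x *\<^sub>R f x))"
    unfolding set_lebesgue_integral_def by (rule integral_norm_bound)
  also have "\<dots> \<le> (LINT x|lborel. e * indicator (qcube :: (real ^ 'd) set) x)"
  proof (rule integral_mono)
    show "integrable lborel (\<lambda>x. norm (indicator qcube x *\<^sub>R f x))"
      using f unfolding set_integrable_def by (rule integrable_norm)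
    show "integrable lborel (\<lambda>x. e * indicator (qcube :: (real ^ 'd) set) x :: real)"
      by (intro integrable_mult_right integrable_real_indicator) (simp_all add: emeasure_qcube)
  qed (auto simp: indicator_def e)
  also have "\<dots> = e" by (simp add: measure_qcube)
  finally show ?thesis .
qed

lemma integral_qcube_chi_mult:
  assumes "a \<in> int_vecs" "b \<in> int_vecs"
  shows "(LINT x:qcube|lborel. chi a x * chi b x) = (if a = - b then 1 else 0)"
  using integral_qcube_chi[OF int_vecs_add[OF assms]]
  by (simp add: chi_add_left add_eq_0_iff2)

text \<open>Coefficients are taken against \<open>chi b\<close> without conjugation, so the
  frequency read off is \<open>- b\<close>. With this convention the coefficient of a periodization
  is a plain exponential moment; the reflected frequency is accounted for in
  \<open>G_AE\<close>.\<close>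

lemma fourier_coeff_finite_sum:
  assumes F: "finite F" "F \<subseteq> int_vecs" and b: "b \<in> int_vecs"
  shows "(LINT x:qcube|lborel. (\<Sum>a\<in>F. c a * chi a x) * chi b x) = (if - b \<in> F then c (- b) else 0)"
proof -
  have i: "set_integrable lborel qcube (\<lambda>x. c a * (chi a x * chi b x))" for a
    by (rule set_integrable_qcube_bounded[where K="cmod (c a)"]) (auto simp: norm_mult)
  have "(LINT x:qcube|lborel. (\<Sum>a\<in>F. c a * chi a x) * chi b x) =
      (LINT x:qcube|lborel. (\<Sum>a\<in>F. c a * (chi a x * chi b x)))"
    by (simp add: sum_distrib_right mult.assoc)
  also have "\<dots> = (\<Sum>a\<in>F. LINT x:qcube|lborel. c a * (chi a x * chi b x))"
    using i unfolding set_lebesgue_integral_def set_integrable_def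
    by (simp add: scaleR_sum_right)
  also have "\<dots> = (\<Sum>a\<in>F. if a = - b then c a else 0)"
    using F b by (intro sum.cong) (auto simp: integral_qcube_chi_mult subset_iff)
  finally show ?thesis using F(1) by simp
qed

text \<open>Convergence along finite subsets is uniform by the M-test. No exchange of limit and
  integral is required: one finite set that is uniformly close and contains \<open>- b\<close>, if
  \<open>S\<close> does, already has the exact coefficient, and the difference contributes at most
  \<open>e\<close>.\<close>

lemma abs_trig_series:
  fixes S :: "(real ^ 'd) set"
  assumes S: "S \<subseteq> int_vecs" and c: "(\<lambda>a. cmod (c a)) summable_on S"
  defines "f \<equiv> (\<lambda>x. \<Sum>\<^sub>\<infinity>a\<in>S. c a * chi a x)"
  shows continuous_abs_trig_series: "continuous_on UNIV f"
    and bounded_abs_trig_series: "cmod (f x) \<le> (\<Sum>\<^sub>\<infinity>a\<in>S. cmod (c a))"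
    and fourier_coeff_abs_trig_series: "b \<in> int_vecs \<Longrightarrow>
      (LINT x:qcube|lborel. f x * chi b x) = (if - b \<in> S then c (- b) else 0)"
proof -
  have ul: "uniform_limit UNIV (\<lambda>F x. \<Sum>a\<in>F. c a * chi a x) f (finite_subsets_at_top S)"
    unfolding f_def by (rule Weierstrass_m_test_general[OF _ c]) (simp add: norm_mult)
  show cont: "continuous_on UNIV f"
    by (rule uniform_limit_theorem[OF _ ul])
       (auto intro!: always_eventually continuous_intros)
  have n: "(\<lambda>a. norm (c a * chi a x)) = (\<lambda>a. cmod (c a))" for x by (simp add: norm_mult)
  show bd: "cmod (f x) \<le> (\<Sum>\<^sub>\<infinity>a\<in>S. cmod (c a))" for x
    unfolding f_def using norm_infsum_bound[of "\<lambda>a. c a * chi a x" S] c by (simp add: n)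
  assume b: "b \<in> int_vecs"
  let ?v = "if - b \<in> S then c (- b) else 0"
  have fm: "f \<in> borel_measurable borel" using cont by (rule borel_measurable_continuous_onI)
  have "cmod ((LINT x:qcube|lborel. f x * chi b x) - ?v) \<le> 0 + e" if e: "e > 0" for e
  proof -
    have "\<forall>\<^sub>F F in finite_subsets_at_top S. \<forall>x\<in>UNIV. dist (\<Sum>a\<in>F. c a * chi a x) (f x) < e"
      using uniform_limitD[OF ul e] .
    moreover have "\<forall>\<^sub>F F in finite_subsets_at_top S. finite F \<and> F \<subseteq> S \<and> ({- b} \<inter> S \<subseteq> F)"
      unfolding eventually_finite_subsets_at_top by (intro exI[of _ "{- b} \<inter> S"]) auto
    ultimately have "\<forall>\<^sub>F F in finite_subsets_at_top S.
        (\<forall>x\<in>UNIV. dist (\<Sum>a\<in>F. c a * chi a x) (f x) < e) \<and> finite F \<and> F \<subseteq> S \<and> ({- b} \<inter> S \<subseteq> F)"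
      by eventually_elim auto
    from eventually_happens'[OF finite_subsets_at_top_neq_bot this]
    obtain F where F: "\<And>x. dist (\<Sum>a\<in>F. c a * chi a x) (f x) < e" "finite F" "F \<subseteq> S"
        "{- b} \<inter> S \<subseteq> F"
      by auto
    have v: "?v = (LINT x:qcube|lborel. (\<Sum>a\<in>F. c a * chi a x) * chi b x)"
      using fourier_coeff_finite_sum[OF F(2) _ b] F(3,4) S by auto
    have i1: "set_integrable lborel qcube (\<lambda>x. f x * chi b x)"
      using fm bd by (intro set_integrable_qcube_bounded[where K="\<Sum>\<^sub>\<infinity>a\<in>S. cmod (c a)"]) (auto simp: norm_mult)
    have i2: "set_integrable lborel qcube (\<lambda>x. (\<Sum>a\<in>F. c a * chi a x) * chi b x)"
      by (intro set_integrable_qcube_bounded[where K="\<Sum>a\<in>F. cmod (c a)"])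
         (auto simp: norm_mult intro!: sum_norm_le)
    have "(LINT x:qcube|lborel. f x * chi b x) - ?v =
        (LINT x:qcube|lborel. f x * chi b x - (\<Sum>a\<in>F. c a * chi a x) * chi b x)"
      unfolding v by (rule set_integral_diff(2)[OF i1 i2, symmetric])
    also have "cmod \<dots> \<le> e"
    proof (rule norm_set_integral_qcube_le[OF set_integral_diff(1)[OF i1 i2]])
      fix x
      have "cmod (f x * chi b x - (\<Sum>a\<in>F. c a * chi a x) * chi b x) = dist (\<Sum>a\<in>F. c a * chi a x) (f x)"
        by (simp add: left_diff_distrib[symmetric] norm_mult dist_norm norm_minus_commute)
      then show "cmod (f x * chi b x - (\<Sum>a\<in>F. c a * chi a x) * chi b x) \<le> e" using F(1)[of x] by simp
    qed
    finally show ?thesis by simp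
  qed
  then have "cmod ((LINT x:qcube|lborel. f x * chi b x) - ?v) \<le> 0" by (rule field_le_epsilon)
  then show "(LINT x:qcube|lborel. f x * chi b x) = ?v" by simp
qed

text \<open>Abel summation: multiplication by \<open>1 - z\<close> replaces the coefficients 1/k by
  the differences 1/(k+1) - 1/(k+2) = 1/((k+1)(k+2)), which are summable. The last term is the
  boundary term with denominator \<open>N\<close>, whence \<open>N\<close> is at least 1.\<close>

lemma ln_one_minus_partial_sum:
  fixes z :: complex
  assumes "N \<ge> 1"
  shows "(1 - z) * (\<Sum>k=1..N. z ^ k / of_nat k) =
    z - (\<Sum>k<N - 1. z ^ (k + 2) / of_nat ((k + 1) * (k + 2))) - z ^ (N + 1) / of_nat N"
  using assms
proof (induction N rule: dec_induct)
  case base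
  then show ?case by (simp add: power2_eq_square algebra_simps)
next
  case (step n)
  have e: "(1::complex) / of_nat n - 1 / of_nat (Suc n) = 1 / of_nat (n * Suc n)"
  proof -
    have "1 / x - 1 / (1 + x) = 1 / (x * (1 + x))" if "x \<noteq> 0" "1 + x \<noteq> 0" for x :: complex
      using that by (simp add: divide_simps)
    from this[of "of_nat n"] show ?thesis
      using step(1) of_nat_neq_0[of n, where 'a=complex] by (simp add: distrib_left)
  qed
  obtain m where m: "n = Suc m" using step(1) by (cases n) auto
  have "(1 - z) * (\<Sum>k=1..Suc n. z ^ k / of_nat k) =
      (1 - z) * (\<Sum>k=1..n. z ^ k / of_nat k) + (1 - z) * (z ^ Suc n / of_nat (Suc n))"
    by (simp add: distrib_left)
  also have "\<dots> = z - (\<Sum>k<n - 1. z ^ (k + 2) / of_nat ((k + 1) * (k + 2)))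
      - z ^ Suc n * (1 / of_nat n - 1 / of_nat (Suc n)) - z ^ (Suc n + 1) / of_nat (Suc n)"
    unfolding step.IH by (simp add: algebra_simps diff_divide_distrib)
  also have "\<dots> = z - (\<Sum>k<Suc n - 1. z ^ (k + 2) / of_nat ((k + 1) * (k + 2))) - z ^ (Suc n + 1) / of_nat (Suc n)"
    unfolding e by (simp add: m)
  finally show ?case .
qed

text \<open>Keeps \<open>1 - z\<close> off the branch cut of \<open>ln\<close> on the closed disc
  punctured at 1, so that \<open>ln (1 - z)\<close> is continuous there.\<close>

lemma one_minus_notin_nonpos_Reals:
  fixes z :: complex
  assumes z: "cmod z \<le> 1" "z \<noteq> 1"
  shows "1 - z \<notin> \<real>\<^sub>\<le>\<^sub>0"
proof
  assume "1 - z \<in> \<real>\<^sub>\<le>\<^sub>0"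
  then have "Re z \<ge> 1" "Im z = 0" by (auto simp: complex_nonpos_Reals_iff)
  moreover have "Re z \<le> 1" using complex_Re_le_cmod[of z] z(1) by linarith
  ultimately have "z = 1" by (simp add: complex_eq_iff)
  then show False using z(2) by simp
qed

text \<open>
  Summation by parts turns the conditionally convergent series into one that converges uniformly on
  the closed disc, so that the identity extends from the interior by continuity.
\<close>
lemma ln_one_minus_sums:
  fixes z :: complex
  assumes z: "cmod z \<le> 1" "z \<noteq> 1"
  shows "(\<lambda>N. \<Sum>k=1..N. z ^ k / of_nat k) \<longlonglongrightarrow> - ln (1 - z)"
proof -
  define T where "T = (\<lambda>w :: complex. \<Sum>k. w ^ (k + 2) / of_nat ((k + 1) * (k + 2)))"
  define h where "h = (\<lambda>w. w - T w)"
  have sm: "summable (\<lambda>k. 1 / real ((k + 1) * (k + 2)))"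
  proof (rule summable_comparison_test'[where N=0])
    show "summable (\<lambda>n. inverse (real (Suc n) ^ 2))"
      using inverse_power_summable[of 2, where 'a=real] by (subst summable_Suc_iff) simp
    fix n :: nat
    have "real (Suc n) ^ 2 \<le> real ((n + 1) * (n + 2))" by (simp add: power2_eq_square algebra_simps)
    then have "inverse (real ((n + 1) * (n + 2))) \<le> inverse (real (Suc n) ^ 2)"
      by (rule le_imp_inverse_le) simp
    moreover have "norm (1 / real m) = inverse (real m)" for m by (simp add: inverse_eq_divide)
    ultimately show "norm (1 / real ((n + 1) * (n + 2))) \<le> inverse (real (Suc n) ^ 2)" by metis
  qed
  have bd: "cmod (w ^ (k + 2) / of_nat ((k + 1) * (k + 2))) \<le> 1 / real ((k + 1) * (k + 2))" if "cmod w \<le> 1" for w k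
    unfolding norm_divide norm_power norm_of_nat
    by (intro divide_right_mono power_le_one that) auto
  have ul: "uniform_limit (cball 0 1) (\<lambda>n w. \<Sum>k<n. w ^ (k + 2) / of_nat ((k + 1) * (k + 2))) T sequentially"
    unfolding T_def by (rule Weierstrass_m_test[OF _ sm]) (use bd in auto)
  have "continuous_on (cball 0 1) T"
    by (rule uniform_limit_theorem[OF _ ul]) (auto intro!: always_eventually continuous_intros simp del: of_nat_mult of_nat_add of_nat_Suc)
  then have conth: "continuous_on (cball 0 1) h" unfolding h_def by (intro continuous_intros)
  have lim: "(\<lambda>N. (1 - w) * (\<Sum>k=1..N. w ^ k / of_nat k)) \<longlonglongrightarrow> h w" if w: "cmod w \<le> 1" for w
  proof -
    have "(\<lambda>n. \<Sum>k<n. w ^ (k + 2) / of_nat ((k + 1) * (k + 2))) \<longlonglongrightarrow> T w"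
      using tendsto_uniform_limitI[OF ul, of w] w by simp
    then have t1: "(\<lambda>n. \<Sum>k<n - 1. w ^ (k + 2) / of_nat ((k + 1) * (k + 2))) \<longlonglongrightarrow> T w"
      by (rule filterlim_compose) (simp add: filterlim_minus_const_nat_at_top)
    have "(\<lambda>n. w ^ (n + 1) / of_nat n) \<longlonglongrightarrow> 0"
    proof (rule Lim_null_comparison)
      show "\<forall>\<^sub>F n in sequentially. cmod (w ^ (n + 1) / of_nat n) \<le> 1 / real n"
        unfolding norm_divide norm_power norm_of_nat
        by (intro always_eventually allI divide_right_mono power_le_one w) auto
    qed (rule lim_1_over_n)
    from tendsto_diff[OF tendsto_diff[OF tendsto_const t1] this, of w]
    have "(\<lambda>N. w - (\<Sum>k<N - 1. w ^ (k + 2) / of_nat ((k + 1) * (k + 2))) - w ^ (N + 1) / of_nat N) \<longlonglongrightarrow> h w"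
      by (simp add: h_def)
    then show ?thesis
    proof (rule Lim_transform_eventually)
      show "\<forall>\<^sub>F N in sequentially. w - (\<Sum>k<N - 1. w ^ (k + 2) / of_nat ((k + 1) * (k + 2))) - w ^ (N + 1) / of_nat N
          = (1 - w) * (\<Sum>k=1..N. w ^ k / of_nat k)"
        using eventually_ge_at_top[of 1] by eventually_elim (rule ln_one_minus_partial_sum[symmetric])
    qed
  qed
  have inside: "h w = - ((1 - w) * ln (1 - w))" if w: "cmod w < 1" for w
  proof -
    have "(\<lambda>n. w ^ n / of_nat n) sums (- ln (1 - w))"
      using sums_minus[OF Ln_series'[of "- w"]] w by simp
    then have "(\<lambda>N. \<Sum>k<N. w ^ k / of_nat k) \<longlonglongrightarrow> - ln (1 - w)" by (simp add: sums_def)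
    then have "(\<lambda>N. \<Sum>k<Suc N. w ^ k / of_nat k) \<longlonglongrightarrow> - ln (1 - w)" by (rule LIMSEQ_Suc)
    moreover have "(\<Sum>k<Suc N. w ^ k / of_nat k) = (\<Sum>k=1..N. w ^ k / of_nat k)" for N
      by (induction N) auto
    ultimately have "(\<lambda>N. \<Sum>k=1..N. w ^ k / of_nat k) \<longlonglongrightarrow> - ln (1 - w)" by simp
    then have "(\<lambda>N. (1 - w) * (\<Sum>k=1..N. w ^ k / of_nat k)) \<longlonglongrightarrow> (1 - w) * - ln (1 - w)"
      by (intro tendsto_mult tendsto_const)
    with lim[of w] w show ?thesis by (auto dest: LIMSEQ_unique)
  qed
  note nn = one_minus_notin_nonpos_Reals[OF z]
  \<comment> \<open>Radii increasing from 1/2 to 1, so that the points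
    \<open>of_real (r n) * z\<close> stay in the open disc, where \<open>ln\<close> has its power
    series.\<close>
  define r where "r = (\<lambda>n::nat. 1 - 1 / real (n + 2))"
  have r: "0 \<le> r n" "r n < 1" for n by (auto simp: r_def field_simps)
  have rl: "r \<longlonglongrightarrow> 1" unfolding r_def by real_asymp
  have rz: "(\<lambda>n. of_real (r n) * z) \<longlonglongrightarrow> z"
    using tendsto_mult[OF tendsto_of_real[OF rl] tendsto_const[of z]] by simp
  have rz1: "cmod (of_real (r n) * z) < 1" for n
  proof -
    have "r n * cmod z \<le> r n * 1" using r(1)[of n] z(1) by (intro mult_left_mono)
    then show ?thesis using r[of n] by (simp add: norm_mult)
  qed
  have "(\<lambda>n. h (of_real (r n) * z)) \<longlonglongrightarrow> h z"
    by (rule continuous_on_tendsto_compose[OF conth rz]) (use z rz1 in \<open>auto intro!: always_eventually less_imp_le\<close>)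
  moreover have "(\<lambda>n. h (of_real (r n) * z)) \<longlonglongrightarrow> - ((1 - z) * ln (1 - z))"
    unfolding inside[OF rz1] by (intro tendsto_intros rz nn)
  ultimately have hz: "h z = - ((1 - z) * ln (1 - z))" by (rule LIMSEQ_unique)
  have "(\<lambda>N. (1 - z) * (\<Sum>k=1..N. z ^ k / of_nat k) / (1 - z)) \<longlonglongrightarrow> - ((1 - z) * ln (1 - z)) / (1 - z)"
    using lim[OF z(1)] z(2) unfolding hz by (intro tendsto_divide tendsto_const) auto
  then show ?thesis using z(2) by simp
qed

text \<open>On the open unit interval this is 1/2 - t, because 1 - exp (2 pi i t) has argument pi (t
  - 1/2) there. The logarithmic form matches the power series of \<open>ln (1 - z)\<close>; the
  value 0 at integers is both the limit of the symmetric sums and the mean of the one-sided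
  limits.\<close>

definition sawtooth :: "real \<Rightarrow> real" where
  "sawtooth t = (if cis (2 * pi * t) = 1 then 0 else - Im (ln (1 - cis (2 * pi * t))) / pi)"

lemma symmetric_int_sum:
  fixes f :: "int \<Rightarrow> 'a::comm_monoid_add"
  shows "(\<Sum>k\<in>{- int N..int N} - {0}. f k) = (\<Sum>k=1..N. f (int k) + f (- int k))"
proof (induction N)
  case (Suc N)
  have "{- int (Suc N)..int (Suc N)} - {0} = insert (int (Suc N)) (insert (- int (Suc N)) ({- int N..int N} - {0}))"
    by auto
  then show ?case using Suc by (simp add: add_ac)
qed simp

text \<open>A term and its mirror image are conjugate, which leaves the imaginary part of the
  logarithmic series. The factor \<open>r\<close> covers the sawtooth series (\<open>r = 1\<close>)
  and its Abel means together.\<close>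

lemma symmetric_sum_eq_Im:
  fixes z :: complex
  shows "(\<Sum>k\<in>{- int N..int N} - {0}. of_real (r ^ nat \<bar>k\<bar>) / (2 * of_real pi * \<i> * of_int k) *
      exp (2 * of_real pi * \<i> * of_real (of_int k * t))) =
    of_real (Im (\<Sum>k=1..N. (of_real r * cis (2 * pi * t)) ^ k / of_nat k) / pi)"
proof -
  have "(of_real (r ^ nat \<bar>int k\<bar>) / (2 * of_real pi * \<i> * of_int (int k)) *
      exp (2 * of_real pi * \<i> * of_real (of_int (int k) * t))) +
    (of_real (r ^ nat \<bar>- int k\<bar>) / (2 * of_real pi * \<i> * of_int (- int k)) *
      exp (2 * of_real pi * \<i> * of_real (of_int (- int k) * t))) =
    of_real (Im ((of_real r * cis (2 * pi * t)) ^ k / of_nat k) / pi)" (is "?l = ?r") if "k \<in> {1..N}" for k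
  proof -
    have k: "k > 0" using that by auto
    define w where "w = cis (2 * pi * t) ^ k"
    have w: "w = cis (real k * (2 * pi * t))" unfolding w_def by (rule Complex.DeMoivre)
    have e1: "exp (2 * of_real pi * \<i> * of_real (of_int (int k) * t)) = w"
      unfolding w cis_conv_exp by (simp add: mult_ac)
    have e2: "exp (2 * of_real pi * \<i> * of_real (of_int (- int k) * t)) = cnj w"
      unfolding e1[symmetric] by (simp add: exp_cnj)
    have "?l = of_real (r ^ k) / (2 * of_real pi * \<i> * of_nat k) * (w - cnj w)"
      unfolding e1 e2 using k by (simp add: field_simps)
    also have "w - cnj w = 2 * \<i> * of_real (Im w)" by (simp add: complex_eq_iff)
    also have "of_real (r ^ k) / (2 * of_real pi * \<i> * of_nat k) * (2 * \<i> * of_real (Im w)) =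
        of_real (r ^ k * Im w / (real k * pi))" using k by (simp add: field_simps)
    also have "r ^ k * Im w / (real k * pi) = Im ((of_real r * cis (2 * pi * t)) ^ k / of_nat k) / pi"
    proof -
      have "(of_real r * cis (2 * pi * t)) ^ k / of_nat k = of_real (r ^ k / real k) * w"
        by (simp add: power_mult_distrib w_def)
      from arg_cong[OF this, of Im]
      have im: "Im ((of_real r * cis (2 * pi * t)) ^ k / of_nat k) = r ^ k / real k * Im w"
        by (simp only: Re_complex_of_real Im_complex_of_real times_complex.simps mult_zero_left add_0_right)
      show ?thesis unfolding im by simp
    qed
    finally show ?thesis .
  qed
  then show ?thesis
    unfolding symmetric_int_sum by (simp add: sum_divide_distrib)
qed

lemma sawtooth_sums:
  "(\<lambda>N. \<Sum>k\<in>{- int N..int N} - {0}. 1 / (2 * of_real pi * \<i> * of_int k) *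
      exp (2 * of_real pi * \<i> * of_real (of_int k * t))) \<longlonglongrightarrow> of_real (sawtooth t)"
proof -
  have eq: "(\<lambda>N. \<Sum>k\<in>{- int N..int N} - {0}. 1 / (2 * of_real pi * \<i> * of_int k) *
      exp (2 * of_real pi * \<i> * of_real (of_int k * t))) =
    (\<lambda>N. of_real (Im (\<Sum>k=1..N. cis (2 * pi * t) ^ k / of_nat k) / pi))"
    using symmetric_sum_eq_Im[of 1 t] by simp
  show ?thesis
  proof (cases "cis (2 * pi * t) = 1")
    case True
    then show ?thesis unfolding eq sawtooth_def by (simp add: Im_divide_of_nat)
  next
    case False
    have "(\<lambda>N. \<Sum>k=1..N. cis (2 * pi * t) ^ k / of_nat k) \<longlonglongrightarrow> - ln (1 - cis (2 * pi * t))"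
      by (rule ln_one_minus_sums) (use False in auto)
    then have "(\<lambda>N. complex_of_real (Im (\<Sum>k=1..N. cis (2 * pi * t) ^ k / of_nat k) / pi)) \<longlonglongrightarrow>
        of_real (Im (- ln (1 - cis (2 * pi * t))) / pi)"
      by (intro tendsto_intros) auto
    then show ?thesis unfolding eq sawtooth_def using False by simp
  qed
qed

lemma sawtooth_minus: "sawtooth (- t) = - sawtooth t"
proof -
  let ?p = "\<lambda>t N. \<Sum>k\<in>{- int N..int N} - {0}. 1 / (2 * complex_of_real pi * \<i> * of_int k) *
      exp (2 * of_real pi * \<i> * of_real (of_int k * t))"
  have "?p (- t) N = - ?p t N" for N
    unfolding sum_negf[symmetric]
    by (rule sum.reindex_bij_witness[where i=uminus and j=uminus]) auto
  then have "(\<lambda>N. - ?p t N) \<longlonglongrightarrow> of_real (sawtooth (- t))" using sawtooth_sums[of "- t"] by simp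
  from LIMSEQ_unique[OF this tendsto_minus[OF sawtooth_sums[of t]]]
  show ?thesis by (metis of_real_eq_iff of_real_minus)
qed

text \<open>At a jump \<open>sawtooth\<close> is odd about \<open>t\<close>, so the sum vanishes
  identically; elsewhere the function is continuous. This averaged continuity is what remains of
  continuity at the jumps.\<close>

lemma sawtooth_symmetric_limit:
  "((\<lambda>h. sawtooth (t + h) + sawtooth (t - h)) \<longlongrightarrow> 2 * sawtooth t) (at 0)"
proof (cases "cis (2 * pi * t) = 1")
  case True
  have "cis (2 * pi * (t + s)) = cis (2 * pi * s)" for s
    using True by (simp add: distrib_left cis_mult[symmetric])
  from this this[of "- h" for h] have "sawtooth (t + h) = sawtooth h" "sawtooth (t - h) = sawtooth (- h)" for h
    by (simp_all only: sawtooth_def diff_conv_add_uminus)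
  then show ?thesis using True by (simp add: sawtooth_minus) (simp add: sawtooth_def)
next
  case False
  have nn: "1 - cis (2 * pi * t) \<notin> \<real>\<^sub>\<le>\<^sub>0"
    by (rule one_minus_notin_nonpos_Reals) (use False in auto)
  have ic: "isCont (\<lambda>s. cis (2 * pi * s)) t"
    unfolding cis_conv_exp by (intro continuous_intros)
  have "isCont sawtooth t"
  proof -
    have c: "isCont (\<lambda>s. - Im (ln (1 - cis (2 * pi * s))) / pi) t"
      unfolding divide_inverse by (intro continuous_intros isCont_Im isCont_Ln' nn ic)
    have "\<forall>\<^sub>F s in nhds t. cis (2 * pi * s) \<noteq> 1"
    proof -
      have "((\<lambda>s. cis (2 * pi * s)) \<longlongrightarrow> cis (2 * pi * t)) (nhds t)"
        using ic by (simp add: continuous_within tendsto_nhds_iff)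
      from tendsto_imp_eventually_ne[OF this False] show ?thesis .
    qed
    then have "\<forall>\<^sub>F s in nhds t. sawtooth s = - Im (ln (1 - cis (2 * pi * s))) / pi"
      by eventually_elim (simp add: sawtooth_def)
    from isCont_cong[OF this] c show ?thesis by simp
  qed
  then have "isCont (\<lambda>h. sawtooth (t + h)) 0" "isCont (\<lambda>h. sawtooth (t - h)) 0"
    using isCont_o2[of 0 "\<lambda>h. t + h" sawtooth] isCont_o2[of 0 "\<lambda>h. t - h" sawtooth] by simp_all
  then have "isCont (\<lambda>h. sawtooth (t + h) + sawtooth (t - h)) 0"
    by (rule continuous_add)
  then show ?thesis by (simp add: isCont_def)
qed

lemma sawtooth_bound: "\<bar>sawtooth t\<bar> \<le> 1"
proof (cases "cis (2 * pi * t) = 1")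
  case False
  then have "1 - cis (2 * pi * t) \<noteq> 0" by simp
  from mpi_less_Im_Ln[OF this] Im_Ln_le_pi[OF this] show ?thesis
    by (auto simp: sawtooth_def abs_le_iff field_simps)
qed (simp add: sawtooth_def)

lemma borel_measurable_sawtooth [measurable]: "sawtooth \<in> borel_measurable borel"
proof (rule borel_measurable_LIMSEQ_metric)
  let ?p = "\<lambda>N t. \<Sum>k\<in>{- int N..int N} - {0}. 1 / (2 * complex_of_real pi * \<i> * of_int k) *
      exp (2 * of_real pi * \<i> * of_real (of_int k * t))"
  show "(\<lambda>t. Re (?p N t)) \<in> borel_measurable borel" for N
    by (intro borel_measurable_continuous_onI continuous_intros)
  show "(\<lambda>N. Re (?p N t)) \<longlonglongrightarrow> sawtooth t" for t
    using tendsto_Re[OF sawtooth_sums[of t]] by simp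
qed

lemma qcube_integral_sum:
  fixes f :: "'a \<Rightarrow> real ^ 'd \<Rightarrow> complex"
  assumes "\<And>i. i \<in> A \<Longrightarrow> set_integrable lborel qcube (f i)"
  shows "(LINT x:qcube|lborel. (\<Sum>i\<in>A. f i x)) = (\<Sum>i\<in>A. LINT x:qcube|lborel. f i x)"
  unfolding set_lebesgue_integral_def scaleR_sum_right
  using assms unfolding set_integrable_def by (rule Bochner_Integration.integral_sum)

definition damped_sawtooth :: "real \<Rightarrow> real \<Rightarrow> real" where
  "damped_sawtooth r t = - Im (ln (1 - of_real r * cis (2 * pi * t))) / pi"

text \<open>
  The partial sums of the sawtooth series do not converge uniformly. The Abel means do so for each
  \<open>r < 1\<close> and are bounded uniformly in \<open>r\<close>, since the argument of \<open>1 - z\<close> is.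
\<close>
lemma fourier_coeff_sawtooth:
  fixes a b :: "real ^ 'd"
  assumes a: "a \<in> int_vecs" "a \<noteq> 0" and b: "b \<in> int_vecs"
  shows "k \<noteq> 0 \<Longrightarrow> - b = of_int k *\<^sub>R a \<Longrightarrow>
      (LINT x:qcube|lborel. of_real (sawtooth (a \<bullet> x)) * chi b x) = 1 / (2 * of_real pi * \<i> * of_int k)"
    and "- b \<notin> {of_int k *\<^sub>R a |k :: int. k \<noteq> 0} \<Longrightarrow>
      (LINT x:qcube|lborel. of_real (sawtooth (a \<bullet> x)) * chi b x) = 0"
proof -
  define c where "c = (\<lambda>r k. complex_of_real (r ^ nat \<bar>k\<bar>) / (2 * of_real pi * \<i> * of_int k))"
  define P where "P = (\<lambda>r N x. \<Sum>k\<in>{- int N..int N} - {0}. c r k * chi (of_int k *\<^sub>R a) x)"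
  \<comment> \<open>At most one \<open>k\<close> satisfies the condition, as \<open>a\<close> is
    nonzero. Writing the coefficient as a sum over this possibly empty set treats both claims of the
    lemma by one limit.\<close>
  define V where "V = (\<lambda>r. \<Sum>k | k \<noteq> 0 \<and> of_int k *\<^sub>R a = - b. c r k)"
  have injk: "of_int k *\<^sub>R a = of_int l *\<^sub>R a \<longleftrightarrow> k = l" for k l :: int using a(2) by simp
  have Pcoeff: "(\<lambda>N. LINT x:qcube|lborel. P r N x * chi b x) \<longlonglongrightarrow> V r" for r
  proof (rule tendsto_eventually)
    let ?Z = "{k :: int. k \<noteq> 0 \<and> of_int k *\<^sub>R a = - b}"
    have "inj (\<lambda>k :: int. of_int k *\<^sub>R a)" using injk by (auto intro: injI)
    from finite_vimageI[OF _ this, of "{- b}"] have fin: "finite ?Z"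
      by (rule finite_subset[rotated]) auto
    define M where "M = (\<Sum>k\<in>?Z. nat \<bar>k\<bar>)"
    have M: "nat \<bar>k\<bar> \<le> M" if "k \<in> ?Z" for k
      unfolding M_def by (rule member_le_sum[OF that _ fin]) simp
    show "\<forall>\<^sub>F N in sequentially. (LINT x:qcube|lborel. P r N x * chi b x) = V r"
      using eventually_ge_at_top[of M]
    proof eventually_elim
      case (elim N)
      let ?K = "{- int N..int N} - {0}"
      have i: "set_integrable lborel qcube (\<lambda>x. c r k * (chi (of_int k *\<^sub>R a) x * chi b x))" for k
        by (rule set_integrable_qcube_bounded[where K="cmod (c r k)"]) (auto simp: norm_mult)
      have "(LINT x:qcube|lborel. P r N x * chi b x) =
          (LINT x:qcube|lborel. (\<Sum>k\<in>?K. c r k * (chi (of_int k *\<^sub>R a) x * chi b x)))"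
        unfolding P_def by (simp add: sum_distrib_right mult.assoc)
      also have "\<dots> = (\<Sum>k\<in>?K. LINT x:qcube|lborel. c r k * (chi (of_int k *\<^sub>R a) x * chi b x))"
        by (rule qcube_integral_sum[OF i])
      also have "\<dots> = (\<Sum>k\<in>?K. if of_int k *\<^sub>R a = - b then c r k else 0)"
        by (intro sum.cong) (auto simp: integral_qcube_chi_mult[OF int_vecs_scale[OF a(1)] b])
      also have "\<dots> = V r"
      proof -
        have "k \<in> ?K" if "k \<in> ?Z" for k
          using M[OF that] elim that by (simp; linarith)
        then have "{k \<in> ?K. of_int k *\<^sub>R a = - b} = ?Z" by blast
        then show ?thesis unfolding V_def by (simp add: sum.inter_filter[symmetric])
      qed
      finally show ?case .
    qed
  qed
  have Plim: "(\<lambda>N. P r N x) \<longlonglongrightarrow> of_real (damped_sawtooth r (a \<bullet> x))" if r: "0 \<le> r" "r < 1" for r x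
  proof -
    have "P r N x = of_real (Im (\<Sum>k=1..N. (of_real r * cis (2 * pi * (a \<bullet> x))) ^ k / of_nat k) / pi)" for N
      unfolding symmetric_sum_eq_Im[symmetric] P_def c_def chi_def by simp
    moreover have "(\<lambda>N. \<Sum>k=1..N. (of_real r * cis (2 * pi * (a \<bullet> x))) ^ k / of_nat k)
        \<longlonglongrightarrow> - ln (1 - of_real r * cis (2 * pi * (a \<bullet> x)))"
    proof (rule ln_one_minus_sums)
      have "cmod (of_real r * cis (2 * pi * (a \<bullet> x))) < 1" using r by (simp add: norm_mult)
      then show "cmod (of_real r * cis (2 * pi * (a \<bullet> x))) \<le> 1" "of_real r * cis (2 * pi * (a \<bullet> x)) \<noteq> 1" by auto
    qed
    then have "(\<lambda>N. complex_of_real (Im (\<Sum>k=1..N. (of_real r * cis (2 * pi * (a \<bullet> x))) ^ k / of_nat k) / pi)) \<longlonglongrightarrow>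
        of_real (Im (- ln (1 - of_real r * cis (2 * pi * (a \<bullet> x)))) / pi)"
      by (intro tendsto_intros) auto
    ultimately show ?thesis by (simp add: damped_sawtooth_def)
  qed
  \<comment> \<open>A geometric bound that blows up as \<open>r\<close> tends to 1. It is used at
    fixed \<open>r\<close> only, for the limit in \<open>N\<close>; the limit in \<open>r\<close>
    relies on the uniform bound \<open>dbd\<close>.\<close>
  have Pbd: "cmod (P r N x) \<le> 2 / (1 - r)" if r: "0 \<le> r" "r < 1" for r N x
  proof -
    have "cmod (P r N x) \<le> (\<Sum>k\<in>{- int N..int N} - {0}. r ^ nat \<bar>k\<bar>)"
      unfolding P_def
    proof (rule sum_norm_le)
      fix k assume "k \<in> {- int N..int N} - {0}"
      then have "1 \<le> real_of_int \<bar>k\<bar>" by auto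
      then have "1 * 1 \<le> (2 * pi) * real_of_int \<bar>k\<bar>" using pi_gt3 by (intro mult_mono) auto
      then have "r ^ nat \<bar>k\<bar> / (2 * pi * real_of_int \<bar>k\<bar>) \<le> r ^ nat \<bar>k\<bar>"
        using r(1) by (simp add: divide_le_eq mult_le_cancel_left1)
      then show "cmod (c r k * chi (of_int k *\<^sub>R a) x) \<le> r ^ nat \<bar>k\<bar>"
        using r(1) by (simp add: c_def norm_mult norm_divide norm_power)
    qed
    also have "\<dots> = 2 * (\<Sum>k=1..N. r ^ k)" unfolding symmetric_int_sum by (simp add: sum_distrib_left)
    also have "(\<Sum>k=1..N. r ^ k) \<le> (\<Sum>k. r ^ k)"
      using r by (intro sum_le_suminf summable_geometric) auto
    also have "(\<Sum>k. r ^ k) = 1 / (1 - r)" using r by (intro suminf_geometric) auto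
    finally show ?thesis by simp
  qed
  have one_int: "integrable lborel (\<lambda>x. K * indicator (qcube :: (real ^ 'd) set) x :: real)" for K
    by (intro integrable_mult_right integrable_real_indicator) (simp_all add: emeasure_qcube)
  have Pm[measurable]: "P r N \<in> borel_measurable borel" for r N unfolding P_def by measurable
  have dm: "(\<lambda>x. complex_of_real (damped_sawtooth r (a \<bullet> x))) \<in> borel_measurable borel"
    if "0 \<le> r" "r < 1" for r
    by (rule borel_measurable_LIMSEQ_metric[OF Pm Plim[OF that]])
  have damped: "(LINT x:qcube|lborel. of_real (damped_sawtooth r (a \<bullet> x)) * chi b x) = V r"
    if r: "0 \<le> r" "r < 1" for r
  proof -
    note dm[OF r, measurable]
    have "(\<lambda>N. LINT x:qcube|lborel. P r N x * chi b x) \<longlonglongrightarrow>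
        (LINT x:qcube|lborel. of_real (damped_sawtooth r (a \<bullet> x)) * chi b x)"
      unfolding set_lebesgue_integral_def
    proof (rule integral_dominated_convergence[where w="\<lambda>x. 2 / (1 - r) * indicator qcube x"])
      show "AE x in lborel. (\<lambda>N. indicator qcube x *\<^sub>R (P r N x * chi b x)) \<longlonglongrightarrow>
          indicator qcube x *\<^sub>R (of_real (damped_sawtooth r (a \<bullet> x)) * chi b x)"
        by (intro AE_I2 tendsto_intros Plim r)
      show "AE x in lborel. norm (indicator qcube x *\<^sub>R (P r N x * chi b x)) \<le> 2 / (1 - r) * indicator qcube x" for N
        using Pbd[OF r] by (intro AE_I2) (auto simp: norm_mult indicator_def)
    qed (auto intro: one_int)
    with Pcoeff[of r] show ?thesis by (rule LIMSEQ_unique[rotated])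
  qed
  define r where "r = (\<lambda>n::nat. 1 - 1 / real (n + 2))"
  have r: "0 \<le> r n" "r n < 1" for n by (auto simp: r_def field_simps)
  have rl: "r \<longlonglongrightarrow> 1" unfolding r_def by real_asymp
  have dlim: "(\<lambda>n. damped_sawtooth (r n) t) \<longlonglongrightarrow> sawtooth t" for t
  proof (cases "cis (2 * pi * t) = 1")
    case True
    \<comment> \<open>At an integer \<open>t\<close> the argument of \<open>ln\<close> is the
      positive real number \<open>1 - r n\<close>, so the Abel means vanish and agree with the value
      0 prescribed at a jump.\<close>
    have "Im (ln (1 - complex_of_real (r n))) = 0" for n
      using Im_Ln_of_real[of "1 - r n"] r(2)[of n] by simp
    then show ?thesis using True by (simp add: damped_sawtooth_def sawtooth_def)
  next
    case False
    have nn: "1 - cis (2 * pi * t) \<notin> \<real>\<^sub>\<le>\<^sub>0"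
      by (rule one_minus_notin_nonpos_Reals) (use False in auto)
    have "(\<lambda>n. - Im (ln (1 - of_real (r n) * cis (2 * pi * t))) / pi) \<longlonglongrightarrow> - Im (ln (1 - of_real 1 * cis (2 * pi * t))) / pi"
      by (intro tendsto_intros rl) (use nn in auto)
    then show ?thesis using False by (simp add: damped_sawtooth_def sawtooth_def)
  qed
  have dbd: "\<bar>damped_sawtooth (r n) t\<bar> \<le> 1" for n t
  proof -
    have "cmod (of_real (r n) * cis (2 * pi * t)) < 1" using r[of n] by (simp add: norm_mult)
    then have "1 - of_real (r n) * cis (2 * pi * t) \<noteq> 0" by auto
    from mpi_less_Im_Ln[OF this] Im_Ln_le_pi[OF this] show ?thesis
      by (auto simp: damped_sawtooth_def abs_le_iff field_simps)
  qed
  have "(\<lambda>n. LINT x:qcube|lborel. of_real (damped_sawtooth (r n) (a \<bullet> x)) * chi b x) \<longlonglongrightarrow>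
      (LINT x:qcube|lborel. of_real (sawtooth (a \<bullet> x)) * chi b x)"
    unfolding set_lebesgue_integral_def
  proof (rule integral_dominated_convergence[where w="\<lambda>x. 1 * indicator qcube x"])
    show "AE x in lborel. (\<lambda>n. indicator qcube x *\<^sub>R (of_real (damped_sawtooth (r n) (a \<bullet> x)) * chi b x)) \<longlonglongrightarrow>
        indicator qcube x *\<^sub>R (of_real (sawtooth (a \<bullet> x)) * chi b x)"
      by (intro AE_I2 tendsto_intros dlim)
    show "AE x in lborel. norm (indicator qcube x *\<^sub>R (complex_of_real (damped_sawtooth (r n) (a \<bullet> x)) * chi b x)) \<le> 1 * indicator qcube x" for n
      using dbd[of n] by (intro AE_I2) (auto simp: norm_mult indicator_def)
    show "(\<lambda>x. indicator qcube x *\<^sub>R (complex_of_real (damped_sawtooth (r n) (a \<bullet> x)) * chi b x)) \<in> borel_measurable lborel" for n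
    proof -
      note dm[OF r, measurable]
      show ?thesis by measurable
    qed
  qed (use one_int[of 1] in auto)
  then have lim: "(\<lambda>n. V (r n)) \<longlonglongrightarrow> (LINT x:qcube|lborel. of_real (sawtooth (a \<bullet> x)) * chi b x)"
    by (simp add: damped r)
  { assume "- b \<notin> {of_int k *\<^sub>R a |k :: int. k \<noteq> 0}"
    then have "{k :: int. k \<noteq> 0 \<and> of_int k *\<^sub>R a = - b} = {}" by auto
    then have "V = (\<lambda>r. 0)" unfolding V_def by (simp only: sum.empty)
    with lim show "(LINT x:qcube|lborel. of_real (sawtooth (a \<bullet> x)) * chi b x) = 0"
      by (simp add: LIMSEQ_const_iff) }
  { assume k: "k \<noteq> 0" "- b = of_int k *\<^sub>R a"
    then have "{l :: int. l \<noteq> 0 \<and> of_int l *\<^sub>R a = - b} = {k}" using injk by auto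
    then have V: "V = (\<lambda>r. c r k)" unfolding V_def by simp
    have "(\<lambda>n. c (r n) k) \<longlonglongrightarrow> complex_of_real (1 ^ nat \<bar>k\<bar>) / (2 * of_real pi * \<i> * of_int k)"
      unfolding c_def by (intro tendsto_intros rl) (use k in auto)
    with lim show "(LINT x:qcube|lborel. of_real (sawtooth (a \<bullet> x)) * chi b x) = 1 / (2 * of_real pi * \<i> * of_int k)"
      unfolding V by (auto dest: LIMSEQ_unique) }
qed

section \<open>The density of the box measure\<close>

text \<open>The defining condition speaks only of sets with exactly the given number of elements; a
  smaller \<open>W\<close> is padded to size \<open>rho v I\<close>, and removing more vectors only
  shrinks the span.\<close>

lemma rho_span:
  fixes v :: "'i \<Rightarrow> real ^ 'd"
  assumes I: "finite I" and adm: "admissible_family v I"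
    and W: "W \<subseteq> I" "card W \<le> rho v I"
  shows "span (v ` (I - W)) = UNIV"
proof -
  let ?R = "{r. r \<le> card I \<and> (\<forall>W\<subseteq>I. card W = r \<longrightarrow> span (v ` (I - W)) = UNIV)}"
  have fin: "finite ?R" by (rule finite_subset[of _ "{..card I}"]) auto
  have "0 \<in> ?R" using adm I by (auto simp: admissible_family_def dest: finite_subset)
  then have rho: "rho v I \<in> ?R" unfolding rho_def using fin by (intro Max_in) auto
  have fW: "finite W" using W(1) I by (rule finite_subset)
  have "rho v I - card W \<le> card (I - W)"
    using rho W fW by (simp add: card_Diff_subset diff_le_mono)
  then obtain X where X: "X \<subseteq> I - W" "card X = rho v I - card W"
    using obtain_subset_with_card_n by metis
  have "card (W \<union> X) = rho v I"
    using X W(2) fW finite_subset[OF X(1)] I by (subst card_Un_disjoint) auto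
  moreover have "W \<union> X \<subseteq> I" using X(1) W(1) by auto
  ultimately have "span (v ` (I - (W \<union> X))) = UNIV" using rho by blast
  moreover have "span (v ` (I - (W \<union> X))) \<subseteq> span (v ` (I - W))" by (intro span_mono) auto
  ultimately show ?thesis by auto
qed

text \<open>Indexing the basis by the coordinate type makes its parameters a point of
  \<open>real ^ 'd\<close>, on which the basis acts as a linear map.\<close>

lemma basis_enumeration:
  fixes v :: "'i \<Rightarrow> real ^ 'd"
  assumes "span (v ` I) = UNIV"
  obtains \<sigma> :: "'d \<Rightarrow> 'i" where "inj \<sigma>" "range \<sigma> \<subseteq> I" "span (range (v \<circ> \<sigma>)) = UNIV"
proof -
  obtain Bs where Bs: "Bs \<subseteq> v ` I" "independent Bs" "v ` I \<subseteq> span Bs"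
    using maximal_independent_subset by blast
  have sp: "span Bs = UNIV"
    using span_mono[OF Bs(3)] assms by (simp add: span_span) (metis top.extremum_uniqueI)
  have "card Bs = CARD('d)"
    using dim_eq_card[of Bs UNIV] sp Bs(2) by (simp add: dim_UNIV)
  moreover have "finite Bs" using Bs(2) by (rule independent_imp_finite)
  ultimately obtain h :: "'d \<Rightarrow> real ^ 'd" where h: "bij_betw h UNIV Bs"
    by (metis finite_class.finite_UNIV finite_same_card_bij)
  define \<sigma> where "\<sigma> = inv_into I v \<circ> h"
  have hB: "h j \<in> v ` I" for j using h Bs(1) by (auto simp: bij_betw_def)
  have vs: "v \<circ> \<sigma> = h" unfolding \<sigma>_def using hB by (auto simp: f_inv_into_f)
  show thesis
  proof
    show "inj \<sigma>" using vs h by (metis bij_betw_def inj_on_imageI2)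
    show "range \<sigma> \<subseteq> I" unfolding \<sigma>_def using hB by (auto simp: inv_into_into)
    show "span (range (v \<circ> \<sigma>)) = UNIV" using sp h by (simp add: vs bij_betw_def)
  qed
qed

text \<open>
  Uniqueness of Haar measure: both sides of \<open>\<mu>(A) \<nu>(B) = \<nu>(A) \<mu>(B)\<close>, with \<open>A\<close> the unit ball and \<open>\<nu>\<close> the
  image measure, equal the integral of \<open>1\<^sub>A(x) 1\<^sub>B(T y + x)\<close>. The library computes \<open>c\<close> as a determinant, but
  only for well-ordered index types.
\<close>
lemma linear_change_of_variables:
  fixes T L :: "'a::euclidean_space \<Rightarrow> 'a"
  assumes T: "linear T" and L: "linear L" and TL: "\<And>x. T (L x) = x" and LT: "\<And>x. L (T x) = x"
  obtains c :: real where "c \<ge> 0"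
    "\<And>f :: 'a \<Rightarrow> real. f \<in> borel_measurable borel \<Longrightarrow> (LINT y|lborel. f (T y)) = c * (LINT y|lborel. f y)"
proof -
  have [measurable]: "T \<in> borel_measurable borel" "L \<in> borel_measurable borel"
    using T L by (auto intro!: borel_measurable_continuous_onI linear_continuous_on simp: linear_conv_bounded_linear)
  define \<nu> where "\<nu> = distr lborel borel T"
  have \<nu>: "emeasure \<nu> B = (\<integral>\<^sup>+y. indicator B (T y) \<partial>lborel)" if [measurable]: "B \<in> sets borel" for B
  proof -
    have "emeasure \<nu> B = (\<integral>\<^sup>+y. indicator B y \<partial>\<nu>)"
      using that by (simp add: \<nu>_def)
    then show ?thesis unfolding \<nu>_def by (subst (asm) nn_integral_distr) auto
  qed
  have shift: "(\<integral>\<^sup>+y. f (y + a) \<partial>lborel) = (\<integral>\<^sup>+y. f y \<partial>lborel)"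
    if "f \<in> borel_measurable borel" for f :: "'a \<Rightarrow> ennreal" and a
    using nn_integral_distr[of "(+) a" lborel borel f] that
    by (simp add: lborel_distr_plus add.commute)
  let ?A = "cball (0::'a) 1"
  have [measurable]: "?A \<in> sets borel" by simp
  have key: "emeasure lborel ?A * emeasure \<nu> B = emeasure \<nu> ?A * emeasure lborel B"
    if B[measurable]: "B \<in> sets borel" for B
  proof -
    have "emeasure lborel ?A * emeasure \<nu> B = (\<integral>\<^sup>+x. indicator ?A x * emeasure \<nu> B \<partial>lborel)"
      by (subst nn_integral_multc) auto
    also have "\<dots> = (\<integral>\<^sup>+x. (\<integral>\<^sup>+y. indicator ?A x * indicator B (T y + x) \<partial>lborel) \<partial>lborel)"
    proof (rule nn_integral_cong)
      fix x
      have "(\<integral>\<^sup>+y. indicator B (T y + x) \<partial>lborel) = (\<integral>\<^sup>+y. indicator B (T (y + L x)) \<partial>lborel)"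
        by (simp add: linear_add[OF T] TL)
      also have "\<dots> = emeasure \<nu> B" by (subst shift) (auto simp: \<nu>)
      finally show "indicator ?A x * emeasure \<nu> B = (\<integral>\<^sup>+y. indicator ?A x * indicator B (T y + x) \<partial>lborel)"
        by (subst nn_integral_cmult) auto
    qed
    also have "\<dots> = (\<integral>\<^sup>+y. (\<integral>\<^sup>+x. indicator ?A x * indicator B (T y + x) \<partial>lborel) \<partial>lborel)"
      by (rule lborel_pair.Fubini') auto
    also have "\<dots> = (\<integral>\<^sup>+y. (\<integral>\<^sup>+x. indicator ?A (x - T y) * indicator B x \<partial>lborel) \<partial>lborel)"
    proof (rule nn_integral_cong)
      fix y
      show "(\<integral>\<^sup>+x. indicator ?A x * indicator B (T y + x) \<partial>lborel) =
          (\<integral>\<^sup>+x. indicator ?A (x - T y) * indicator B x \<partial>lborel)"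
        using shift[of "\<lambda>x. indicator ?A (x - T y) * indicator B x" "T y"] by (simp add: add.commute)
    qed
    also have "\<dots> = (\<integral>\<^sup>+x. (\<integral>\<^sup>+y. indicator ?A (x - T y) * indicator B x \<partial>lborel) \<partial>lborel)"
      by (rule lborel_pair.Fubini') auto
    also have "\<dots> = (\<integral>\<^sup>+x. emeasure \<nu> ?A * indicator B x \<partial>lborel)"
    proof (rule nn_integral_cong)
      fix x
      have "(\<integral>\<^sup>+y. indicator ?A (x - T y) \<partial>lborel) = (\<integral>\<^sup>+y. indicator ?A (T (y + L (- x))) \<partial>lborel)"
      proof (rule nn_integral_cong)
        fix y
        have "T (y + L (- x)) = - (x - T y)" by (simp add: linear_add[OF T] TL)
        then show "indicator ?A (x - T y) = (indicator ?A (T (y + L (- x))) :: ennreal)"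
          by (simp add: indicator_def norm_minus_commute)
      qed
      also have "\<dots> = emeasure \<nu> ?A" by (subst shift) (auto simp: \<nu>)
      finally show "(\<integral>\<^sup>+y. indicator ?A (x - T y) * indicator B x \<partial>lborel) = emeasure \<nu> ?A * indicator B x"
        by (subst nn_integral_multc) auto
    qed
    also have "\<dots> = emeasure \<nu> ?A * emeasure lborel B" by (subst nn_integral_cmult) auto
    finally show ?thesis .
  qed
  have Apos: "emeasure lborel ?A \<noteq> 0"
  proof -
    \<comment> \<open>A cube of side \<open>1 / DIM('a)\<close> fits into the unit ball because the
      norm is at most the sum of the absolute coordinates.\<close>
    have "box 0 (\<Sum>b\<in>Basis. (1 / DIM('a)) *\<^sub>R b) \<subseteq> ?A"
    proof
      fix x :: 'a assume x: "x \<in> box 0 (\<Sum>b\<in>Basis. (1 / DIM('a)) *\<^sub>R b)"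
      have "norm x \<le> (\<Sum>b\<in>Basis. \<bar>x \<bullet> b\<bar>)" by (rule norm_le_l1)
      also have "\<dots> \<le> (\<Sum>b\<in>(Basis::'a set). 1 / DIM('a))"
        using x by (intro sum_mono) (auto simp: mem_box inner_sum_left inner_Basis sum.delta if_distrib cong: if_cong)
      finally show "x \<in> ?A" by simp
    qed
    moreover have "emeasure lborel (box 0 (\<Sum>b\<in>Basis. (1 / DIM('a)) *\<^sub>R b :: 'a)) \<noteq> 0"
      by (subst emeasure_lborel_box) (auto simp: inner_sum_left inner_Basis if_distrib cong: if_cong)
    ultimately show ?thesis
      by (metis emeasure_mono le_zero_eq sets_lborel borel_closed closed_cball)
  qed
  have Afin: "emeasure lborel ?A \<noteq> \<infinity>" using emeasure_lborel_cball_finite[of "0::'a" 1] by auto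
  have \<nu>A: "emeasure \<nu> ?A \<noteq> \<infinity>"
  proof -
    have "bounded_linear L" using L by (simp add: linear_conv_bounded_linear)
    then obtain K where K: "\<And>x. norm (L x) \<le> norm x * K" "K > 0"
      using bounded_linear.pos_bounded by blast
    have "emeasure \<nu> ?A = emeasure lborel (T -` ?A)" unfolding \<nu>_def by (subst emeasure_distr) auto
    also have "\<dots> \<le> emeasure lborel (cball (0::'a) K)"
    proof (rule emeasure_mono)
      show "T -` ?A \<subseteq> cball 0 K"
      proof
        fix y assume "y \<in> T -` ?A"
        then have "norm (T y) \<le> 1" by simp
        then have "norm (T y) * K \<le> 1 * K" using K(2) by (intro mult_right_mono) auto
        then show "y \<in> cball 0 K" using K(1)[of "T y"] by (simp add: LT)
      qed
    qed auto
    finally show ?thesis using emeasure_lborel_cball_finite[of "0::'a" K] by (auto simp: top_unique)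
  qed
  define a where "a = enn2real (emeasure \<nu> ?A)"
  define b where "b = enn2real (emeasure lborel ?A)"
  have a: "emeasure \<nu> ?A = ennreal a" "a \<ge> 0"
    unfolding a_def using \<nu>A by (simp_all add: less_top)
  have b: "emeasure lborel ?A = ennreal b" unfolding b_def using Afin by (simp add: less_top)
  then have b0: "b > 0" using Apos by (metis ennreal_eq_0_iff not_le)
  define c where "c = a / b"
  have eq: "\<nu> = density lborel (\<lambda>_. ennreal c)"
  proof (rule measure_eqI)
    fix B assume "B \<in> sets \<nu>"
    then have B: "B \<in> sets borel" by (simp add: \<nu>_def)
    have "emeasure \<nu> B = ennreal c * emeasure lborel B"
    proof -
      have "ennreal (1 / b) * (ennreal b * emeasure \<nu> B) = ennreal (1 / b) * (ennreal a * emeasure lborel B)"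
        using key[OF B] by (simp add: a b)
      moreover have "ennreal (1 / b) * ennreal b = 1" "ennreal (1 / b) * ennreal a = ennreal c"
        using b0 a(2) by (simp_all add: c_def ennreal_mult[symmetric])
      ultimately show ?thesis by (simp add: mult.assoc[symmetric])
    qed
    then show "emeasure \<nu> B = emeasure (density lborel (\<lambda>_. ennreal c)) B"
      using B by (simp add: emeasure_density_const)
  qed (simp add: \<nu>_def)
  show thesis
  proof
    show "c \<ge> 0" using a(2) b0 by (simp add: c_def)
    fix f :: "'a \<Rightarrow> real" assume f[measurable]: "f \<in> borel_measurable borel"
    have "(LINT y|lborel. f (T y)) = (LINT y|\<nu>. f y)" unfolding \<nu>_def by (subst integral_distr) auto
    also have "\<dots> = (LINT y|lborel. c *\<^sub>R f y)" unfolding eq using a(2) b0 by (intro integral_density) (auto simp: c_def)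
    finally show "(LINT y|lborel. f (T y)) = c * (LINT y|lborel. f y)" by simp
  qed
qed

text \<open>Turns the parameters attached to the basis vectors, a function on the indices in
  \<open>range \<sigma>\<close>, into a vector, so that the linear substitution applies. Lebesgue
  measure is recognised by its values on boxes.\<close>

lemma lborel_distr_PiM:
  fixes \<sigma> :: "'d::finite \<Rightarrow> 'i"
  assumes \<sigma>: "inj \<sigma>"
  shows "distr (\<Pi>\<^sub>M i\<in>range \<sigma>. lborel) borel (\<lambda>u. \<chi> j. u (\<sigma> j)) = (lborel :: (real ^ 'd) measure)"
proof (rule lborel_eqI[symmetric])
  interpret P: finite_product_sigma_finite "\<lambda>_::'i. lborel :: real measure" "range \<sigma>"
    by standard simp
  have [measurable]: "(\<lambda>u. \<chi> j. u (\<sigma> j)) \<in> measurable (\<Pi>\<^sub>M i\<in>range \<sigma>. lborel) (borel :: (real ^ 'd) measure)"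
  proof (subst borel_measurable_euclidean_space, rule ballI)
    fix b :: "real ^ 'd" assume "b \<in> Basis"
    then obtain j where "b = axis j 1" by (auto simp: Basis_vec_def)
    then show "(\<lambda>u. (\<chi> j. u (\<sigma> j)) \<bullet> b) \<in> borel_measurable (\<Pi>\<^sub>M i\<in>range \<sigma>. lborel)"
      by (simp add: inner_axis)
  qed
  fix l u :: "real ^ 'd" assume lu: "\<And>b. b \<in> Basis \<Longrightarrow> l \<bullet> b \<le> u \<bullet> b"
  have le: "l $ j \<le> u $ j" for j using lu[of "axis j 1"] by (simp add: inner_axis axis_in_Basis_iff)
  let ?B = "\<lambda>i. {l $ inv \<sigma> i <..< u $ inv \<sigma> i}"
  have "(\<lambda>u. \<chi> j. u (\<sigma> j)) -` box l u \<inter> space (\<Pi>\<^sub>M i\<in>range \<sigma>. lborel) = (\<Pi>\<^sub>E i\<in>range \<sigma>. ?B i)"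
    using \<sigma> by (auto simp: space_PiM mem_box_cart PiE_def Pi_iff)
  then have "emeasure (distr (\<Pi>\<^sub>M i\<in>range \<sigma>. lborel) borel (\<lambda>u. \<chi> j. u (\<sigma> j))) (box l u)
      = emeasure (\<Pi>\<^sub>M i\<in>range \<sigma>. lborel) (\<Pi>\<^sub>E i\<in>range \<sigma>. ?B i)"
    by (subst emeasure_distr) auto
  also have "\<dots> = (\<Prod>i\<in>range \<sigma>. emeasure lborel (?B i))" by (rule P.measure_times) auto
  also have "\<dots> = (\<Prod>j\<in>UNIV. ennreal (u $ j - l $ j))"
    using \<sigma> le by (subst prod.reindex) auto
  also have "\<dots> = ennreal (\<Prod>j\<in>UNIV. u $ j - l $ j)" using le by (subst prod_ennreal) auto
  also have "(\<Prod>j\<in>UNIV. u $ j - l $ j) = (\<Prod>b\<in>Basis. (u - l) \<bullet> b)"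
    by (simp add: Basis_vec_def prod.UNION_disjoint inner_axis axis_eq_axis)
  finally show "emeasure (distr (\<Pi>\<^sub>M i\<in>range \<sigma>. lborel) borel (\<lambda>u. \<chi> j. u (\<sigma> j))) (box l u)
      = (\<Prod>b\<in>Basis. (u - l) \<bullet> b)" .
qed simp

text \<open>Fubini with coordinate \<open>i\<close> innermost: once the other coordinates are fixed,
  the equation has a single solution in that coordinate.\<close>

lemma AE_PiM_hyperplane:
  fixes a :: "'i \<Rightarrow> real"
  assumes J: "finite J" "i \<in> J" "a i \<noteq> 0"
  shows "AE x in (\<Pi>\<^sub>M i\<in>J. lborel). (\<Sum>k\<in>J. x k * a k) \<noteq> t"
proof -
  interpret product_sigma_finite "\<lambda>_::'i. lborel :: real measure" by standard
  define K where "K = J - {i}"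
  have K: "finite K" "i \<notin> K" "J = insert i K" using J by (auto simp: K_def)
  let ?f = "\<lambda>x. indicator {x. (\<Sum>k\<in>J. x k * a k) = t} x :: ennreal"
  have m: "Measurable.pred (\<Pi>\<^sub>M i\<in>J. lborel) (\<lambda>x. (\<Sum>k\<in>J. x k * a k) = t)"
    by measurable
  have fm: "?f \<in> borel_measurable (\<Pi>\<^sub>M i\<in>J. lborel)"
    using m by (simp add: indicator_def Measurable.pred_def)
  have "(\<integral>\<^sup>+x. ?f x \<partial>(\<Pi>\<^sub>M i\<in>J. lborel)) = (\<integral>\<^sup>+x. (\<integral>\<^sup>+y. ?f (x(i := y)) \<partial>lborel) \<partial>(\<Pi>\<^sub>M i\<in>K. lborel))"
    using product_nn_integral_insert[OF K(1,2), of ?f] fm unfolding K(3) by simp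
  also have "\<dots> = (\<integral>\<^sup>+x. 0 \<partial>(\<Pi>\<^sub>M i\<in>K. (lborel :: real measure)))"
  proof (rule nn_integral_cong)
    fix x :: "'i \<Rightarrow> real"
    let ?y = "(t - (\<Sum>k\<in>K. x k * a k)) / a i"
    have "(\<Sum>k\<in>J. (x(i := y)) k * a k) = y * a i + (\<Sum>k\<in>K. x k * a k)" for y
      unfolding K(3) using K(1,2) by (simp add: sum.insert) (intro sum.cong, auto)
    then have "?f (x(i := y)) = indicator {?y} y" for y
      using J(3) by (auto simp: indicator_def field_simps)
    then show "(\<integral>\<^sup>+y. ?f (x(i := y)) \<partial>lborel) = 0" by simp
  qed
  finally have "(\<integral>\<^sup>+x. ?f x \<partial>(\<Pi>\<^sub>M i\<in>J. lborel)) = 0" by simp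
  then have "AE x in (\<Pi>\<^sub>M i\<in>J. lborel). ?f x = 0" using fm by (subst (asm) nn_integral_0_iff_AE) auto
  then show ?thesis by eventually_elim (auto simp: indicator_def)
qed

lemma set_integrable_box:
  fixes v :: "'i \<Rightarrow> real ^ 'd" and f :: "real ^ 'd \<Rightarrow> 'b::{banach, second_countable_topology}"
  assumes I: "finite I" and f: "continuous_on UNIV f"
  shows "set_integrable (\<Pi>\<^sub>M i\<in>I. lborel) (\<Pi>\<^sub>E i\<in>I. {0..1}) (\<lambda>u. f (\<Sum>i\<in>I. u i *\<^sub>R v i))"
proof -
  define R where "R = (\<Sum>i\<in>I. norm (v i))"
  have [measurable]: "f \<in> borel_measurable borel" using f by (rule borel_measurable_continuous_onI)
  obtain M where M: "\<And>w. norm w \<le> R \<Longrightarrow> norm (f w) \<le> M"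
    by (rule continuous_bounded_cball[where r=R, OF f], rule that)
  have s1[measurable]: "(\<Pi>\<^sub>E i\<in>I. {0..1::real}) \<in> sets (\<Pi>\<^sub>M i\<in>I. lborel)" by (intro sets_PiM_I_finite I) auto
  interpret PI: finite_product_sigma_finite "\<lambda>_::'i. lborel :: real measure" I by standard (rule I)
  have "emeasure (\<Pi>\<^sub>M i\<in>I. lborel) (\<Pi>\<^sub>E i\<in>I. {0..1::real}) = 1" by (subst PI.measure_times) auto
  then have i1: "integrable (\<Pi>\<^sub>M i\<in>I. lborel) (\<lambda>u. M * indicator (\<Pi>\<^sub>E i\<in>I. {0..1::real}) u :: real)"
    using s1 by (intro integrable_mult_right integrable_real_indicator) auto
  show ?thesis
    unfolding set_integrable_def
  proof (rule Bochner_Integration.integrable_bound[OF i1])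
  show "(\<lambda>u. indicator (\<Pi>\<^sub>E i\<in>I. {0..1}) u *\<^sub>R f (\<Sum>i\<in>I. u i *\<^sub>R v i)) \<in> borel_measurable (\<Pi>\<^sub>M i\<in>I. lborel)"
    by measurable
  show "AE u in \<Pi>\<^sub>M i\<in>I. lborel. norm (indicator (\<Pi>\<^sub>E i\<in>I. {0..1}) u *\<^sub>R f (\<Sum>i\<in>I. u i *\<^sub>R v i))
      \<le> norm (M * indicator (\<Pi>\<^sub>E i\<in>I. {0..1::real}) u)"
  proof (rule AE_I2)
    fix u :: "'i \<Rightarrow> real"
    show "norm (indicator (\<Pi>\<^sub>E i\<in>I. {0..1}) u *\<^sub>R f (\<Sum>i\<in>I. u i *\<^sub>R v i)) \<le> norm (M * indicator (\<Pi>\<^sub>E i\<in>I. {0..1::real}) u)"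
    proof (cases "u \<in> (\<Pi>\<^sub>E i\<in>I. {0..1::real})")
      case True
      have "norm (\<Sum>i\<in>I. u i *\<^sub>R v i) \<le> R" unfolding R_def
      proof (rule sum_norm_le)
        fix i assume "i \<in> I"
        then have "\<bar>u i\<bar> \<le> 1" using True by (auto simp: PiE_iff)
        then show "norm (u i *\<^sub>R v i) \<le> norm (v i)" by (simp add: mult_left_le_one_le)
      qed
      from M[OF this] show ?thesis using True by simp
    qed simp
  qed
  qed
qed

text \<open>
  Split off a basis \<open>v \<circ> \<sigma>\<close> and substitute: \<open>g w\<close> is, up to a constant, the measure of those parameters \<open>x\<close> of
  the other vectors for which \<open>w - s x\<close> lies in the parallelepiped of the basis. If \<open>rho v I \<ge> 1\<close>, each facet
  functional is nonzero on one of the other vectors, so that \<open>w - s x\<close> almost never hits the boundary.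
\<close>
lemma box_density:
  fixes v :: "'i \<Rightarrow> real ^ 'd"
  assumes I: "finite I" and adm: "admissible_family v I"
  obtains g :: "real ^ 'd \<Rightarrow> real" and R C :: real where
    "g \<in> borel_measurable borel" "\<And>w. 0 \<le> g w" "\<And>w. g w \<le> C" "\<And>w. norm w > R \<Longrightarrow> g w = 0"
    "\<And>f. continuous_on UNIV f \<Longrightarrow>
      (LINT u:(\<Pi>\<^sub>E i\<in>I. {0..1})|(\<Pi>\<^sub>M i\<in>I. lborel). f (\<Sum>i\<in>I. u i *\<^sub>R v i)) = (LINT w|lborel. f w * g w)"
    "rho v I \<ge> 1 \<Longrightarrow> continuous_on UNIV g"
proof -
  obtain \<sigma> :: "'d \<Rightarrow> 'i" where \<sigma>: "inj \<sigma>" "range \<sigma> \<subseteq> I" "span (range (v \<circ> \<sigma>)) = UNIV"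
    using basis_enumeration adm unfolding admissible_family_def by metis
  define T where "T = (\<lambda>z :: real ^ 'd. \<Sum>j\<in>UNIV. z $ j *\<^sub>R v (\<sigma> j))"
  have linT: "linear T" unfolding T_def
    by (intro linearI) (simp_all add: scaleR_left_distrib sum.distrib scaleR_sum_right)
  have Tax: "T (axis j 1) = v (\<sigma> j)" for j
    unfolding T_def by (simp add: axis_def if_distrib[of "\<lambda>c. c *\<^sub>R _"] cong: if_cong)
  have "surj T"
  proof -
    have "subspace (range T)" using linT by (intro linear_subspace_image subspace_UNIV)
    moreover have "range (v \<circ> \<sigma>) \<subseteq> range T" using Tax by (auto simp: o_def) (metis rangeI)
    ultimately have "span (range (v \<circ> \<sigma>)) \<subseteq> range T" by (rule span_minimal[rotated])
    then show ?thesis using \<sigma>(3) by auto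
  qed
  then obtain L where L: "linear L" "\<And>x. T (L x) = x" "\<And>x. L (T x) = x"
    using linear_surjective_isomorphism[OF linT] by blast
  obtain c where c: "c \<ge> 0" "\<And>f :: real ^ 'd \<Rightarrow> real. f \<in> borel_measurable borel \<Longrightarrow>
      (LINT y|lborel. f (T y)) = c * (LINT y|lborel. f y)"
    using linear_change_of_variables[OF linT L(1) L(2) L(3)] by metis
  have contL: "continuous_on UNIV L" and contT: "continuous_on UNIV T"
    using L(1) linT by (auto intro!: linear_continuous_on simp: linear_conv_bounded_linear)
  have [measurable]: "L \<in> borel_measurable borel" "T \<in> borel_measurable borel"
    using contL contT by (auto intro: borel_measurable_continuous_onI)
  define W where "W = range \<sigma>"
  define J where "J = I - W"
  have IJW: "I = J \<union> W" "J \<inter> W = {}" "finite J" "finite W"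
    using \<sigma>(2) I by (auto simp: J_def W_def)
  define PJ where "PJ = (\<Pi>\<^sub>M i\<in>J. lborel :: real measure)"
  define s where "s = (\<lambda>x :: 'i \<Rightarrow> real. \<Sum>i\<in>J. x i *\<^sub>R v i)"
  define Q where "Q = (\<Pi>\<^sub>E i\<in>J. {0..1::real})"
  define D where "D = (cbox 0 1 :: (real ^ 'd) set)"
  define R where "R = (\<Sum>i\<in>I. norm (v i))"
  interpret P: product_sigma_finite "\<lambda>_::'i. lborel :: real measure" by standard
  interpret PJ: finite_product_sigma_finite "\<lambda>_::'i. lborel :: real measure" J by standard (rule IJW)
  interpret PW: finite_product_sigma_finite "\<lambda>_::'i. lborel :: real measure" W by standard (rule IJW)
  interpret PJs: sigma_finite_measure PJ unfolding PJ_def by (rule PJ.sigma_finite_measure_axioms)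
  interpret pair: pair_sigma_finite PJ "lborel :: (real ^ 'd) measure" ..
  have [measurable]: "D \<in> sets borel" by (simp add: D_def)
  have Q[measurable]: "Q \<in> sets PJ" unfolding Q_def PJ_def by (intro sets_PiM_I_finite IJW) auto
  have [measurable]: "s \<in> borel_measurable PJ" unfolding s_def PJ_def by measurable
  have Q1: "emeasure PJ Q = 1" unfolding Q_def PJ_def by (subst PJ.measure_times) auto
  have sT: "norm (s x + T z) \<le> R" if "x \<in> Q" "z \<in> D" for x z
  proof -
    have "norm (s x + T z) \<le> (\<Sum>i\<in>J. norm (v i)) + (\<Sum>j\<in>UNIV. norm (v (\<sigma> j)))"
      unfolding s_def T_def
    proof (intro norm_triangle_mono sum_norm_le)
      fix i assume "i \<in> J"
      then have "\<bar>x i\<bar> \<le> 1" using that(1) by (auto simp: Q_def PiE_iff)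
      then show "norm (x i *\<^sub>R v i) \<le> norm (v i)" by (simp add: mult_left_le_one_le)
    next
      fix j
      have "\<bar>z $ j\<bar> \<le> 1" using that(2) by (auto simp: D_def mem_box_cart)
      then show "norm (z $ j *\<^sub>R v (\<sigma> j)) \<le> norm (v (\<sigma> j))" by (simp add: mult_left_le_one_le)
    qed
    also have "(\<Sum>j\<in>UNIV. norm (v (\<sigma> j))) = (\<Sum>i\<in>W. norm (v i))"
      unfolding W_def using \<sigma>(1) by (simp add: sum.reindex)
    also have "(\<Sum>i\<in>J. norm (v i)) + (\<Sum>i\<in>W. norm (v i)) = R"
      unfolding R_def IJW(1) using IJW by (subst sum.union_disjoint) auto
    finally show ?thesis .
  qed
  have supp: "norm w \<le> R" if "x \<in> Q" "L (w - s x) \<in> D" for x w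
    using sT[OF that] by (simp add: L(2))
  \<comment> \<open>Integrated over \<open>x\<close> this gives the density, up to the factor
    \<open>c\<close>; integrated over \<open>w\<close> against a test function it gives the inner
    part of the box integral. Fubini links the two.\<close>
  define k where "k = (\<lambda>x w. indicator Q x * indicator D (L (w - s x)) :: real)"
  have k01: "0 \<le> k x w" "k x w \<le> indicator Q x" for x w by (auto simp: k_def indicator_def)
  have km[measurable]: "(\<lambda>p. k (fst p) (snd p)) \<in> borel_measurable (PJ \<Otimes>\<^sub>M lborel)"
    unfolding k_def by measurable
  have km1[measurable]: "(\<lambda>x. k x w) \<in> borel_measurable PJ" for w unfolding k_def by measurable
  have Qint: "integrable PJ (indicator Q :: _ \<Rightarrow> real)"
    using Q1 by (intro integrable_real_indicator) auto
  have kint: "integrable PJ (\<lambda>x. k x w)" for w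
    by (rule Bochner_Integration.integrable_bound[OF Qint]) (use k01 in \<open>auto intro!: AE_I2\<close>)
  define G where "G = (\<lambda>w. LINT x|PJ. k x w)"
  have Gm[measurable]: "G \<in> borel_measurable borel"
  proof -
    have "(\<lambda>w. LINT x|PJ. k x w) \<in> borel_measurable lborel"
      by (rule PJs.borel_measurable_lebesgue_integral) (unfold k_def, measurable)
    then show ?thesis by (simp add: G_def)
  qed
  have G0: "0 \<le> G w" for w unfolding G_def by (rule Bochner_Integration.integral_nonneg) (rule k01)
  have G1: "G w \<le> 1" for w
  proof -
    have "G w \<le> (LINT x|PJ. indicator Q x)" unfolding G_def by (intro integral_mono kint Qint k01)
    also have "\<dots> = 1" using Q1 by (simp add: measure_def)
    finally show ?thesis .
  qed
  have Gs: "G w = 0" if "norm w > R" for w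
  proof -
    have "k x w = 0" for x using supp[of x w] that by (auto simp: k_def indicator_def)
    then show ?thesis by (simp add: G_def)
  qed
  show thesis
  proof
    show "(\<lambda>w. c * G w) \<in> borel_measurable borel" by measurable
    show "0 \<le> c * G w" for w using c(1) G0 by simp
    show "c * G w \<le> c" for w using c(1) G1[of w] by (simp add: mult_left_le)
    show "c * G w = 0" if "norm w > R" for w using Gs[OF that] by simp
  next
    fix f :: "real ^ 'd \<Rightarrow> real" assume f: "continuous_on UNIV f"
    have fm[measurable]: "f \<in> borel_measurable borel" using f by (rule borel_measurable_continuous_onI)
    obtain M where M: "\<And>w. norm w \<le> R \<Longrightarrow> \<bar>f w\<bar> \<le> M"
      by (rule continuous_bounded_cball[where r=R, OF f, unfolded real_norm_def], rule that)
    define F where "F = (\<lambda>u. indicator (\<Pi>\<^sub>E i\<in>I. {0..1::real}) u *\<^sub>R f (\<Sum>i\<in>I. u i *\<^sub>R v i))"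
    have Fint: "integrable (\<Pi>\<^sub>M i\<in>I. lborel) F"
      using set_integrable_box[OF I f, of v] by (simp add: F_def set_integrable_def)
    have inner: "(LINT y|(\<Pi>\<^sub>M i\<in>W. lborel). F (merge J W (x, y))) = c * (LINT w|lborel. k x w * f w)"
      if x: "x \<in> space PJ" for x
    proof -
      have "(LINT y|(\<Pi>\<^sub>M i\<in>W. lborel). F (merge J W (x, y))) =
          (LINT y|(\<Pi>\<^sub>M i\<in>W. lborel). indicator Q x * (indicator D (\<chi> j. y (\<sigma> j)) * f (s x + T (\<chi> j. y (\<sigma> j)))))"
      proof (rule Bochner_Integration.integral_cong[OF refl])
        fix y assume y: "y \<in> space (\<Pi>\<^sub>M i\<in>W. (lborel :: real measure))"
        have "(\<Sum>i\<in>I. merge J W (x, y) i *\<^sub>R v i) = (\<Sum>i\<in>J. merge J W (x, y) i *\<^sub>R v i) + (\<Sum>i\<in>W. merge J W (x, y) i *\<^sub>R v i)"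
          unfolding IJW(1) using IJW by (subst sum.union_disjoint) auto
        also have "(\<Sum>i\<in>J. merge J W (x, y) i *\<^sub>R v i) = s x"
          unfolding s_def by (intro sum.cong) (auto simp: merge_def)
        also have "(\<Sum>i\<in>W. merge J W (x, y) i *\<^sub>R v i) = (\<Sum>i\<in>W. y i *\<^sub>R v i)"
          using IJW(2) by (intro sum.cong) (auto simp: merge_def)
        also have "\<dots> = T (\<chi> j. y (\<sigma> j))" unfolding W_def T_def using \<sigma>(1) by (simp add: sum.reindex)
        finally have 1: "(\<Sum>i\<in>I. merge J W (x, y) i *\<^sub>R v i) = s x + T (\<chi> j. y (\<sigma> j))" .
        have mj: "\<And>i. i \<in> J \<Longrightarrow> merge J W (x, y) i = x i" "\<And>i. i \<in> W \<Longrightarrow> merge J W (x, y) i = y i"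
          using IJW(2) by (auto simp: merge_def)
        have "merge J W (x, y) \<in> (\<Pi>\<^sub>E i\<in>I. {0..1::real}) \<longleftrightarrow> (\<forall>i\<in>J. x i \<in> {0..1}) \<and> (\<forall>i\<in>W. y i \<in> {0..1})"
          unfolding IJW(1) PiE_iff ball_Un by (simp add: mj)
        moreover have "x \<in> Q \<longleftrightarrow> (\<forall>i\<in>J. x i \<in> {0..1})"
          using x by (auto simp: Q_def PiE_iff PJ_def space_PiM)
        moreover have "(\<chi> j. y (\<sigma> j)) \<in> D \<longleftrightarrow> (\<forall>i\<in>W. y i \<in> {0..1})"
          by (auto simp: D_def W_def mem_box_cart)
        ultimately have "merge J W (x, y) \<in> (\<Pi>\<^sub>E i\<in>I. {0..1::real}) \<longleftrightarrow> x \<in> Q \<and> (\<chi> j. y (\<sigma> j)) \<in> D"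
          by blast
        then have 2: "(indicator (\<Pi>\<^sub>E i\<in>I. {0..1::real}) (merge J W (x, y)) :: real) = indicator Q x * indicator D (\<chi> j. y (\<sigma> j))"
          by (auto simp: indicator_def)
        show "F (merge J W (x, y)) = indicator Q x * (indicator D (\<chi> j. y (\<sigma> j)) * f (s x + T (\<chi> j. y (\<sigma> j))))"
          unfolding F_def 1 2 by simp
      qed
      also have "\<dots> = indicator Q x * (LINT y|(\<Pi>\<^sub>M i\<in>W. lborel). indicator D (\<chi> j. y (\<sigma> j)) * f (s x + T (\<chi> j. y (\<sigma> j))))"
        by simp
      also have "(LINT y|(\<Pi>\<^sub>M i\<in>W. lborel). indicator D (\<chi> j. y (\<sigma> j)) * f (s x + T (\<chi> j. y (\<sigma> j)))) =
          (LINT z|lborel. indicator D z * f (s x + T z))"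
      proof -
        have [measurable]: "(\<lambda>u. \<chi> j. u (\<sigma> j)) \<in> measurable (\<Pi>\<^sub>M i\<in>W. lborel) (borel :: (real ^ 'd) measure)"
        proof (subst borel_measurable_euclidean_space, rule ballI)
          fix b :: "real ^ 'd" assume "b \<in> Basis"
          then obtain j where "b = axis j 1" by (auto simp: Basis_vec_def)
          then show "(\<lambda>u. (\<chi> j. u (\<sigma> j)) \<bullet> b) \<in> borel_measurable (\<Pi>\<^sub>M i\<in>W. lborel)"
            by (simp add: inner_axis W_def)
        qed
        have [measurable]: "(\<lambda>z. indicator D z * f (s x + T z)) \<in> borel_measurable borel" by measurable
        show ?thesis
          by (subst lborel_distr_PiM[OF \<sigma>(1), symmetric], subst integral_distr) (simp_all add: W_def[symmetric])
      qed
      also have "\<dots> = (LINT z|lborel. indicator D (L (T z)) * f (s x + T z))" by (simp add: L(3))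
      also have "\<dots> = c * (LINT w|lborel. indicator D (L w) * f (s x + w))"
        by (rule c(2)[of "\<lambda>w. indicator D (L w) * f (s x + w)"]) measurable
      also have "(LINT w|lborel. indicator D (L w) * f (s x + w)) = (LINT w|lborel. indicator D (L (w - s x)) * f w)"
        using lborel_shift_integral[of "\<lambda>w. indicator D (L w) * f (s x + w)" "- s x"] by simp
      also have "indicator Q x * (c * (LINT w|lborel. indicator D (L (w - s x)) * f w)) = c * (LINT w|lborel. k x w * f w)"
        unfolding k_def mult.assoc by simp
      finally show ?thesis .
    qed
    have Kint: "integrable (PJ \<Otimes>\<^sub>M lborel) (\<lambda>(x, w). k x w * f w)"
    proof (rule Bochner_Integration.integrable_bound)
      have "emeasure (PJ \<Otimes>\<^sub>M lborel) (Q \<times> cball (0 :: real ^ 'd) R) = emeasure lborel (cball (0 :: real ^ 'd) R)"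
        by (subst lborel.emeasure_pair_measure_Times) (auto simp: Q1)
      also have "\<dots> < \<infinity>" by (rule emeasure_lborel_cball_finite)
      finally show "integrable (PJ \<Otimes>\<^sub>M lborel) (\<lambda>p. M * indicator (Q \<times> cball (0 :: real ^ 'd) R) p :: real)"
        by (intro integrable_mult_right integrable_real_indicator) auto
      show "(\<lambda>(x, w). k x w * f w) \<in> borel_measurable (PJ \<Otimes>\<^sub>M lborel)"
        unfolding case_prod_beta using km by measurable
      show "AE p in PJ \<Otimes>\<^sub>M lborel. norm (case p of (x, w) \<Rightarrow> k x w * f w) \<le> norm (M * indicator (Q \<times> cball (0 :: real ^ 'd) R) p)"
      proof (rule AE_I2)
        fix p :: "('i \<Rightarrow> real) \<times> (real ^ 'd)"
        obtain x w where p: "p = (x, w)" by (cases p)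
        show "norm (case p of (x, w) \<Rightarrow> k x w * f w) \<le> norm (M * indicator (Q \<times> cball (0 :: real ^ 'd) R) p)"
          using M[of w] supp[of x w] by (auto simp: p k_def indicator_def)
      qed
    qed
    have "(LINT u:(\<Pi>\<^sub>E i\<in>I. {0..1})|(\<Pi>\<^sub>M i\<in>I. lborel). f (\<Sum>i\<in>I. u i *\<^sub>R v i)) = (LINT u|(\<Pi>\<^sub>M i\<in>I. lborel). F u)"
      by (simp add: F_def set_lebesgue_integral_def)
    also have "\<dots> = (LINT x|PJ. (LINT y|(\<Pi>\<^sub>M i\<in>W. lborel). F (merge J W (x, y))))"
      using P.product_integral_fold[OF IJW(2,3,4), of F] Fint unfolding PJ_def IJW(1)[symmetric] by simp
    also have "\<dots> = (LINT x|PJ. c * (LINT w|lborel. k x w * f w))"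
      by (rule Bochner_Integration.integral_cong[OF refl inner])
    also have "\<dots> = c * (LINT x|PJ. (LINT w|lborel. k x w * f w))" by simp
    also have "(LINT x|PJ. (LINT w|lborel. k x w * f w)) = (LINT w|lborel. (LINT x|PJ. k x w * f w))"
      by (rule pair.Fubini_integral[OF Kint, symmetric])
    also have "\<dots> = (LINT w|lborel. f w * G w)" by (simp add: G_def mult.commute)
    also have "c * \<dots> = (LINT w|lborel. f w * (c * G w))" by (simp add: mult.left_commute)
    finally show "(LINT u:(\<Pi>\<^sub>E i\<in>I. {0..1})|(\<Pi>\<^sub>M i\<in>I. lborel). f (\<Sum>i\<in>I. u i *\<^sub>R v i)) = (LINT w|lborel. f w * (c * G w))" .
  next
    assume rho: "rho v I \<ge> 1"
    \<comment> \<open>Coordinate \<open>j\<close> of \<open>L\<close> annihilates every basis vector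
      except \<open>v (\<sigma> j)\<close>. If it annihilated the other vectors too, deleting the
      single index \<open>\<sigma> j\<close> would leave only vectors of a hyperplane, although
      \<open>rho v I\<close> is at least 1.\<close>
    have ex: "\<exists>i\<in>J. L (v i) $ j \<noteq> 0" for j
    proof (rule ccontr)
      assume no: "\<not> (\<exists>i\<in>J. L (v i) $ j \<noteq> 0)"
      have "span (v ` (I - {\<sigma> j})) = UNIV" using rho \<sigma>(2) by (intro rho_span[OF I adm]) auto
      moreover have "v ` (I - {\<sigma> j}) \<subseteq> {z. L z $ j = 0}"
      proof
        fix z assume "z \<in> v ` (I - {\<sigma> j})"
        then obtain i where i: "i \<in> I" "i \<noteq> \<sigma> j" "z = v i" by auto
        show "z \<in> {z. L z $ j = 0}"
        proof (cases "i \<in> J")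
          case False
          then obtain l where l: "i = \<sigma> l" using i IJW by (auto simp: W_def)
          then have "L z = axis l 1" using L(3)[of "axis l 1"] by (simp add: i Tax)
          then show ?thesis using l i by (auto simp: axis_def)
        qed (use no i in auto)
      qed
      moreover have "subspace {z. L z $ j = 0}"
        using L(1) by (auto simp: subspace_def linear_0 linear_add linear_cmul)
      ultimately have "UNIV \<subseteq> {z. L z $ j = 0}" by (metis span_minimal)
      then have "L (v (\<sigma> j)) $ j = 0" by auto
      then show False using L(3)[of "axis j 1"] by (simp add: Tax)
    qed
    have AEs: "AE x in PJ. \<forall>j. L (w - s x) $ j \<noteq> 0 \<and> L (w - s x) $ j \<noteq> 1" for w
    proof -
      have *: "AE x in PJ. L (w - s x) $ j \<noteq> t" for j t
      proof -
        obtain i where i: "i \<in> J" "L (v i) $ j \<noteq> 0" using ex by blast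
        have "AE x in PJ. (\<Sum>k\<in>J. x k * L (v k) $ j) \<noteq> L w $ j - t"
          unfolding PJ_def by (rule AE_PiM_hyperplane[where a="\<lambda>i. L (v i) $ j", OF IJW(3) i(1) i(2)])
        then show ?thesis
          by eventually_elim (simp add: s_def linear_diff[OF L(1)] linear_sum[OF L(1)] linear_cmul[OF L(1)] algebra_simps)
      qed
      have "AE x in PJ. L (w - s x) $ j \<noteq> 0 \<and> L (w - s x) $ j \<noteq> 1" for j
        using *[of j 0] *[of j 1] by eventually_elim simp
      then have "AE x in PJ. \<forall>j\<in>UNIV. L (w - s x) $ j \<noteq> 0 \<and> L (w - s x) $ j \<noteq> 1"
        by (intro AE_finite_allI) auto
      then show ?thesis by simp
    qed
    have contG: "continuous_on UNIV G"
    proof (rule continuous_at_imp_continuous_on, rule ballI, rule continuous_at_sequentiallyI)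
      fix w :: "real ^ 'd" and X assume X: "X \<longlonglongrightarrow> w"
      show "(\<lambda>n. G (X n)) \<longlonglongrightarrow> G w"
        unfolding G_def
      proof (rule integral_dominated_convergence[where w="indicator Q"])
        show "AE x in PJ. (\<lambda>n. k x (X n)) \<longlonglongrightarrow> k x w"
          using AEs[of w]
        proof eventually_elim
          case (elim x)
          \<comment> \<open>Away from the facets the limit lies either in the open cube or in the
            open complement of \<open>D\<close>, so membership in \<open>D\<close> is eventually
            constant along the sequence.\<close>
          have lim: "(\<lambda>n. L (X n - s x)) \<longlonglongrightarrow> L (w - s x)"
            by (rule continuous_on_tendsto_compose[OF contL]) (auto intro!: tendsto_intros X)
          have "\<forall>\<^sub>F n in sequentially. (L (X n - s x) \<in> D) = (L (w - s x) \<in> D)"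
          proof (cases "L (w - s x) \<in> D")
            case True
            have "0 < L (w - s x) $ j \<and> L (w - s x) $ j < 1" for j
            proof -
              have "0 \<le> L (w - s x) $ j" "L (w - s x) $ j \<le> 1" using True by (auto simp: D_def mem_box_cart)
              then show ?thesis using elim by (simp add: order_less_le)
            qed
            then have "L (w - s x) \<in> box 0 1" by (simp add: mem_box_cart)
            from topological_tendstoD[OF lim open_box this]
            show ?thesis
            proof eventually_elim
              case (elim n)
              then show ?case using True box_subset_cbox by (auto simp: D_def)
            qed
          next
            case False
            then have "L (w - s x) \<in> - D" by simp
            moreover have "open (- D)" unfolding D_def by (intro open_Compl closed_cbox)
            ultimately show ?thesis using topological_tendstoD[OF lim, of "- D"] False
              by (auto elim!: eventually_mono)
          qed
          then have "\<forall>\<^sub>F n in sequentially. k x (X n) = k x w"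
            by eventually_elim (simp add: k_def indicator_def)
          then show ?case by (rule tendsto_eventually)
        qed
        show "AE x in PJ. norm (k x (X n)) \<le> indicator Q x" for n
          using k01 by (intro AE_I2) auto
      qed (use Qint in auto)
    qed
    show "continuous_on UNIV (\<lambda>w. c * G w)" by (intro continuous_intros contG)
  qed
qed

section \<open>Derivatives of products of linear forms\<close>

text \<open>Closed form of the iterated derivative: by the product rule each direction removes one
  factor and leaves the matching component of its vector. On this form differentiability is a plain
  induction on the list.\<close>

fun dprod :: "('i \<Rightarrow> real ^ 'd) \<Rightarrow> 'd list \<Rightarrow> 'i set \<Rightarrow> real ^ 'd \<Rightarrow> real" where
  "dprod v [] U x = (\<Prod>i\<in>U. x \<bullet> v i)"
| "dprod v (j # js) U x = (\<Sum>i\<in>U. v i $ j * dprod v js (U - {i}) x)"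

lemma sum_distinct_pairs_swap:
  assumes "finite U"
  shows "(\<Sum>i\<in>U. \<Sum>l\<in>U - {i}. F i l) = (\<Sum>l\<in>U. \<Sum>i\<in>U - {l}. F i l :: 'a::comm_monoid_add)"
proof -
  have "(\<Sum>i\<in>U. \<Sum>l\<in>U - {i}. F i l) = (\<Sum>i\<in>U. \<Sum>l | l \<in> U \<and> i \<noteq> l. F i l)"
    by (intro sum.cong) auto
  also have "\<dots> = (\<Sum>l\<in>U. \<Sum>i | i \<in> U \<and> i \<noteq> l. F i l)"
    by (rule sum.swap_restrict[OF assms assms])
  also have "\<dots> = (\<Sum>l\<in>U. \<Sum>i\<in>U - {l}. F i l)"
    by (intro sum.cong) auto
  finally show ?thesis .
qed

text \<open>Differentiation removes the factor of the new direction last, whereas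
  \<open>dprod\<close> removes it first. Exchanging the two sums over pairs of distinct factors
  reconciles the orders.\<close>

lemma dprod_has_derivative:
  assumes "finite U"
  shows "((\<lambda>t. dprod v js U (x + t *\<^sub>R axis j 1)) has_real_derivative
    dprod v (j # js) U (x + t *\<^sub>R axis j 1)) (at t)"
  using assms
proof (induction js arbitrary: U)
  case Nil
  have "((\<lambda>t. (x + t *\<^sub>R axis j 1) \<bullet> v i) has_real_derivative v i $ j) (at t)" for i
    unfolding inner_add_left inner_scaleR_left inner_axis'
    by (auto intro!: derivative_eq_intros)
  then have "((\<lambda>t. \<Prod>i\<in>U. (x + t *\<^sub>R axis j 1) \<bullet> v i) has_real_derivative
      (\<Sum>i\<in>U. v i $ j * (\<Prod>l\<in>U - {i}. (x + t *\<^sub>R axis j 1) \<bullet> v l))) (at t)"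
    by (rule has_field_derivative_prod)
  then show ?case by simp
next
  case (Cons k js)
  have "((\<lambda>t. \<Sum>i\<in>U. v i $ k * dprod v js (U - {i}) (x + t *\<^sub>R axis j 1)) has_real_derivative
      (\<Sum>i\<in>U. v i $ k * dprod v (j # js) (U - {i}) (x + t *\<^sub>R axis j 1))) (at t)"
    by (intro DERIV_sum DERIV_cmult Cons.IH) (use Cons.prems in auto)
  also have "(\<Sum>i\<in>U. v i $ k * dprod v (j # js) (U - {i}) (x + t *\<^sub>R axis j 1)) =
      (\<Sum>i\<in>U. \<Sum>l\<in>U - {i}. v i $ k * (v l $ j * dprod v js (U - {i} - {l}) (x + t *\<^sub>R axis j 1)))"
    by (simp add: sum_distrib_left)
  also have "\<dots> = (\<Sum>l\<in>U. \<Sum>i\<in>U - {l}. v i $ k * (v l $ j * dprod v js (U - {i} - {l}) (x + t *\<^sub>R axis j 1)))"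
    by (rule sum_distinct_pairs_swap[OF Cons.prems])
  also have "\<dots> = dprod v (j # k # js) U (x + t *\<^sub>R axis j 1)"
    by (simp add: sum_distrib_left mult.left_commute Diff_insert2[symmetric] insert_commute)
  finally show ?case by simp
qed

lemma foldr_partial_deriv_dprod:
  assumes "finite U"
  shows "foldr partial_deriv js (\<lambda>x. \<Prod>i\<in>U. x \<bullet> v i) = dprod v js U"
proof (induction js)
  case (Cons j js)
  have "partial_deriv j (dprod v js U) x = dprod v (j # js) U x" for x
    unfolding partial_deriv_def
    using DERIV_imp_deriv[OF dprod_has_derivative[OF assms, of v js x j 0]] by simp
  then show ?case using Cons.IH by auto
qed auto

text \<open>For finite sets of equal size these are the bijections, and the sums of products below
  are permanents. Surjectivity is the form in which the Fourier coefficients deliver the condition;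
  equal size then gives injectivity.\<close>

definition onto_maps :: "nat set \<Rightarrow> 'i set \<Rightarrow> (nat \<Rightarrow> 'i) set" where
  "onto_maps K U = {f \<in> K \<rightarrow>\<^sub>E U. f ` K = U}"

text \<open>Expansion of a permanent along the row \<open>k\<close>. Equal cardinalities force
  injectivity, so that the restriction to \<open>K\<close> misses exactly the value at
  \<open>k\<close>.\<close>

lemma sum_onto_maps_insert:
  fixes w :: "nat \<Rightarrow> 'i \<Rightarrow> real"
  assumes K: "finite K" "k \<notin> K" and U: "finite U" "card U = Suc (card K)"
  shows "(\<Sum>f\<in>onto_maps (insert k K) U. \<Prod>l\<in>insert k K. w l (f l)) =
    (\<Sum>i\<in>U. w k i * (\<Sum>f\<in>onto_maps K (U - {i}). \<Prod>l\<in>K. w l (f l)))"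
proof -
  have fin: "finite (onto_maps K (U - {i}))" for i
    unfolding onto_maps_def using K U by (intro finite_subset[OF _ finite_PiE[of K "\<lambda>_. U"]]) auto
  have "(\<Sum>i\<in>U. w k i * (\<Sum>f\<in>onto_maps K (U - {i}). \<Prod>l\<in>K. w l (f l))) =
      (\<Sum>i\<in>U. \<Sum>f\<in>onto_maps K (U - {i}). w k i * (\<Prod>l\<in>K. w l (f l)))"
    by (simp add: sum_distrib_left)
  also have "\<dots> = (\<Sum>(i, f)\<in>(SIGMA i:U. onto_maps K (U - {i})). w k i * (\<Prod>l\<in>K. w l (f l)))"
    using U fin by (subst sum.Sigma) auto
  also have "\<dots> = (\<Sum>f\<in>onto_maps (insert k K) U. \<Prod>l\<in>insert k K. w l (f l))"
  proof (rule sum.reindex_bij_witness[of _ "\<lambda>f. (f k, restrict f K)" "\<lambda>(i, f). f(k := i)"])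
    fix p assume "p \<in> (SIGMA i:U. onto_maps K (U - {i}))"
    then obtain i g where p: "p = (i, g)" "i \<in> U" "g \<in> K \<rightarrow>\<^sub>E U - {i}" "g ` K = U - {i}"
      by (auto simp: onto_maps_def)
    show "(case p of (i, f) \<Rightarrow> f(k := i)) \<in> onto_maps (insert k K) U"
      using p K(2) by (auto simp: onto_maps_def PiE_iff extensional_def image_def)
    show "((case p of (i, f) \<Rightarrow> f(k := i)) k, restrict (case p of (i, f) \<Rightarrow> f(k := i)) K) = p"
      using p K(2) by (auto simp: PiE_iff extensional_def restrict_def fun_eq_iff)
    have "(\<Prod>l\<in>K. w l ((g(k := i)) l)) = (\<Prod>l\<in>K. w l (g l))"
      using K(2) by (intro prod.cong) auto
    then show "(\<Prod>l\<in>insert k K. w l ((case p of (i, f) \<Rightarrow> f(k := i)) l)) =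
        (case p of (i, f) \<Rightarrow> w k i * (\<Prod>l\<in>K. w l (f l)))"
      using K p(1) by simp
  next
    fix f assume f: "f \<in> onto_maps (insert k K) U"
    then have f1: "f \<in> insert k K \<rightarrow>\<^sub>E U" "f ` insert k K = U" by (auto simp: onto_maps_def)
    have "inj_on f (insert k K)" using K U f1(2) by (intro eq_card_imp_inj_on) auto
    then have "f ` K = U - {f k}" using f1(2) K(2) by (auto simp: inj_on_def)
    then show "(f k, restrict f K) \<in> (SIGMA i:U. onto_maps K (U - {i}))"
      using f1 by (auto simp: onto_maps_def)
    show "(case (f k, restrict f K) of (i, f) \<Rightarrow> f(k := i)) = f"
      using f1(1) by (auto simp: fun_eq_iff PiE_iff extensional_def)
  qed
  finally show ?thesis ..
qed

lemma dprod_eq_sum_onto_maps: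
  assumes "distinct ks" "finite U" "card U = length ks"
  shows "dprod v (map j ks) U x = (\<Sum>f\<in>onto_maps (set ks) U. \<Prod>l\<in>set ks. v (f l) $ j l)"
  using assms
proof (induction ks arbitrary: U)
  case Nil
  then have "U = {}" by simp
  moreover have "onto_maps {} {} = {\<lambda>x. undefined :: 'a}" by (auto simp: onto_maps_def)
  ultimately show ?case by simp
next
  case (Cons k ks)
  have "dprod v (map j (k # ks)) U x = (\<Sum>i\<in>U. v i $ j k * (\<Sum>f\<in>onto_maps (set ks) (U - {i}). \<Prod>l\<in>set ks. v (f l) $ j l))"
    using Cons.prems by (simp add: Cons.IH)
  also have "\<dots> = (\<Sum>f\<in>onto_maps (insert k (set ks)) U. \<Prod>l\<in>insert k (set ks). v (f l) $ j l)"
    using Cons.prems by (intro sum_onto_maps_insert[symmetric, of _ _ _ "\<lambda>l i. v i $ j l"]) (auto simp: distinct_card)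
  finally show ?case by simp
qed

section \<open>Multi-indices as lists of directions\<close>

lemma exists_count_list: "\<exists>js. \<forall>j :: 'd::finite. count_list js j = \<beta> j"
proof -
  have "\<exists>js. (\<forall>j\<in>S. count_list js j = \<beta> j) \<and> (\<forall>j. j \<notin> S \<longrightarrow> count_list js j = 0)" if "finite S" for S :: "'d set"
    using that
  proof (induction S)
    case empty
    then show ?case by (intro exI[of _ "[]"]) auto
  next
    case (insert a S)
    then obtain js where js: "\<forall>j\<in>S. count_list js j = \<beta> j" "\<forall>j. j \<notin> S \<longrightarrow> count_list js j = 0" by blast
    have c: "count_list (replicate n a) j = (if j = a then n else 0)" for n j
      by (induction n) auto
    show ?case
      by (rule exI[of _ "replicate (\<beta> a) a @ js"]) (use js insert in \<open>auto simp: c\<close>)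
  qed
  from this[of UNIV] show ?thesis by auto
qed

text \<open>The very choice made inside \<open>multi_deriv\<close>, so that the positions of one
  list index both the derivatives and the factors of the monomial.\<close>

definition multi_list :: "nat ^ 'd \<Rightarrow> 'd list" where
  "multi_list \<beta> = (SOME js. \<forall>j. count_list js j = \<beta> $ j)"

lemma count_multi_list: "count_list (multi_list \<beta>) j = \<beta> $ j"
  unfolding multi_list_def using someI_ex[OF exists_count_list[of "\<lambda>j. \<beta> $ j"]] by blast

lemma length_multi_list: "length (multi_list \<beta>) = (\<Sum>j\<in>UNIV. \<beta> $ j)"
  using sum_count_set[of "multi_list \<beta>" UNIV] by (simp add: count_multi_list)

text \<open>The factors are indexed by positions \<open>k\<close>, with \<open>j k\<close> the
  direction at position \<open>k\<close>. Repeated directions are thereby told apart, and the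
  expansion of \<open>mon j T (a + b)\<close> runs over subsets without binomial
  coefficients.\<close>

definition mon :: "(nat \<Rightarrow> 'd) \<Rightarrow> nat set \<Rightarrow> real ^ 'd \<Rightarrow> real" where
  "mon j S x = (\<Prod>k\<in>S. x $ j k)"

lemma prod_list_eq_prod_count:
  fixes f :: "'d::finite \<Rightarrow> 'b::comm_monoid_mult"
  shows "prod_list (map f xs) = (\<Prod>j\<in>UNIV. f j ^ count_list xs j)"
proof (induction xs)
  case (Cons a xs)
  have "(\<Prod>j\<in>UNIV. f j ^ count_list (a # xs) j) = (\<Prod>j\<in>UNIV. (if j = a then f j else 1) * f j ^ count_list xs j)"
    by (intro prod.cong) auto
  also have "\<dots> = f a * (\<Prod>j\<in>UNIV. f j ^ count_list xs j)" by (simp add: prod.distrib)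
  finally show ?case using Cons by simp
qed simp

lemma prod_nth_eq_prod_list:
  fixes f :: "'d \<Rightarrow> 'b::comm_monoid_mult"
  shows "(\<Prod>k<length xs. f (xs ! k)) = prod_list (map f xs)"
  by (induction xs) (simp_all add: prod.lessThan_Suc_shift del: prod.lessThan_Suc)

lemma monomial_eq_mon:
  "monomial \<beta> x = of_real (mon ((!) (multi_list \<beta>)) {..<\<Sum>j\<in>UNIV. \<beta> $ j} x)"
proof -
  have "(\<Prod>k<length (multi_list \<beta>). x $ (multi_list \<beta> ! k)) = prod_list (map (($) x) (multi_list \<beta>))"
    by (rule prod_nth_eq_prod_list)
  then show ?thesis
    unfolding monomial_def mon_def length_multi_list[symmetric]
    by (simp add: prod_list_eq_prod_count count_multi_list)
qed

lemma bernoulli_coeff_eq: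
  assumes U: "finite U" "card U = (\<Sum>j\<in>UNIV. \<beta> $ j)"
  defines "K \<equiv> {..<\<Sum>j\<in>UNIV. \<beta> $ j}"
  shows "multi_deriv \<beta> (\<lambda>x. \<Prod>i\<in>U. x \<bullet> v i) y = (\<Sum>f\<in>onto_maps K U. \<Prod>k\<in>K. v (f k) $ (multi_list \<beta> ! k))"
    and "bernoulli_coeff v \<beta> U = (\<Sum>f\<in>onto_maps K U. \<Prod>k\<in>K. v (f k) $ (multi_list \<beta> ! k))"
proof -
  have "multi_list \<beta> = map ((!) (multi_list \<beta>)) [0..<length (multi_list \<beta>)]" by (simp add: map_nth)
  then show 1: "multi_deriv \<beta> (\<lambda>x. \<Prod>i\<in>U. x \<bullet> v i) y = (\<Sum>f\<in>onto_maps K U. \<Prod>k\<in>K. v (f k) $ (multi_list \<beta> ! k))" for y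
    unfolding multi_deriv_def multi_list_def[symmetric] foldr_partial_deriv_dprod[OF U(1)]
    using dprod_eq_sum_onto_maps[of "[0..<length (multi_list \<beta>)]" U v "(!) (multi_list \<beta>)" y] U
    by (simp add: K_def length_multi_list atLeast0LessThan)
  show "bernoulli_coeff v \<beta> U = (\<Sum>f\<in>onto_maps K U. \<Prod>k\<in>K. v (f k) $ (multi_list \<beta> ! k))"
    unfolding bernoulli_coeff_def by (rule 1)
qed

section \<open>Fourier coefficients of the box measure\<close>

text \<open>The integral over a single parameter \<open>u i\<close>: here \<open>a\<close> is
  \<open>\<alpha> \<bullet> v i\<close>, and \<open>n\<close> counts how often \<open>u i\<close>
  occurs in a term of the expanded monomial.\<close>

definition theta :: "real \<Rightarrow> nat \<Rightarrow> complex" where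
  "theta a n = (LINT t|lborel. indicator {0..1} t *\<^sub>R (of_real t ^ n * exp (2 * of_real pi * \<i> * of_real (a * t))))"

lemma theta_0_0: "theta 0 0 = 1"
  by (simp add: theta_def scaleR_conv_of_real)

lemma theta_nonzero_int:
  assumes a: "a \<in> \<int>" "a \<noteq> 0"
  shows theta_int_0: "theta a 0 = 0"
    and theta_int_1: "theta a (Suc 0) = 1 / (2 * of_real pi * \<i> * of_real a)"
proof -
  define c where "c = 2 * of_real pi * \<i> * complex_of_real a"
  have c0: "c \<noteq> 0" using a(2) by (simp add: c_def)
  obtain k :: int where k: "a = of_int k" using a(1) by (auto elim: Ints_cases)
  have e1: "exp c = 1"
  proof -
    have "c = of_real (of_int (2 * k) * pi) * \<i>" by (simp add: c_def k)
    then show ?thesis by (auto simp: exp_eq_1)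
  qed
  have et: "exp (2 * of_real pi * \<i> * of_real (a * t)) = exp (c * of_real t)" for t
    by (simp add: c_def mult_ac)
  have "theta a 0 = exp (c * of_real 1) / c - exp (c * of_real 0) / c"
    unfolding theta_def et
  proof (rule integral_FTC_atLeastAtMost)
    fix x :: real
    have "((\<lambda>z. exp (c * z) / c) has_field_derivative of_real x ^ 0 * exp (c * of_real x)) (at (of_real x))"
      using c0 by (auto intro!: derivative_eq_intros)
    then show "((\<lambda>t. exp (c * of_real t) / c) has_vector_derivative of_real x ^ 0 * exp (c * of_real x)) (at x within {0..1})"
      by (rule has_vector_derivative_real_field)
  qed (auto intro!: continuous_intros)
  then show "theta a 0 = 0" using e1 by simp
  let ?F = "\<lambda>z. z * exp (c * z) / c - exp (c * z) / c ^ 2"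
  have "theta a (Suc 0) = ?F (of_real 1) - ?F (of_real 0)"
    unfolding theta_def et
  proof (rule integral_FTC_atLeastAtMost[where F="\<lambda>t. ?F (of_real t)"])
    fix x :: real
    have "(?F has_field_derivative of_real x ^ Suc 0 * exp (c * of_real x)) (at (of_real x))"
      using c0 by (auto intro!: derivative_eq_intros simp: field_simps power2_eq_square)
    then show "((\<lambda>t. ?F (of_real t)) has_vector_derivative of_real x ^ Suc 0 * exp (c * of_real x)) (at x within {0..1})"
      by (rule has_vector_derivative_real_field)
  qed (auto intro!: continuous_intros)
  then show "theta a (Suc 0) = 1 / (2 * of_real pi * \<i> * of_real a)"
    using e1 by (simp add: c_def[symmetric])
qed

lemma chi_sum: "chi a (\<Sum>i\<in>I. f i) = (\<Prod>i\<in>I. chi a (f i))"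
  by (induction I rule: infinite_finite_induct) (simp_all add: chi_add_right)

lemma prod_eq_prod_power_card:
  fixes h :: "'i \<Rightarrow> 'b::comm_monoid_mult"
  assumes "finite S" "finite I" "f ` S \<subseteq> I"
  shows "(\<Prod>k\<in>S. h (f k)) = (\<Prod>i\<in>I. h i ^ card {k \<in> S. f k = i})"
proof -
  have "(\<Prod>k\<in>S. h (f k)) = (\<Prod>i\<in>I. \<Prod>k | k \<in> S \<and> f k = i. h (f k))"
    by (rule prod.group[OF assms, symmetric])
  also have "\<dots> = (\<Prod>i\<in>I. h i ^ card {k \<in> S. f k = i})"
    by (intro prod.cong) auto
  finally show ?thesis .
qed

text \<open>Multiplying out, each position \<open>k\<close> picks the index \<open>f k\<close> of
  the vector that supplies its factor. Every term is then a product of functions of separate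
  parameters, and the integral factorizes.\<close>

lemma box_integral_expand:
  fixes v :: "'i \<Rightarrow> real ^ 'd"
  assumes I: "finite I" and S: "finite S"
  shows "(LINT u:(\<Pi>\<^sub>E i\<in>I. {0..1})|(\<Pi>\<^sub>M i\<in>I. lborel).
      complex_of_real (mon j S (\<Sum>i\<in>I. u i *\<^sub>R v i)) * chi \<alpha> (\<Sum>i\<in>I. u i *\<^sub>R v i)) =
    (\<Sum>f\<in>S \<rightarrow>\<^sub>E I. of_real (\<Prod>k\<in>S. v (f k) $ j k) *
      (\<Prod>i\<in>I. theta (\<alpha> \<bullet> v i) (card {k \<in> S. f k = i})))"
proof -
  interpret P: product_sigma_finite "\<lambda>_::'i. lborel :: real measure" by standard
  let ?n = "\<lambda>f i. card {k \<in> S. f k = i}"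
  define h where "h = (\<lambda>i n t. indicator {0..1} t *\<^sub>R (of_real t ^ n * exp (2 * of_real pi * \<i> * of_real ((\<alpha> \<bullet> v i) * t))) :: complex)"
  define C where "C = (\<lambda>f. complex_of_real (\<Prod>k\<in>S. v (f k) $ j k))"
  have hint: "integrable lborel (h i n)" for i n
    unfolding h_def by (intro borel_integrable_compact continuous_intros) auto
  have eq: "indicator (\<Pi>\<^sub>E i\<in>I. {0..1}) u *\<^sub>R (complex_of_real (mon j S (\<Sum>i\<in>I. u i *\<^sub>R v i)) * chi \<alpha> (\<Sum>i\<in>I. u i *\<^sub>R v i))
      = (\<Sum>f\<in>S \<rightarrow>\<^sub>E I. C f * (\<Prod>i\<in>I. h i (?n f i) (u i)))"
    if u: "u \<in> space (\<Pi>\<^sub>M i\<in>I. (lborel :: real measure))" for u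
  proof -
    let ?w = "\<Sum>i\<in>I. u i *\<^sub>R v i"
    have ind: "complex_of_real (indicator (\<Pi>\<^sub>E i\<in>I. {0..1}) u) = (\<Prod>i\<in>I. of_real (indicator {0..1} (u i)))"
    proof (cases "u \<in> (\<Pi>\<^sub>E i\<in>I. {0..1})")
      case True
      then show ?thesis by (simp add: PiE_iff)
    next
      case False
      then obtain i where "i \<in> I" "u i \<notin> {0..1}" using u by (auto simp: PiE_iff space_PiM)
      then show ?thesis using False I by (auto intro!: prod_zero[symmetric] bexI[of _ i])
    qed
    have "complex_of_real (mon j S ?w) = (\<Prod>k\<in>S. \<Sum>i\<in>I. of_real (u i) * of_real (v i $ j k))"
      unfolding mon_def by (simp add: sum_component)
    also have "\<dots> = (\<Sum>f\<in>S \<rightarrow>\<^sub>E I. \<Prod>k\<in>S. of_real (u (f k)) * of_real (v (f k) $ j k))"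
      by (rule prod_sum_PiE[OF S I])
    also have "\<dots> = (\<Sum>f\<in>S \<rightarrow>\<^sub>E I. C f * (\<Prod>i\<in>I. of_real (u i) ^ ?n f i))"
    proof (rule sum.cong)
      fix f assume "f \<in> S \<rightarrow>\<^sub>E I"
      then have "f ` S \<subseteq> I" by auto
      from prod_eq_prod_power_card[OF S I this, of "\<lambda>i. complex_of_real (u i)"]
      show "(\<Prod>k\<in>S. of_real (u (f k)) * of_real (v (f k) $ j k)) = C f * (\<Prod>i\<in>I. of_real (u i) ^ ?n f i)"
        by (simp add: prod.distrib C_def mult.commute)
    qed simp
    finally have m: "complex_of_real (mon j S ?w) = (\<Sum>f\<in>S \<rightarrow>\<^sub>E I. C f * (\<Prod>i\<in>I. of_real (u i) ^ ?n f i))" .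
    have c: "chi \<alpha> ?w = (\<Prod>i\<in>I. exp (2 * of_real pi * \<i> * of_real ((\<alpha> \<bullet> v i) * u i)))"
      unfolding chi_sum by (intro prod.cong) (simp_all add: chi_def mult_ac)
    have sc: "r *\<^sub>R z = complex_of_real r * z" for r z by (simp add: scaleR_conv_of_real)
    show ?thesis
      unfolding sc ind m c h_def sum_distrib_left sum_distrib_right
      by (intro sum.cong) (simp_all add: prod.distrib mult_ac)
  qed
  have pint: "integrable (\<Pi>\<^sub>M i\<in>I. lborel) (\<lambda>u. \<Prod>i\<in>I. h i (?n f i) (u i))" for f
    by (rule P.product_integrable_prod[OF I hint])
  have "(LINT u:(\<Pi>\<^sub>E i\<in>I. {0..1})|(\<Pi>\<^sub>M i\<in>I. lborel).
      complex_of_real (mon j S (\<Sum>i\<in>I. u i *\<^sub>R v i)) * chi \<alpha> (\<Sum>i\<in>I. u i *\<^sub>R v i)) =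
    (LINT u|(\<Pi>\<^sub>M i\<in>I. lborel). (\<Sum>f\<in>S \<rightarrow>\<^sub>E I. C f * (\<Prod>i\<in>I. h i (?n f i) (u i))))"
    unfolding set_lebesgue_integral_def by (rule Bochner_Integration.integral_cong[OF refl eq])
  also have "\<dots> = (\<Sum>f\<in>S \<rightarrow>\<^sub>E I. LINT u|(\<Pi>\<^sub>M i\<in>I. lborel). C f * (\<Prod>i\<in>I. h i (?n f i) (u i)))"
    by (rule Bochner_Integration.integral_sum) (intro integrable_mult_right pint)
  also have "\<dots> = (\<Sum>f\<in>S \<rightarrow>\<^sub>E I. C f * (\<Prod>i\<in>I. theta (\<alpha> \<bullet> v i) (?n f i)))"
  proof (rule sum.cong)
    fix f
    have "(LINT u|(\<Pi>\<^sub>M i\<in>I. lborel). (\<Prod>i\<in>I. h i (?n f i) (u i))) = (\<Prod>i\<in>I. integral\<^sup>L lborel (h i (?n f i)))"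
      by (rule P.product_integral_prod[OF I hint])
    then show "(LINT u|(\<Pi>\<^sub>M i\<in>I. lborel). C f * (\<Prod>i\<in>I. h i (?n f i) (u i))) = C f * (\<Prod>i\<in>I. theta (\<alpha> \<bullet> v i) (?n f i))"
      by (simp add: h_def theta_def)
  qed simp
  finally show ?thesis by (simp add: C_def)
qed

text \<open>
  For \<open>a \<in> bernoulli_index v I U\<close> with \<open>U \<in> Lambda_sets v I\<close> this set is \<open>U\<close> itself.
\<close>
definition non_orth :: "('i \<Rightarrow> real ^ 'd) \<Rightarrow> 'i set \<Rightarrow> real ^ 'd \<Rightarrow> 'i set" where
  "non_orth v I a = {i \<in> I. a \<bullet> v i \<noteq> 0}"

section \<open>Vectors not orthogonal to a given frequency\<close>

lemma span_orthogonal: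
  assumes "\<And>i. i \<in> J \<Longrightarrow> a \<bullet> v i = 0" "span (v ` J) = UNIV"
  shows "a = (0 :: real ^ 'd)"
proof -
  have "span (v ` J) \<subseteq> {x. a \<bullet> x = 0}"
    by (rule span_minimal) (auto simp: assms(1) subspace_def inner_add_right)
  then have "a \<bullet> a = 0" using assms(2) by blast
  then show ?thesis by simp
qed

text \<open>If there were at most \<open>rho v I\<close> such indices, the remaining vectors would
  span everything by \<open>rho_span\<close>; being orthogonal to \<open>a\<close> they would force
  \<open>a = 0\<close>.\<close>

lemma card_non_orth:
  fixes v :: "'i \<Rightarrow> real ^ 'd"
  assumes I: "finite I" and adm: "admissible_family v I" and a: "a \<noteq> 0"
  shows "rho v I < card (non_orth v I a)"
proof (rule ccontr)
  assume "\<not> rho v I < card (non_orth v I a)"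
  then have "span (v ` (I - non_orth v I a)) = UNIV"
    by (intro rho_span[OF I adm]) (auto simp: non_orth_def)
  then have "a = 0" by (rule span_orthogonal[rotated]) (auto simp: non_orth_def)
  then show False using a by simp
qed

text \<open>A frequency of \<open>U\<close> is orthogonal to the vectors outside \<open>U\<close>,
  and by \<open>card_non_orth\<close> at least \<open>card U\<close> vectors are not orthogonal to
  it; so these are exactly the ones in \<open>U\<close>. Hence a nonzero frequency belongs to at
  most one \<open>U\<close>, and the Bernoulli series do not interfere.\<close>

lemma Lambda_sets_non_orth:
  fixes v :: "'i \<Rightarrow> real ^ 'd"
  assumes I: "finite I" and adm: "admissible_family v I" and a: "a \<in> int_vecs" "a \<noteq> 0"
  shows non_orth_in_Lambda: "card (non_orth v I a) = rho v I + 1 \<Longrightarrow> non_orth v I a \<in> Lambda_sets v I"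
    and bernoulli_index_iff: "U \<in> Lambda_sets v I \<Longrightarrow> a \<in> bernoulli_index v I U \<longleftrightarrow> U = non_orth v I a"
proof -
  assume "card (non_orth v I a) = rho v I + 1"
  moreover have "span (v ` (I - non_orth v I a)) \<noteq> UNIV"
  proof
    assume "span (v ` (I - non_orth v I a)) = UNIV"
    then have "a = 0" by (rule span_orthogonal[rotated]) (auto simp: non_orth_def)
    then show False using a by simp
  qed
  ultimately show "non_orth v I a \<in> Lambda_sets v I" by (auto simp: Lambda_sets_def non_orth_def)
next
  assume U: "U \<in> Lambda_sets v I"
  show "a \<in> bernoulli_index v I U \<longleftrightarrow> U = non_orth v I a"
  proof
    assume "a \<in> bernoulli_index v I U"
    then have sub: "non_orth v I a \<subseteq> U" by (auto simp: bernoulli_index_def non_orth_def inner_commute)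
    have "finite U" "card U = rho v I + 1" using U I by (auto simp: Lambda_sets_def dest: finite_subset)
    moreover from this have "card U \<le> card (non_orth v I a)" using card_non_orth[OF I adm a(2)] by linarith
    ultimately show "U = non_orth v I a" using card_seteq[OF _ sub] by simp
  qed (use a in \<open>auto simp: bernoulli_index_def non_orth_def inner_commute\<close>)
qed

text \<open>In the critical degree a surviving \<open>f\<close> is a bijection onto
  \<open>N\<close>: each parameter of \<open>N\<close> then occurs exactly once and contributes
  \<open>theta\<close> with exponent 1, its factor of the Bernoulli weight, while the other indices
  contribute \<open>theta 0 0 = 1\<close>. If \<open>card N\<close> exceeds
  \<open>rho v I + 1\<close>, both sides are zero.\<close>

lemma box_integral_mon_chi:
  fixes v :: "'i \<Rightarrow> real ^ 'd" and j :: "nat \<Rightarrow> 'd" and \<alpha> :: "real ^ 'd"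
  assumes I: "finite I" and adm: "admissible_family v I" and iv: "\<forall>i\<in>I. v i \<in> int_vecs"
    and a: "\<alpha> \<in> int_vecs" "\<alpha> \<noteq> 0" and S: "finite S"
  defines "E \<equiv> (LINT u:(\<Pi>\<^sub>E i\<in>I. {0..1})|(\<Pi>\<^sub>M i\<in>I. lborel).
      complex_of_real (mon j S (\<Sum>i\<in>I. u i *\<^sub>R v i)) * chi \<alpha> (\<Sum>i\<in>I. u i *\<^sub>R v i))"
  shows "card S \<le> rho v I \<Longrightarrow> E = 0"
    and "card S = rho v I + 1 \<Longrightarrow> E = (\<Sum>U\<in>Lambda_sets v I.
      of_real (\<Sum>f\<in>onto_maps S U. \<Prod>k\<in>S. v (f k) $ j k) *
      (if \<alpha> \<in> bernoulli_index v I U then \<Prod>i\<in>U. 1 / (2 * of_real pi * \<i> * of_real (\<alpha> \<bullet> v i)) else 0))"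
proof -
  define N where "N = non_orth v I \<alpha>"
  let ?C = "\<lambda>f. complex_of_real (\<Prod>k\<in>S. v (f k) $ j k)"
  let ?n = "\<lambda>f i. card {k \<in> S. f k = i}"
  let ?T = "\<lambda>f. \<Prod>i\<in>I. theta (\<alpha> \<bullet> v i) (?n f i)"
  have E: "E = (\<Sum>f\<in>S \<rightarrow>\<^sub>E I. ?C f * ?T f)" unfolding E_def by (rule box_integral_expand[OF I S])
  have NI: "N \<subseteq> I" "finite N" using I by (auto simp: N_def non_orth_def)
  have cN: "rho v I < card N" unfolding N_def by (rule card_non_orth[OF I adm a(2)])
  have T0: "?T f = 0" if "i \<in> N" "i \<notin> f ` S" for f i
  proof -
    have "?n f i = 0" using that(2) S by auto
    moreover have "\<alpha> \<bullet> v i \<in> \<int>" "\<alpha> \<bullet> v i \<noteq> 0" using that(1) iv a(1) by (auto simp: N_def non_orth_def int_vecs_inner)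
    ultimately have "theta (\<alpha> \<bullet> v i) (?n f i) = 0" by (simp add: theta_int_0)
    then show ?thesis using that(1) NI I by (intro prod_zero) auto
  qed
  have big: "?T f = 0" if "card N > card S" for f
  proof -
    have "card (f ` S) < card N" using card_image_le[OF S, of f] that by linarith
    then have "\<not> N \<subseteq> f ` S" using S by (metis card_mono finite_imageI not_le)
    then show ?thesis using T0 by blast
  qed
  { assume "card S \<le> rho v I"
    then have "card N > card S" using cN by linarith
    then show "E = 0" unfolding E by (simp add: big) }
  assume cS: "card S = rho v I + 1"
  have fL: "finite (Lambda_sets v I)" using I by (auto simp: Lambda_sets_def)
  let ?P = "\<lambda>U. \<Prod>i\<in>U. 1 / (2 * of_real pi * \<i> * of_real (\<alpha> \<bullet> v i))"
  have "(\<Sum>U\<in>Lambda_sets v I. of_real (\<Sum>f\<in>onto_maps S U. \<Prod>k\<in>S. v (f k) $ j k) *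
      (if \<alpha> \<in> bernoulli_index v I U then ?P U else 0)) =
    (\<Sum>U\<in>Lambda_sets v I. if U = N then of_real (\<Sum>f\<in>onto_maps S N. \<Prod>k\<in>S. v (f k) $ j k) * ?P N else 0)"
    by (intro sum.cong) (auto simp: bernoulli_index_iff[OF I adm a] N_def)
  also have "\<dots> = (if N \<in> Lambda_sets v I then of_real (\<Sum>f\<in>onto_maps S N. \<Prod>k\<in>S. v (f k) $ j k) * ?P N else 0)"
    using fL by simp
  also have "\<dots> = E"
  proof (cases "card N = rho v I + 1")
    case False
    then have "N \<notin> Lambda_sets v I" by (auto simp: Lambda_sets_def)
    moreover have "card N > card S" using cN cS False by linarith
    ultimately show ?thesis unfolding E by (simp add: big)
  next
    case True
    have "E = (\<Sum>f\<in>onto_maps S N. ?C f * ?P N)"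
      unfolding E
    proof (rule sum.mono_neutral_cong_right)
      show "finite (S \<rightarrow>\<^sub>E I)" using S I by (intro finite_PiE) auto
      show "onto_maps S N \<subseteq> S \<rightarrow>\<^sub>E I" using PiE_mono[of S "\<lambda>_. N" "\<lambda>_. I"] NI(1) by (auto simp: onto_maps_def)
      show "\<forall>f\<in>(S \<rightarrow>\<^sub>E I) - onto_maps S N. ?C f * ?T f = 0"
      proof
        fix f assume f: "f \<in> (S \<rightarrow>\<^sub>E I) - onto_maps S N"
        have "\<not> N \<subseteq> f ` S"
        proof
          assume "N \<subseteq> f ` S"
          moreover have "card (f ` S) \<le> card N" using card_image_le[OF S, of f] cS True by simp
          ultimately have "N = f ` S" using S by (intro card_seteq) auto
          then show False using f by (auto simp: onto_maps_def PiE_iff)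
        qed
        then obtain i where "i \<in> N" "i \<notin> f ` S" by blast
        from T0[OF this] show "?C f * ?T f = 0" by simp
      qed
      fix f assume f: "f \<in> onto_maps S N"
      then have fN: "f ` S = N" by (simp add: onto_maps_def)
      have inj: "inj_on f S" using S fN True cS by (intro eq_card_imp_inj_on) auto
      have "?T f = (\<Prod>i\<in>N. 1 / (2 * of_real pi * \<i> * of_real (\<alpha> \<bullet> v i)))"
      proof (rule prod.mono_neutral_cong_right[OF I NI(1)])
        show "\<forall>i\<in>I - N. theta (\<alpha> \<bullet> v i) (?n f i) = 1"
        proof
          fix i assume i: "i \<in> I - N"
          then have "?n f i = 0" using fN S by auto
          moreover have "\<alpha> \<bullet> v i = 0" using i by (auto simp: N_def non_orth_def)
          ultimately show "theta (\<alpha> \<bullet> v i) (?n f i) = 1" by (simp only: theta_0_0)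
        qed
        fix i assume i: "i \<in> N"
        then obtain k where k: "k \<in> S" "f k = i" using fN by auto
        then have "{k \<in> S. f k = i} = {k}" using inj by (auto simp: inj_on_def)
        then have n1: "?n f i = Suc 0" by simp
        have ints: "\<alpha> \<bullet> v i \<in> \<int>" "\<alpha> \<bullet> v i \<noteq> 0" using i iv a(1) by (auto simp: N_def non_orth_def int_vecs_inner)
        show "theta (\<alpha> \<bullet> v i) (?n f i) = 1 / (2 * of_real pi * \<i> * of_real (\<alpha> \<bullet> v i))"
          unfolding n1 by (rule theta_int_1[OF ints])
      qed
      then show "?C f * ?T f = ?C f * ?P N" by simp
    qed
    also have "\<dots> = of_real (\<Sum>f\<in>onto_maps S N. \<Prod>k\<in>S. v (f k) $ j k) * ?P N"
      by (simp add: sum_distrib_right)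
    finally show ?thesis
      using non_orth_in_Lambda[OF I adm a] True by (simp add: N_def)
  qed
  finally show "E = (\<Sum>U\<in>Lambda_sets v I. of_real (\<Sum>f\<in>onto_maps S U. \<Prod>k\<in>S. v (f k) $ j k) *
      (if \<alpha> \<in> bernoulli_index v I U then ?P U else 0))" ..
qed

section \<open>Bernoulli splines\<close>

text \<open>Cramer's rule: the entries of the dual basis vector are determinants of integer matrices
  divided by \<open>det A\<close>, so \<open>det A\<close> times this vector is integral.\<close>

lemma integer_dual_vector:
  fixes Bs :: "(real ^ 'd) set"
  assumes Bs: "Bs \<subseteq> int_vecs" "independent Bs" "span Bs = UNIV" and b: "b \<in> Bs"
  shows "\<exists>\<alpha>\<in>int_vecs. \<alpha> \<bullet> b \<noteq> 0 \<and> (\<forall>c\<in>Bs - {b}. \<alpha> \<bullet> c = 0)"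
proof -
  have "card Bs = CARD('d)"
    using dim_eq_card[of Bs UNIV] Bs(2,3) by (simp add: dim_UNIV)
  moreover have "finite Bs" using Bs(2) by (rule independent_imp_finite)
  ultimately obtain h :: "'d \<Rightarrow> real ^ 'd" where h: "bij_betw h UNIV Bs"
    by (metis finite_class.finite_UNIV finite_same_card_bij)
  define A where "A = (\<chi> i. h i)"
  have hB: "h i \<in> int_vecs" for i using h Bs(1) by (auto simp: bij_betw_def)
  have "rows A = Bs"
    using h by (auto simp: rows_def row_def A_def bij_betw_def)
  then have "invertible A"
    using Bs(3) matrix_left_invertible_span_rows[of A] by (simp add: invertible_left_inverse)
  then have dA: "det A \<noteq> 0" by (simp add: invertible_det_nz)
  obtain i0 where i0: "h i0 = b" using h b by (metis bij_betw_imp_surj_on imageE)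
  define x where "x = (\<chi> k. det (\<chi> i j. if j = k then axis i0 1 $ i else A $ i $ j) / det A)"
  have Ax: "A *v x = axis i0 1" using cramer[OF dA, of x "axis i0 1"] by (simp add: x_def)
  have hx: "h i \<bullet> x = (if i = i0 then 1 else 0)" for i
  proof -
    have "h i \<bullet> x = (A *v x) $ i" by (simp add: matrix_vector_mult_def A_def inner_vec_def)
    then show ?thesis by (simp add: Ax axis_def)
  qed
  have int: "det (\<chi> i j. if j = k then axis i0 1 $ i else A $ i $ j) \<in> \<int>" for k
    unfolding det_def using hB
    by (intro Ints_sum Ints_mult Ints_prod) (auto simp: A_def axis_def int_vecs_def)
  show ?thesis
  proof (rule bexI[of _ "det A *\<^sub>R x"])
    have "det A *\<^sub>R x = (\<chi> k. det (\<chi> i j. if j = k then axis i0 1 $ i else A $ i $ j))"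
      using dA by (simp add: x_def vec_eq_iff)
    then show "det A *\<^sub>R x \<in> int_vecs" using int by (simp add: int_vecs_def)
    have e: "(det A *\<^sub>R x) \<bullet> h i = (if i = i0 then det A else 0)" for i
      using hx[of i] by (simp add: inner_commute)
    show "(det A *\<^sub>R x) \<bullet> b \<noteq> 0 \<and> (\<forall>c\<in>Bs - {b}. (det A *\<^sub>R x) \<bullet> c = 0)"
    proof (intro conjI ballI)
      show "(det A *\<^sub>R x) \<bullet> b \<noteq> 0" using e[of i0] dA unfolding i0 by metis
      fix c assume c: "c \<in> Bs - {b}"
      then obtain i where "c = h i" using h by (auto simp: bij_betw_def)
      moreover from this have "i \<noteq> i0" using c i0 by auto
      ultimately show "(det A *\<^sub>R x) \<bullet> c = 0" using e[of i] by metis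
    qed
  qed
qed

text \<open>Restoring one index \<open>u\<close> of \<open>U\<close> leaves only
  \<open>rho v I\<close> indices removed, so the family spans again. Hence the vectors outside
  \<open>U\<close> span a hyperplane without \<open>v u\<close>, and the integral dual vector of
  \<open>v u\<close> is a normal of it.\<close>

lemma bernoulli_index_nonempty:
  fixes v :: "'i \<Rightarrow> real ^ 'd"
  assumes I: "finite I" and adm: "admissible_family v I" and iv: "\<forall>i\<in>I. v i \<in> int_vecs"
    and U: "U \<in> Lambda_sets v I"
  shows "bernoulli_index v I U \<noteq> {}"
proof -
  have U': "U \<subseteq> I" "card U = rho v I + 1" "span (v ` (I - U)) \<noteq> UNIV" using U by (auto simp: Lambda_sets_def)
  then obtain u where u: "u \<in> U" by (metis card.empty ex_in_conv add_is_0 zero_neq_one)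
  have "card (U - {u}) \<le> rho v I" using U' u I by (simp add: finite_subset)
  then have "span (v ` (I - (U - {u}))) = UNIV" by (intro rho_span[OF I adm]) (use U' in auto)
  moreover have "I - (U - {u}) = insert u (I - U)" using u U' by auto
  ultimately have sp: "span (insert (v u) (v ` (I - U))) = UNIV" by simp
  obtain Bs where Bs: "Bs \<subseteq> v ` (I - U)" "independent Bs" "v ` (I - U) \<subseteq> span Bs"
    using maximal_independent_subset by blast
  have "span (v ` (I - U)) = span Bs"
    using span_mono[OF Bs(1)] span_mono[OF Bs(3)] by (simp add: span_span)
  then have "span (insert (v u) Bs) = UNIV" using sp by (simp add: span_insert)
  moreover have nin: "v u \<notin> span Bs"
  proof
    assume "v u \<in> span Bs"
    then have "span (insert (v u) Bs) = span Bs" by (rule span_redundant)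
    then show False using \<open>span (insert (v u) Bs) = UNIV\<close> \<open>span (v ` (I - U)) = span Bs\<close> U'(3) by simp
  qed
  moreover have "independent (insert (v u) Bs)" using Bs(2) nin by (simp add: independent_insert)
  moreover have "insert (v u) Bs \<subseteq> int_vecs" using Bs(1) iv u U'(1) by auto
  ultimately obtain \<alpha> where \<alpha>: "\<alpha> \<in> int_vecs" "\<alpha> \<bullet> v u \<noteq> 0" "\<forall>c\<in>insert (v u) Bs - {v u}. \<alpha> \<bullet> c = 0"
    using integer_dual_vector[of "insert (v u) Bs" "v u"] by auto
  have "v u \<notin> Bs" using nin span_base by blast
  then have "\<forall>c\<in>Bs. \<alpha> \<bullet> c = 0" using \<alpha>(3) by auto
  then have "span Bs \<subseteq> {x. \<alpha> \<bullet> x = 0}"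
    by (intro span_minimal) (auto simp: subspace_def inner_add_right)
  then have "\<alpha> \<bullet> v i = 0" if "i \<in> I - U" for i using Bs(3) that by blast
  then have "\<forall>i\<in>I - U. v i \<bullet> \<alpha> = 0" by (simp add: inner_commute)
  then have "\<alpha> \<in> bernoulli_index v I U" using \<alpha> by (auto simp: bernoulli_index_def)
  then show ?thesis by auto
qed

text \<open>Division with remainder: an index vector has a nonzero integer product with
  \<open>v u\<close>, and one minimizing the absolute value of this product generates the others,
  since a nonzero remainder \<open>z\<close> would be an index vector with a smaller product. This
  existence justifies the choice by \<open>SOME\<close>.\<close>

lemma bernoulli_direction:
  fixes v :: "'i \<Rightarrow> real ^ 'd"
  assumes I: "finite I" and adm: "admissible_family v I" and iv: "\<forall>i\<in>I. v i \<in> int_vecs"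
    and U: "U \<in> Lambda_sets v I"
  defines "a \<equiv> bernoulli_direction v I U"
  shows "a \<in> int_vecs" "a \<noteq> 0" "bernoulli_index v I U = {of_int k *\<^sub>R a |k :: int. k \<noteq> 0}"
proof -
  have U': "U \<subseteq> I" "card U = rho v I + 1" using U by (auto simp: Lambda_sets_def)
  then obtain u where u: "u \<in> U" by (metis card.empty ex_in_conv add_is_0 zero_neq_one)
  let ?X = "bernoulli_index v I U"
  have nz: "x \<bullet> v u \<noteq> 0" if "x \<in> ?X" for x
    using that bernoulli_index_iff[OF I adm _ _ U, of x] u by (auto simp: bernoulli_index_def non_orth_def)
  define m where "m = (\<lambda>x. nat \<bar>\<lfloor>x \<bullet> v u\<rfloor>\<bar>)"
  have fl: "of_int \<lfloor>x \<bullet> v u\<rfloor> = x \<bullet> v u" if "x \<in> int_vecs" for x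
  proof -
    have "v u \<in> int_vecs" using iv u U'(1) by auto
    from int_vecs_inner[OF that this] obtain n :: int where "x \<bullet> v u = of_int n" by (auto elim: Ints_cases)
    then show ?thesis by simp
  qed
  obtain x0 where x0: "x0 \<in> ?X" "\<And>y. y \<in> ?X \<Longrightarrow> m x0 \<le> m y"
    using arg_min_nat_lemma[of "\<lambda>x. x \<in> ?X"] bernoulli_index_nonempty[OF I adm iv U] by blast
  have x0': "x0 \<in> int_vecs" "x0 \<noteq> 0" using x0(1) by (auto simp: bernoulli_index_def)
  define k0 where "k0 = \<lfloor>x0 \<bullet> v u\<rfloor>"
  have k0: "of_int k0 = x0 \<bullet> v u" unfolding k0_def by (rule fl[OF x0'(1)])
  then have k00: "k0 \<noteq> 0" using nz[OF x0(1)] by auto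
  have "?X = {of_int k *\<^sub>R x0 |k :: int. k \<noteq> 0}"
  proof (intro equalityI subsetI)
    fix y assume y: "y \<in> ?X"
    then have y': "y \<in> int_vecs" "y \<noteq> 0" by (auto simp: bernoulli_index_def)
    define l where "l = \<lfloor>y \<bullet> v u\<rfloor>"
    have l: "of_int l = y \<bullet> v u" unfolding l_def by (rule fl[OF y'(1)])
    define z where "z = y - of_int (l div k0) *\<^sub>R x0"
    have zi: "z \<in> int_vecs" unfolding z_def using y' x0' by (intro int_vecs_diff int_vecs_scale)
    have zv: "z \<bullet> v u = of_int (l mod k0)"
      by (simp add: z_def inner_diff_left l[symmetric] k0[symmetric] minus_div_mult_eq_mod[symmetric] mult.commute)
    have "z = 0"
    proof (rule ccontr)
      assume "z \<noteq> 0"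
      then have zX: "z \<in> ?X"
        using y x0(1) zi by (auto simp: bernoulli_index_def z_def inner_diff_right)
      have "m x0 \<le> m z" by (rule x0(2)[OF zX])
      then have "\<bar>k0\<bar> \<le> \<bar>l mod k0\<bar>" by (simp add: m_def zv k0_def[symmetric])
      then show False using abs_mod_less[OF k00, of l] by linarith
    qed
    then have "y = of_int (l div k0) *\<^sub>R x0" by (simp add: z_def)
    moreover have "l div k0 \<noteq> 0" using calculation y'(2) by auto
    ultimately show "y \<in> {of_int k *\<^sub>R x0 |k :: int. k \<noteq> 0}" by blast
  next
    fix y assume "y \<in> {of_int k *\<^sub>R x0 |k :: int. k \<noteq> 0}"
    then show "y \<in> ?X" using x0(1) by (auto simp: bernoulli_index_def int_vecs_scale)
  qed
  then have "\<exists>a. a \<in> int_vecs \<and> a \<noteq> 0 \<and> ?X = {of_int k *\<^sub>R a |k :: int. k \<noteq> 0}" using x0' by blast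
  from someI_ex[OF this] show "a \<in> int_vecs" "a \<noteq> 0" "?X = {of_int k *\<^sub>R a |k :: int. k \<noteq> 0}"
    unfolding a_def bernoulli_direction_def by blast+
qed

section \<open>Summability of the Bernoulli weights\<close>

lemma summable_on_inverse_square_int: "(\<lambda>k::int. 1 / (real_of_int k)\<^sup>2) summable_on UNIV - {0}"
proof (rule nonneg_bdd_above_summable_on)
  have sm: "summable (\<lambda>n::nat. 1 / (real n)\<^sup>2)"
    using inverse_power_summable[of 2, where 'a=real] by (simp add: inverse_eq_divide)
  show "bdd_above (sum (\<lambda>k::int. 1 / (real_of_int k)\<^sup>2) ` {F. F \<subseteq> UNIV - {0} \<and> finite F})"
  proof (rule bdd_aboveI2)
    fix F :: "int set" assume "F \<in> {F. F \<subseteq> UNIV - {0} \<and> finite F}"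
    then have F: "finite F" "0 \<notin> F" by auto
    define N where "N = (\<Sum>k\<in>F. nat \<bar>k\<bar>)"
    have "nat \<bar>k\<bar> \<le> N" if "k \<in> F" for k unfolding N_def by (rule member_le_sum[OF that _ F(1)]) simp
    then have "k \<in> {- int N..int N} - {0}" if "k \<in> F" for k using that F(2) by (cases "k = 0") (simp, fastforce)
    then have "(\<Sum>k\<in>F. 1 / (real_of_int k)\<^sup>2) \<le> (\<Sum>k\<in>{- int N..int N} - {0}. 1 / (real_of_int k)\<^sup>2)"
      by (intro sum_mono2) auto
    also have "\<dots> = 2 * (\<Sum>k=1..N. 1 / (real k)\<^sup>2)"
      unfolding symmetric_int_sum by (simp add: sum_distrib_left)
    also have "\<dots> \<le> 2 * (\<Sum>n. 1 / (real n)\<^sup>2)"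
      by (intro mult_left_mono sum_le_suminf sm) auto
    finally show "(\<Sum>k\<in>F. 1 / (real_of_int k)\<^sup>2) \<le> 2 * (\<Sum>n. 1 / (real n)\<^sup>2)" .
  qed
qed auto

definition bernoulli_weight :: "('i \<Rightarrow> real ^ 'd) \<Rightarrow> 'i set \<Rightarrow> real ^ 'd \<Rightarrow> complex" where
  "bernoulli_weight v U a = (\<Prod>i\<in>U. 1 / (2 * of_real pi * \<i> * of_real (a \<bullet> v i)))"

lemma bernoulli_term_eq: "bernoulli_term v U x a = bernoulli_weight v U a * chi a x"
  by (simp add: bernoulli_term_def bernoulli_weight_def chi_def)

text \<open>For \<open>rho v I\<close> at least 1 the weight has at least two factors. At the
  multiple \<open>k\<close> of the direction each is at most 1/|k|, since the products of the
  direction with the vectors of \<open>U\<close> are nonzero integers.\<close>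

lemma summable_bernoulli_weight:
  fixes v :: "'i \<Rightarrow> real ^ 'd"
  assumes I: "finite I" and adm: "admissible_family v I" and iv: "\<forall>i\<in>I. v i \<in> int_vecs"
    and U: "U \<in> Lambda_sets v I" and rho: "rho v I \<ge> 1"
  shows "(\<lambda>a. cmod (bernoulli_weight v U a)) summable_on bernoulli_index v I U"
proof -
  have U': "U \<subseteq> I" "card U = rho v I + 1" "finite U" using U I by (auto simp: Lambda_sets_def finite_subset)
  define a where "a = bernoulli_direction v I U"
  note a = bernoulli_direction[OF I adm iv U, folded a_def]
  have aX: "a \<in> bernoulli_index v I U" unfolding a(3) by (rule CollectI, rule exI[of _ 1]) simp
  have av: "1 \<le> \<bar>a \<bullet> v i\<bar>" if "i \<in> U" for i
  proof -
    have "a \<bullet> v i \<noteq> 0"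
      using aX bernoulli_index_iff[OF I adm a(1,2) U] that by (auto simp: non_orth_def)
    moreover have "a \<bullet> v i \<in> \<int>" using a(1) iv U' that by (auto intro: int_vecs_inner)
    ultimately show ?thesis by (metis Ints_nonzero_abs_ge1)
  qed
  have eq: "bernoulli_index v I U = (\<lambda>k :: int. of_int k *\<^sub>R a) ` (UNIV - {0})" unfolding a(3) by auto
  have inj: "inj_on (\<lambda>k :: int. of_int k *\<^sub>R a) (UNIV - {0})" using a(2) by (auto intro!: inj_onI)
  have "(\<lambda>k :: int. cmod (bernoulli_weight v U (of_int k *\<^sub>R a))) summable_on UNIV - {0}"
  proof (rule summable_on_comparison_test[OF summable_on_inverse_square_int])
    fix k :: int assume "k \<in> UNIV - {0}"
    then have k: "1 \<le> \<bar>real_of_int k\<bar>" by auto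
    have "cmod (bernoulli_weight v U (of_int k *\<^sub>R a)) = (\<Prod>i\<in>U. 1 / (2 * pi * (\<bar>real_of_int k\<bar> * \<bar>a \<bullet> v i\<bar>)))"
      unfolding bernoulli_weight_def prod_norm[symmetric]
      by (intro prod.cong) (simp_all add: norm_divide norm_mult abs_mult)
    also have "\<dots> \<le> (\<Prod>i\<in>U. 1 / \<bar>real_of_int k\<bar>)"
    proof (rule prod_mono)
      fix i assume i: "i \<in> U"
      have "1 * (\<bar>real_of_int k\<bar> * 1) \<le> 2 * pi * (\<bar>real_of_int k\<bar> * \<bar>a \<bullet> v i\<bar>)"
        using av[OF i] pi_gt3 by (intro mult_mono) auto
      then show "0 \<le> 1 / (2 * pi * (\<bar>real_of_int k\<bar> * \<bar>a \<bullet> v i\<bar>)) \<and>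
          1 / (2 * pi * (\<bar>real_of_int k\<bar> * \<bar>a \<bullet> v i\<bar>)) \<le> 1 / \<bar>real_of_int k\<bar>"
        using k by (auto intro!: divide_left_mono mult_pos_pos dest: order_less_le_trans[OF zero_less_one])
    qed
    also have "\<dots> = (1 / \<bar>real_of_int k\<bar>) ^ card U" by simp
    also have "\<dots> \<le> (1 / \<bar>real_of_int k\<bar>) ^ 2"
      using k rho U'(2) by (intro power_decreasing) auto
    finally show "cmod (bernoulli_weight v U (of_int k *\<^sub>R a)) \<le> 1 / (real_of_int k)\<^sup>2"
      by (simp add: power_divide)
  qed auto
  then show ?thesis unfolding eq by (subst summable_on_reindex[OF inj]) (simp add: o_def)
qed

lemma bernoulli_spline_rho_0:
  fixes v :: "'i \<Rightarrow> real ^ 'd"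
  assumes I: "finite I" and adm: "admissible_family v I" and iv: "\<forall>i\<in>I. v i \<in> int_vecs"
    and U: "U \<in> Lambda_sets v I" and rho: "rho v I = 0"
  obtains u where "U = {u}"
    "\<And>x. bernoulli_spline v I U x = of_real (sawtooth (bernoulli_direction v I U \<bullet> x) / (bernoulli_direction v I U \<bullet> v u))"
proof -
  have "card U = 1" using U rho by (auto simp: Lambda_sets_def)
  then obtain u where u: "U = {u}" by (auto simp: card_1_singleton_iff)
  define a where "a = bernoulli_direction v I U"
  have "bernoulli_spline v I U x = of_real (sawtooth (a \<bullet> x) / (a \<bullet> v u))" for x
  proof -
    have "bernoulli_term v U x (of_int k *\<^sub>R a) = 1 / of_real (a \<bullet> v u) *
        (1 / (2 * of_real pi * \<i> * of_int k) * exp (2 * of_real pi * \<i> * of_real (of_int k * (a \<bullet> x))))" for k :: int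
      by (simp add: bernoulli_term_def u mult_ac)
    then have "(\<lambda>N. \<Sum>k\<in>{- int N..int N} - {0}. bernoulli_term v U x (of_int k *\<^sub>R a)) =
        (\<lambda>N. 1 / of_real (a \<bullet> v u) * (\<Sum>k\<in>{- int N..int N} - {0}.
          1 / (2 * of_real pi * \<i> * of_int k) * exp (2 * of_real pi * \<i> * of_real (of_int k * (a \<bullet> x)))))"
      by (simp add: sum_distrib_left)
    also have "\<dots> \<longlonglongrightarrow> 1 / of_real (a \<bullet> v u) * of_real (sawtooth (a \<bullet> x))"
      by (intro tendsto_mult tendsto_const sawtooth_sums)
    finally show ?thesis using rho by (simp add: bernoulli_spline_def a_def limI)
  qed
  with u that show thesis unfolding a_def by blast
qed

text \<open>The two regimes meet here: absolute convergence for \<open>rho v I\<close> at least 1, a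
  rescaled sawtooth for \<open>rho v I = 0\<close>. The first four facts have the same form in both,
  so that the Fourier comparison needs no case distinction.\<close>

lemma bernoulli_spline_props:
  fixes v :: "'i \<Rightarrow> real ^ 'd"
  assumes I: "finite I" and adm: "admissible_family v I" and iv: "\<forall>i\<in>I. v i \<in> int_vecs"
    and U: "U \<in> Lambda_sets v I"
  shows borel_measurable_bernoulli_spline: "bernoulli_spline v I U \<in> borel_measurable borel"
    and bounded_bernoulli_spline: "\<exists>K. \<forall>x. cmod (bernoulli_spline v I U x) \<le> K"
    and periodic_bernoulli_spline: "g \<in> int_vecs \<Longrightarrow> bernoulli_spline v I U (x + g) = bernoulli_spline v I U x"
    and fourier_coeff_bernoulli_spline: "b \<in> int_vecs \<Longrightarrow>
      (LINT x:qcube|lborel. bernoulli_spline v I U x * chi b x) =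
      (if - b \<in> bernoulli_index v I U then bernoulli_weight v U (- b) else 0)"
    and continuous_bernoulli_spline: "rho v I \<ge> 1 \<Longrightarrow> continuous_on UNIV (bernoulli_spline v I U)"
    and symmetric_limit_bernoulli_spline: "rho v I = 0 \<Longrightarrow>
      isCont (\<lambda>h. bernoulli_spline v I U (x + h) + bernoulli_spline v I U (x - h)) 0"
proof -
  define a where "a = bernoulli_direction v I U"
  note a = bernoulli_direction[OF I adm iv U, folded a_def]
  have idx: "bernoulli_index v I U \<subseteq> int_vecs" by (auto simp: bernoulli_index_def)
  have tper: "bernoulli_term v U (x + g) \<alpha> = bernoulli_term v U x \<alpha>" if "\<alpha> \<in> int_vecs" "g \<in> int_vecs" for \<alpha> x g
    using chi_int[OF that] by (simp add: bernoulli_term_eq chi_add_right)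
  show "bernoulli_spline v I U (x + g) = bernoulli_spline v I U x" if "g \<in> int_vecs" for x g
  proof -
    have "(\<Sum>\<^sub>\<infinity>\<alpha>\<in>bernoulli_index v I U. bernoulli_term v U (x + g) \<alpha>) = (\<Sum>\<^sub>\<infinity>\<alpha>\<in>bernoulli_index v I U. bernoulli_term v U x \<alpha>)"
      using idx that by (intro infsum_cong tper) auto
    moreover have "bernoulli_term v U (x + g) (of_int k *\<^sub>R a) = bernoulli_term v U x (of_int k *\<^sub>R a)" for k :: int
      by (intro tper int_vecs_scale a that)
    ultimately show ?thesis by (simp add: bernoulli_spline_def a_def)
  qed
  have ge1: "continuous_on UNIV (bernoulli_spline v I U)"
      "\<And>x. cmod (bernoulli_spline v I U x) \<le> (\<Sum>\<^sub>\<infinity>\<alpha>\<in>bernoulli_index v I U. cmod (bernoulli_weight v U \<alpha>))"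
      "\<And>b. b \<in> int_vecs \<Longrightarrow> (LINT x:qcube|lborel. bernoulli_spline v I U x * chi b x) =
        (if - b \<in> bernoulli_index v I U then bernoulli_weight v U (- b) else 0)"
    if rho: "rho v I \<ge> 1"
  proof -
    have eq: "bernoulli_spline v I U = (\<lambda>x. \<Sum>\<^sub>\<infinity>\<alpha>\<in>bernoulli_index v I U. bernoulli_weight v U \<alpha> * chi \<alpha> x)"
      using rho unfolding bernoulli_spline_def bernoulli_term_eq by auto
    note t = abs_trig_series[OF idx summable_bernoulli_weight[OF I adm iv U rho]]
    show "continuous_on UNIV (bernoulli_spline v I U)" unfolding eq by (rule t(1))
    show "cmod (bernoulli_spline v I U x) \<le> (\<Sum>\<^sub>\<infinity>\<alpha>\<in>bernoulli_index v I U. cmod (bernoulli_weight v U \<alpha>))" for x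
      unfolding eq by (rule t(2))
    show "b \<in> int_vecs \<Longrightarrow> (LINT x:qcube|lborel. bernoulli_spline v I U x * chi b x) =
        (if - b \<in> bernoulli_index v I U then bernoulli_weight v U (- b) else 0)" for b
      unfolding eq by (rule t(3))
  qed
  show "rho v I \<ge> 1 \<Longrightarrow> continuous_on UNIV (bernoulli_spline v I U)" by (rule ge1(1))
  have rho_cases: "rho v I \<ge> 1 \<or> rho v I = 0" by linarith
  show "bernoulli_spline v I U \<in> borel_measurable borel"
    using rho_cases
  proof
    assume "rho v I \<ge> 1"
    then show ?thesis by (intro borel_measurable_continuous_onI ge1(1))
  next
    assume "rho v I = 0"
    from bernoulli_spline_rho_0[OF I adm iv U this] obtain u where
      "\<And>x. bernoulli_spline v I U x = of_real (sawtooth (a \<bullet> x) / (a \<bullet> v u))" unfolding a_def by metis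
    then have "bernoulli_spline v I U = (\<lambda>x. of_real (sawtooth (a \<bullet> x) / (a \<bullet> v u)))" by auto
    moreover have "(\<lambda>x. complex_of_real (sawtooth (a \<bullet> x) / (a \<bullet> v u))) \<in> borel_measurable borel" by measurable
    ultimately show ?thesis by simp
  qed
  show "\<exists>K. \<forall>x. cmod (bernoulli_spline v I U x) \<le> K"
    using rho_cases
  proof
    assume "rho v I \<ge> 1"
    then show ?thesis using ge1(2) by blast
  next
    assume "rho v I = 0"
    from bernoulli_spline_rho_0[OF I adm iv U this] obtain u where
      eq: "\<And>x. bernoulli_spline v I U x = of_real (sawtooth (a \<bullet> x) / (a \<bullet> v u))" unfolding a_def by metis
    have "cmod (bernoulli_spline v I U x) \<le> 1 / \<bar>a \<bullet> v u\<bar>" for x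
      unfolding eq norm_of_real abs_divide by (intro divide_right_mono sawtooth_bound) auto
    then show ?thesis by blast
  qed
  show "isCont (\<lambda>h. bernoulli_spline v I U (x + h) + bernoulli_spline v I U (x - h)) 0" if rho0: "rho v I = 0" for x
  proof -
    from bernoulli_spline_rho_0[OF I adm iv U rho0] obtain u where
      eq: "\<And>x. bernoulli_spline v I U x = of_real (sawtooth (a \<bullet> x) / (a \<bullet> v u))" unfolding a_def by metis
    have "isCont (\<lambda>t. sawtooth (a \<bullet> x + t) + sawtooth (a \<bullet> x - t)) 0"
      using sawtooth_symmetric_limit[of "a \<bullet> x"] by (simp add: isCont_def)
    define S where "S = (\<lambda>h. sawtooth (a \<bullet> x + a \<bullet> h) + sawtooth (a \<bullet> x - a \<bullet> h))"
    have "isCont S 0"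
      using isCont_o2[of 0 "\<lambda>h. a \<bullet> h" "\<lambda>t. sawtooth (a \<bullet> x + t) + sawtooth (a \<bullet> x - t)"]
        \<open>isCont (\<lambda>t. sawtooth (a \<bullet> x + t) + sawtooth (a \<bullet> x - t)) 0\<close> by (simp add: S_def)
    then have "isCont (\<lambda>h. complex_of_real (S h * (1 / (a \<bullet> v u)))) 0"
      by (intro continuous_intros)
    then show ?thesis unfolding eq inner_add_right inner_diff_right of_real_add[symmetric] S_def
      by (simp add: add_divide_distrib)
  qed
  show "(LINT x:qcube|lborel. bernoulli_spline v I U x * chi b x) =
      (if - b \<in> bernoulli_index v I U then bernoulli_weight v U (- b) else 0)" if b: "b \<in> int_vecs" for b
    using rho_cases
  proof
    assume "rho v I \<ge> 1"
    then show ?thesis using ge1(3) b by blast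
  next
    assume "rho v I = 0"
    from bernoulli_spline_rho_0[OF I adm iv U this] obtain u where u: "U = {u}" and
      eq: "\<And>x. bernoulli_spline v I U x = of_real (sawtooth (a \<bullet> x) / (a \<bullet> v u))" unfolding a_def by metis
    have "(LINT x:qcube|lborel. bernoulli_spline v I U x * chi b x) =
        (LINT x:qcube|lborel. 1 / of_real (a \<bullet> v u) * (of_real (sawtooth (a \<bullet> x)) * chi b x))"
      by (simp add: eq)
    also have "\<dots> = 1 / of_real (a \<bullet> v u) * (LINT x:qcube|lborel. of_real (sawtooth (a \<bullet> x)) * chi b x)"
      by (rule set_integral_mult_right)
    also have "\<dots> = (if - b \<in> bernoulli_index v I U then bernoulli_weight v U (- b) else 0)"
    proof (cases "- b \<in> bernoulli_index v I U")
      case True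
      then obtain k :: int where k: "k \<noteq> 0" "- b = of_int k *\<^sub>R a" unfolding a(3) by blast
      have "bernoulli_weight v U (- b) = 1 / of_real (a \<bullet> v u) * (1 / (2 * of_real pi * \<i> * of_int k))"
        unfolding bernoulli_weight_def u k(2) by simp
      then show ?thesis using fourier_coeff_sawtooth(1)[OF a(1,2) b k] True by simp
    next
      case False
      have "(LINT x:qcube|lborel. of_real (sawtooth (a \<bullet> x)) * chi b x) = 0"
        using False unfolding a(3) by (rule fourier_coeff_sawtooth(2)[OF a(1,2) b])
      then show ?thesis using False by simp
    qed
    finally show ?thesis .
  qed
qed

section \<open>Periodized moments of a box spline\<close>

lemma continuous_AE_eq_imp_eq:
  fixes f g :: "real ^ 'd \<Rightarrow> complex"
  assumes "continuous_on UNIV f" "continuous_on UNIV g" "AE x in lborel. f x = g x"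
  shows "f x = g x"
proof -
  have "closed {x. f x = g x}" using assms(1,2) by (rule closed_Collect_eq)
  moreover have "AE x in lebesgue. x \<in> {x. f x = g x}" using assms(3) by (auto intro: AE_completion)
  ultimately have "x \<in> {x. f x = g x}" by (rule mem_closed_if_AE_lebesgue)
  then show ?thesis by simp
qed

lemma mon_empty [simp]: "mon j {} x = 1"
  by (simp add: mon_def)

lemma continuous_on_mon [continuous_intros]: "continuous_on A f \<Longrightarrow> continuous_on A (\<lambda>x. mon j S (f x))"
  unfolding mon_def by (intro continuous_intros)

lemma borel_measurable_mon [measurable]: "mon j S \<in> borel_measurable borel"
  by (intro borel_measurable_continuous_onI continuous_on_mon continuous_on_id)

lemma perio_mult_periodic:
  assumes "\<And>g x. g \<in> int_vecs \<Longrightarrow> h (x + g) = h x"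
  shows "perio (\<lambda>x. f x * h x) x = perio f x * h x"
proof -
  have "h (x - g) = h x" if "g \<in> int_vecs" for g
    using assms[OF int_vecs_uminus[OF that], of x] by simp
  then have "(\<Sum>\<^sub>\<infinity>g\<in>int_vecs. f (x - g) * h (x - g)) = (\<Sum>\<^sub>\<infinity>g\<in>int_vecs. f (x - g) * h x)"
    by (intro infsum_cong) simp
  then show ?thesis by (simp add: perio_def infsum_cmult_left')
qed

locale lattice_box_spline =
  fixes I :: "'i set" and v :: "'i \<Rightarrow> real ^ 'd" and B :: "real ^ 'd \<Rightarrow> real"
  assumes finI: "finite I"
    and intv: "\<forall>i\<in>I. v i \<in> int_vecs"
    and adm: "admissible_family v I"
    and box: "is_box_spline v I B"
begin

lemma integrable_B: "integrable lborel B"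
  using box by (simp add: is_box_spline_def)

lemma borel_measurable_B [measurable]: "B \<in> borel_measurable borel"
  using integrable_B by auto

definition R :: real where
  "R = (SOME r. r > 0 \<and> (\<forall>x. norm x > r \<longrightarrow> B x = 0))"

lemma R_pos: "R > 0" and B_supp: "norm x > R \<Longrightarrow> B x = 0"
proof -
  have "bounded (closure {x. B x \<noteq> 0})" using box by (simp add: is_box_spline_def compact_imp_bounded)
  then have "bounded {x. B x \<noteq> 0}" using bounded_subset closure_subset by blast
  then obtain r where r: "r > 0" "\<forall>x\<in>{x. B x \<noteq> 0}. norm x \<le> r" using bounded_pos by blast
  have "\<exists>r. r > 0 \<and> (\<forall>x. norm x > r \<longrightarrow> B x = 0)" by (rule exI[of _ r]) (use r in force)
  from someI_ex[OF this] show "R > 0" "norm x > R \<Longrightarrow> B x = 0" unfolding R_def by blast+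
qed

lemma integrable_mult_B:
  fixes f :: "real ^ 'd \<Rightarrow> complex"
  assumes f: "continuous_on UNIV f"
  shows "integrable lborel (\<lambda>x. f x * of_real (B x))"
proof -
  obtain M where M: "\<And>w. norm w \<le> R \<Longrightarrow> norm (f w) \<le> M"
    by (rule continuous_bounded_cball[where r=R, OF f], rule that)
  have [measurable]: "f \<in> borel_measurable borel" using f by (rule borel_measurable_continuous_onI)
  show ?thesis
  proof (rule Bochner_Integration.integrable_bound)
    show "integrable lborel (\<lambda>x. M * norm (B x))" by (intro integrable_mult_right integrable_norm integrable_B)
    show "AE x in lborel. norm (f x * complex_of_real (B x)) \<le> norm (M * norm (B x))"
    proof (rule AE_I2)
      fix x
      show "norm (f x * complex_of_real (B x)) \<le> norm (M * norm (B x))"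
      proof (cases "norm x > R")
        case True
        then show ?thesis by (simp add: B_supp)
      next
        case False
        then have "norm (f x) \<le> \<bar>M\<bar>" using M[of x] by simp
        then show ?thesis by (simp add: norm_mult abs_mult mult_right_mono)
      qed
    qed
  qed measurable
qed

lemma box_integral:
  fixes f :: "real ^ 'd \<Rightarrow> complex"
  assumes f: "continuous_on UNIV f"
  shows "(LINT x|lborel. f x * of_real (B x)) =
    (LINT u:(\<Pi>\<^sub>E i\<in>I. {0..1})|(\<Pi>\<^sub>M i\<in>I. lborel). f (\<Sum>i\<in>I. u i *\<^sub>R v i))"
proof -
  have real: "(LINT x|lborel. h x * B x) =
      (LINT u:(\<Pi>\<^sub>E i\<in>I. {0..1})|(\<Pi>\<^sub>M i\<in>I. lborel). h (\<Sum>i\<in>I. u i *\<^sub>R v i))"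
    if "continuous_on UNIV h" for h :: "real ^ 'd \<Rightarrow> real"
    using box that unfolding is_box_spline_def by blast
  have i1: "integrable lborel (\<lambda>x. f x * of_real (B x))" by (rule integrable_mult_B[OF f])
  have i2: "integrable (\<Pi>\<^sub>M i\<in>I. lborel) (\<lambda>u. indicator (\<Pi>\<^sub>E i\<in>I. {0..1}) u *\<^sub>R f (\<Sum>i\<in>I. u i *\<^sub>R v i))"
    using set_integrable_box[OF finI f, of v] by (simp add: set_integrable_def)
  have "Re (LINT x|lborel. f x * of_real (B x)) = (LINT x|lborel. Re (f x) * B x)"
    by (subst integral_Re[OF i1, symmetric]) simp
  also have "\<dots> = Re (LINT u:(\<Pi>\<^sub>E i\<in>I. {0..1})|(\<Pi>\<^sub>M i\<in>I. lborel). f (\<Sum>i\<in>I. u i *\<^sub>R v i))"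
    using f unfolding set_lebesgue_integral_def
    by (subst integral_Re[OF i2, symmetric]) (simp add: real continuous_on_Re set_lebesgue_integral_def)
  finally have re: "Re (LINT x|lborel. f x * of_real (B x)) =
      Re (LINT u:(\<Pi>\<^sub>E i\<in>I. {0..1})|(\<Pi>\<^sub>M i\<in>I. lborel). f (\<Sum>i\<in>I. u i *\<^sub>R v i))" .
  have "Im (LINT x|lborel. f x * of_real (B x)) = (LINT x|lborel. Im (f x) * B x)"
    by (subst integral_Im[OF i1, symmetric]) simp
  also have "\<dots> = Im (LINT u:(\<Pi>\<^sub>E i\<in>I. {0..1})|(\<Pi>\<^sub>M i\<in>I. lborel). f (\<Sum>i\<in>I. u i *\<^sub>R v i))"
    using f unfolding set_lebesgue_integral_def
    by (subst integral_Im[OF i2, symmetric]) (simp add: real continuous_on_Im set_lebesgue_integral_def)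
  finally show ?thesis using re by (simp add: complex_eq_iff)
qed

text \<open>Nonnegativity and boundedness pass from the explicit density only almost everywhere.
  Continuity passes fully, because \<open>is_box_spline\<close> obliges \<open>B\<close> to be
  continuous as soon as some continuous function agrees with it almost everywhere.\<close>

lemma B_density:
  obtains C where "AE x in lborel. 0 \<le> B x \<and> B x \<le> C"
    and "rho v I \<ge> 1 \<Longrightarrow> continuous_on UNIV B"
proof -
  obtain g :: "real ^ 'd \<Rightarrow> real" and r C :: real where
    g: "g \<in> borel_measurable borel" "\<And>w. 0 \<le> g w" "\<And>w. g w \<le> C" "\<And>w. norm w > r \<Longrightarrow> g w = 0"
    and gi: "\<And>f. continuous_on UNIV f \<Longrightarrow>
      (LINT u:(\<Pi>\<^sub>E i\<in>I. {0..1})|(\<Pi>\<^sub>M i\<in>I. lborel). f (\<Sum>i\<in>I. u i *\<^sub>R v i)) = (LINT w|lborel. f w * g w)"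
    and gc: "rho v I \<ge> 1 \<Longrightarrow> continuous_on UNIV g"
    by (rule box_density[OF finI adm], rule that)
  note g(1)[measurable]
  have fgint: "integrable lborel (\<lambda>w. f w * g w)" if f: "continuous_on UNIV f" for f :: "real ^ 'd \<Rightarrow> real"
  proof -
    obtain M where M: "\<And>w. norm w \<le> r \<Longrightarrow> \<bar>f w\<bar> \<le> M"
      by (rule continuous_bounded_cball[where r=r, OF f, unfolded real_norm_def], rule that)
    have [measurable]: "f \<in> borel_measurable borel" using f by (rule borel_measurable_continuous_onI)
    show ?thesis
    proof (rule Bochner_Integration.integrable_bound)
      show "integrable lborel (\<lambda>w. (M * C) * indicator (cball (0 :: real ^ 'd) r) w :: real)"
        using emeasure_lborel_cball_finite[of "0 :: real ^ 'd" r]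
        by (intro integrable_mult_right integrable_real_indicator) auto
      show "AE w in lborel. norm (f w * g w) \<le> norm ((M * C) * indicator (cball (0 :: real ^ 'd) r) w)"
      proof (rule AE_I2)
        fix w
        show "norm (f w * g w) \<le> norm ((M * C) * indicator (cball (0 :: real ^ 'd) r) w)"
        proof (cases "norm w \<le> r")
          case True
          have "\<bar>f w\<bar> * \<bar>g w\<bar> \<le> M * C" using M[OF True] g(2,3)[of w] by (intro mult_mono) auto
          also have "\<dots> \<le> \<bar>M * C\<bar>" by (rule abs_ge_self)
          finally show ?thesis using True by (simp add: abs_mult)
        qed (simp add: g(4))
      qed
    qed measurable
  qed
  have "integrable lborel (\<lambda>w. B w - g w)"
    using fgint[of "\<lambda>_. 1"] integrable_B by simp
  moreover have "(LINT x|lborel. f x * (B x - g x)) = 0" if f: "continuous_on UNIV f" for f :: "real ^ 'd \<Rightarrow> real"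
  proof -
    have fB: "integrable lborel (\<lambda>x. f x * B x)"
    proof -
      have "integrable lborel (\<lambda>x. Re (complex_of_real (f x) * of_real (B x)))"
        by (rule integrable_Re[OF integrable_mult_B]) (intro continuous_intros f)
      then show ?thesis by simp
    qed
    have "(LINT x|lborel. f x * B x) = (LINT w|lborel. f w * g w)"
      using box f gi[OF f] unfolding is_box_spline_def by simp
    then show ?thesis using fB fgint[OF f] by (simp add: right_diff_distrib)
  qed
  ultimately have "AE x in lborel. B x - g x = 0" by (rule AE_zero_if_continuous_integrals)
  then have Bg: "AE x in lborel. B x = g x" by eventually_elim simp
  show thesis
  proof
    show "AE x in lborel. 0 \<le> B x \<and> B x \<le> C" using Bg by eventually_elim (use g in auto)
    show "continuous_on UNIV B" if "rho v I \<ge> 1"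
      using box gc[OF that] Bg unfolding is_box_spline_def by blast
  qed
qed

lemma B_nonneg: "AE x in lborel. 0 \<le> B x"
proof -
  obtain C where "AE x in lborel. 0 \<le> B x \<and> B x \<le> C" using B_density by metis
  then show ?thesis by eventually_elim simp
qed

lemma continuous_B: "rho v I \<ge> 1 \<Longrightarrow> continuous_on UNIV B"
  using B_density by metis

lemma integrable_B_squared: "integrable lborel (\<lambda>x. (cmod (of_real (B x)))\<^sup>2)"
proof -
  obtain C where C: "AE x in lborel. 0 \<le> B x \<and> B x \<le> C" using B_density by metis
  show ?thesis
  proof (rule Bochner_Integration.integrable_bound)
    show "integrable lborel (\<lambda>x. C * B x)" by (intro integrable_mult_right integrable_B)
    show "AE x in lborel. norm ((cmod (of_real (B x)))\<^sup>2) \<le> norm (C * B x)"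
      using C by eventually_elim (auto simp: power2_eq_square intro!: mult_right_mono)
  qed measurable
qed

definition G :: "(nat \<Rightarrow> 'd) \<Rightarrow> nat set \<Rightarrow> real ^ 'd \<Rightarrow> complex" where
  "G j S = perio (\<lambda>x. of_real (mon j S x) * of_real (B x))"

definition moment :: "(nat \<Rightarrow> 'd) \<Rightarrow> nat set \<Rightarrow> complex" where
  "moment j S = (LINT x|lborel. of_real (mon j S x) * of_real (B x))"

text \<open>The asserted combination with its constants written as permanents;
  \<open>bernoulli_coeff_eq\<close> identifies these with the derivatives.\<close>

definition bern_comb :: "(nat \<Rightarrow> 'd) \<Rightarrow> nat set \<Rightarrow> real ^ 'd \<Rightarrow> complex" where
  "bern_comb j S x = (\<Sum>U\<in>Lambda_sets v I.
     of_real (\<Sum>f\<in>onto_maps S U. \<Prod>k\<in>S. v (f k) $ j k) * bernoulli_spline v I U x)"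

lemma mon_B_supp: "norm x > R \<Longrightarrow> complex_of_real (mon j S x) * of_real (B x) = 0"
  by (simp add: B_supp)

lemma bern_comb_props:
  shows borel_measurable_bern_comb [measurable]: "bern_comb j S \<in> borel_measurable borel"
    and bounded_bern_comb: "\<exists>K. \<forall>x. cmod (bern_comb j S x) \<le> K"
    and periodic_bern_comb: "g \<in> int_vecs \<Longrightarrow> bern_comb j S (x + g) = bern_comb j S x"
    and fourier_coeff_bern_comb: "b \<in> int_vecs \<Longrightarrow>
      (LINT x:qcube|lborel. bern_comb j S x * chi b x) =
      (\<Sum>U\<in>Lambda_sets v I. of_real (\<Sum>f\<in>onto_maps S U. \<Prod>k\<in>S. v (f k) $ j k) *
        (if - b \<in> bernoulli_index v I U then bernoulli_weight v U (- b) else 0))"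
    and continuous_bern_comb: "rho v I \<ge> 1 \<Longrightarrow> continuous_on UNIV (bern_comb j S)"
    and symmetric_limit_bern_comb: "rho v I = 0 \<Longrightarrow>
      isCont (\<lambda>h. bern_comb j S (x + h) + bern_comb j S (x - h)) 0"
proof -
  note p = bernoulli_spline_props[OF finI adm intv]
  let ?C = "\<lambda>U. complex_of_real (\<Sum>f\<in>onto_maps S U. \<Prod>k\<in>S. v (f k) $ j k)"
  show "bern_comb j S \<in> borel_measurable borel"
    unfolding bern_comb_def using p(1) by (intro borel_measurable_sum borel_measurable_times) auto
  show "\<exists>K. \<forall>x. cmod (bern_comb j S x) \<le> K"
  proof -
    have "\<forall>U\<in>Lambda_sets v I. \<exists>K. \<forall>x. cmod (bernoulli_spline v I U x) \<le> K" using p(2) by blast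
    then obtain K where K: "\<And>U x. U \<in> Lambda_sets v I \<Longrightarrow> cmod (bernoulli_spline v I U x) \<le> K U" by metis
    have "cmod (bern_comb j S x) \<le> (\<Sum>U\<in>Lambda_sets v I. cmod (?C U) * K U)" for x
      unfolding bern_comb_def by (rule sum_norm_le) (simp only: norm_mult, intro mult_left_mono K norm_ge_zero)
    then show ?thesis by blast
  qed
  show "bern_comb j S (x + g) = bern_comb j S x" if "g \<in> int_vecs" for g x
    unfolding bern_comb_def using p(3) that by (intro sum.cong) auto
  show "(LINT x:qcube|lborel. bern_comb j S x * chi b x) =
      (\<Sum>U\<in>Lambda_sets v I. ?C U * (if - b \<in> bernoulli_index v I U then bernoulli_weight v U (- b) else 0))"
    if b: "b \<in> int_vecs" for b
  proof -
    have i: "set_integrable lborel qcube (\<lambda>x. ?C U * (bernoulli_spline v I U x * chi b x))" if U: "U \<in> Lambda_sets v I" for U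
    proof -
      obtain K where K: "\<And>x. cmod (bernoulli_spline v I U x) \<le> K" using p(2)[OF U] by blast
      note p(1)[OF U, measurable]
      show ?thesis
        by (rule set_integrable_qcube_bounded[where K="cmod (?C U) * K"])
           (measurable, simp only: norm_mult norm_chi mult_1_right, intro mult_left_mono K norm_ge_zero)
    qed
    have "(LINT x:qcube|lborel. bern_comb j S x * chi b x) =
        (LINT x:qcube|lborel. (\<Sum>U\<in>Lambda_sets v I. ?C U * (bernoulli_spline v I U x * chi b x)))"
      unfolding bern_comb_def by (simp add: sum_distrib_right mult.assoc)
    also have "\<dots> = (\<Sum>U\<in>Lambda_sets v I. LINT x:qcube|lborel. ?C U * (bernoulli_spline v I U x * chi b x))"
      by (rule qcube_integral_sum[OF i])
    also have "\<dots> = (\<Sum>U\<in>Lambda_sets v I. ?C U * (if - b \<in> bernoulli_index v I U then bernoulli_weight v U (- b) else 0))"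
      by (intro sum.cong refl) (simp only: set_integral_mult_right p(4)[OF _ b])
    finally show ?thesis .
  qed
  show "continuous_on UNIV (bern_comb j S)" if "rho v I \<ge> 1"
    unfolding bern_comb_def using p(5) that by (intro continuous_on_sum continuous_on_mult_left) auto
  show "isCont (\<lambda>h. bern_comb j S (x + h) + bern_comb j S (x - h)) 0" if rho: "rho v I = 0" for x
  proof -
    have "isCont (\<lambda>h. \<Sum>U\<in>Lambda_sets v I. ?C U * (bernoulli_spline v I U (x + h) + bernoulli_spline v I U (x - h))) 0"
      using p(6)[OF _ rho] by (intro continuous_sum continuous_mult_left) auto
    then show ?thesis by (simp add: bern_comb_def distrib_left sum.distrib)
  qed
qed

lemma G_fourier_coeff:
  assumes a: "a \<in> int_vecs"
  shows "set_integrable lborel qcube (G j S)"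
    and "(LINT x:qcube|lborel. G j S x * chi a x) = (LINT x|lborel. of_real (mon j S x) * chi a x * of_real (B x))"
proof -
  have "integrable lborel (\<lambda>x. of_real (mon j S x) * complex_of_real (B x))"
    by (intro integrable_mult_B continuous_intros)
  from periodization(1)[OF this mon_B_supp] show "set_integrable lborel qcube (G j S)" by (simp add: G_def)
  let ?f = "\<lambda>x. (of_real (mon j S x) * of_real (B x)) * chi a x"
  have eq: "?f = (\<lambda>x. of_real (mon j S x) * chi a x * complex_of_real (B x))" by (simp add: mult_ac)
  have i: "integrable lborel ?f" unfolding eq by (intro integrable_mult_B continuous_intros)
  have "perio ?f = (\<lambda>x. G j S x * chi a x)"
    unfolding G_def by (intro ext perio_mult_periodic) (simp add: chi_add_right chi_int[OF a])
  then show "(LINT x:qcube|lborel. G j S x * chi a x) = (LINT x|lborel. of_real (mon j S x) * chi a x * of_real (B x))"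
    using periodization(2)[OF i, of R] by (simp add: B_supp eq)
qed

lemma bernoulli_weight_uminus: "bernoulli_weight v U (- a) = (- 1) ^ card U * bernoulli_weight v U a"
proof -
  have "bernoulli_weight v U (- a) = (\<Prod>i\<in>U. - 1 * (1 / (2 * of_real pi * \<i> * of_real (a \<bullet> v i))))"
    unfolding bernoulli_weight_def by (intro prod.cong) simp_all
  then show ?thesis unfolding bernoulli_weight_def by (simp only: prod.distrib prod_constant)
qed

lemma bernoulli_index_uminus: "- a \<in> bernoulli_index v I U \<longleftrightarrow> a \<in> bernoulli_index v I U"
  by (simp add: bernoulli_index_def)

text \<open>The coefficient of a Bernoulli spline at \<open>a\<close> carries the weight of
  \<open>- a\<close>, whereas the box integral carries that of \<open>a\<close>. The weight is a
  product of \<open>rho v I + 1\<close> factors odd in the frequency, which explains the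
  sign.\<close>

lemma G_AE:
  assumes S: "finite S"
  shows G_AE_small: "card S \<le> rho v I \<Longrightarrow> AE x in lborel. G j S x = moment j S"
    and G_AE_critical: "card S = rho v I + 1 \<Longrightarrow>
      AE x in lborel. G j S x = moment j S + (- 1) ^ (rho v I + 1) * bern_comb j S x"
proof -
  define E where "E = (\<lambda>a. LINT x|lborel. of_real (mon j S x) * chi a x * complex_of_real (B x))"
  have E0: "E 0 = moment j S" by (simp add: E_def moment_def)
  have Ebox: "E a = (LINT u:(\<Pi>\<^sub>E i\<in>I. {0..1})|(\<Pi>\<^sub>M i\<in>I. lborel).
      complex_of_real (mon j S (\<Sum>i\<in>I. u i *\<^sub>R v i)) * chi a (\<Sum>i\<in>I. u i *\<^sub>R v i))" for a
    unfolding E_def by (rule box_integral) (intro continuous_intros)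
  \<comment> \<open>\<open>p\<close> stands for either of the claimed right-hand sides; its
    boundedness is what makes it integrable over the cube.\<close>
  have main: "AE x in lborel. G j S x - p x = 0"
    if p: "p \<in> borel_measurable borel" "\<And>x. cmod (p x) \<le> K" "\<And>g x. g \<in> int_vecs \<Longrightarrow> p (x + g) = p x"
      and pc: "\<And>a. a \<in> int_vecs \<Longrightarrow> (LINT x:qcube|lborel. p x * chi a x) = E a" for p K
  proof (rule periodic_AE_zero)
    note p(1)[measurable]
    have ip: "set_integrable lborel qcube p" by (rule set_integrable_qcube_bounded[OF p(1,2)])
    show "G j S (x + a) - p (x + a) = G j S x - p x" if "a \<in> int_vecs" for a x
      using perio_shift[OF that] p(3)[OF that] by (simp add: G_def)
    show "AE x in lborel. x \<in> qcube \<longrightarrow> G j S x - p x = 0"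
    proof (rule fourier_uniqueness)
      show "set_integrable lborel qcube (\<lambda>x. G j S x - p x)"
        using G_fourier_coeff(1)[OF int_vecs_0] ip by (rule set_integral_diff(1))
      fix a :: "real ^ 'd" assume a: "a \<in> int_vecs"
      have "set_integrable lborel qcube (\<lambda>x. G j S x * chi a x)" "set_integrable lborel qcube (\<lambda>x. p x * chi a x)"
        using G_fourier_coeff(1)[OF int_vecs_0] ip by (auto intro!: set_integrable_qcube_mult[where C=1])
      from set_integral_diff(2)[OF this]
      show "(LINT x:qcube|lborel. (G j S x - p x) * chi a x) = 0"
        by (simp add: left_diff_distrib pc[OF a] G_fourier_coeff(2)[OF a] E_def)
    qed
  qed
  have cst: "(LINT x:qcube|lborel. moment j S * chi a x) = (if a = 0 then moment j S else 0)" if "a \<in> int_vecs" for a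
    by (subst set_integral_mult_right) (simp add: integral_qcube_chi[OF that])
  { assume c: "card S \<le> rho v I"
    have "AE x in lborel. G j S x - moment j S = 0"
    proof (rule main)
      fix a :: "real ^ 'd" assume a: "a \<in> int_vecs"
      show "(LINT x:qcube|lborel. moment j S * chi a x) = E a"
        using cst[OF a] E0 box_integral_mon_chi(1)[OF finI adm intv a _ S c, of j] by (auto simp: Ebox)
    qed auto
    then show "AE x in lborel. G j S x = moment j S" by eventually_elim simp }
  assume c: "card S = rho v I + 1"
  let ?p = "\<lambda>x. moment j S + (- 1) ^ (rho v I + 1) * bern_comb j S x"
  obtain K where K: "\<And>x. cmod (bern_comb j S x) \<le> K" using bounded_bern_comb by blast
  have "AE x in lborel. G j S x - ?p x = 0"
  proof (rule main)
    show "?p \<in> borel_measurable borel" by measurable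
    show "cmod (?p x) \<le> cmod (moment j S) + K" for x
      by (rule norm_triangle_le) (simp add: norm_mult norm_power K)
    show "?p (x + g) = ?p x" if "g \<in> int_vecs" for g x by (simp add: periodic_bern_comb[OF that])
    fix a :: "real ^ 'd" assume a: "a \<in> int_vecs"
    have i1: "set_integrable lborel qcube (\<lambda>x. moment j S * chi a x)"
      by (rule set_integrable_qcube_bounded[where K="cmod (moment j S)"]) (auto simp: norm_mult)
    have i2: "set_integrable lborel qcube (\<lambda>x. (- 1) ^ (rho v I + 1) * (bern_comb j S x * chi a x))"
      by (rule set_integrable_qcube_bounded[where K=K]) (auto simp: norm_mult norm_power K)
    have "(LINT x:qcube|lborel. ?p x * chi a x) =
        (LINT x:qcube|lborel. moment j S * chi a x + (- 1) ^ (rho v I + 1) * (bern_comb j S x * chi a x))"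
      by (simp only: distrib_right mult.assoc)
    also have "\<dots> = (LINT x:qcube|lborel. moment j S * chi a x) +
        (LINT x:qcube|lborel. (- 1) ^ (rho v I + 1) * (bern_comb j S x * chi a x))"
      by (rule set_integral_add(2)[OF i1 i2])
    also have "\<dots> = (if a = 0 then moment j S else 0) + (- 1) ^ (rho v I + 1) *
      (\<Sum>U\<in>Lambda_sets v I. of_real (\<Sum>f\<in>onto_maps S U. \<Prod>k\<in>S. v (f k) $ j k) *
        (if - a \<in> bernoulli_index v I U then bernoulli_weight v U (- a) else 0))"
      unfolding cst[OF a] by (simp only: set_integral_mult_right fourier_coeff_bern_comb[OF a])
    also have "\<dots> = E a"
    proof (cases "a = 0")
      case True
      then show ?thesis by (simp add: E0 bernoulli_index_def)
    next
      case False
      have w: "(- 1) ^ (rho v I + 1) * bernoulli_weight v U (- a) = bernoulli_weight v U a" if "U \<in> Lambda_sets v I" for U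
      proof -
        have "card U = rho v I + 1" using that by (simp add: Lambda_sets_def)
        then show ?thesis
          unfolding bernoulli_weight_uminus by (simp add: mult.assoc[symmetric] power_mult_distrib[symmetric])
      qed
      have "(- 1) ^ (rho v I + 1) * (\<Sum>U\<in>Lambda_sets v I. of_real (\<Sum>f\<in>onto_maps S U. \<Prod>k\<in>S. v (f k) $ j k) *
          (if - a \<in> bernoulli_index v I U then bernoulli_weight v U (- a) else 0)) =
        (\<Sum>U\<in>Lambda_sets v I. of_real (\<Sum>f\<in>onto_maps S U. \<Prod>k\<in>S. v (f k) $ j k) *
          (if a \<in> bernoulli_index v I U then bernoulli_weight v U a else 0))"
        unfolding sum_distrib_left by (intro sum.cong refl) (simp add: bernoulli_index_uminus w[symmetric] mult_ac)
      then show ?thesis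
        using box_integral_mon_chi(2)[OF finI adm intv a False S c, of j, folded bernoulli_weight_def] False
        by (simp add: Ebox)
    qed
    finally show "(LINT x:qcube|lborel. ?p x * chi a x) = E a" .
  qed
  then show "AE x in lborel. G j S x = ?p x" by eventually_elim simp
qed

lemma G_everywhere:
  assumes S: "finite S" and rho: "rho v I \<ge> 1"
  shows G_small: "card S \<le> rho v I \<Longrightarrow> G j S x = moment j S"
    and G_critical: "card S = rho v I + 1 \<Longrightarrow> G j S x = moment j S + (- 1) ^ (rho v I + 1) * bern_comb j S x"
proof -
  have G: "continuous_on UNIV (G j S)"
    unfolding G_def by (rule continuous_perio[OF _ mon_B_supp]) (intro continuous_intros continuous_B rho)
  show "card S \<le> rho v I \<Longrightarrow> G j S x = moment j S"
    by (rule continuous_AE_eq_imp_eq[OF G _ G_AE_small[OF S]]) auto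
  show "card S = rho v I + 1 \<Longrightarrow> G j S x = moment j S + (- 1) ^ (rho v I + 1) * bern_comb j S x"
    by (rule continuous_AE_eq_imp_eq[OF G _ G_AE_critical[OF S]])
       (intro continuous_intros continuous_bern_comb rho)
qed

end

section \<open>Moments of the dual generator\<close>

definition L2 :: "('a::euclidean_space \<Rightarrow> complex) \<Rightarrow> bool" where
  "L2 f \<longleftrightarrow> f \<in> borel_measurable borel \<and> integrable lborel (\<lambda>x. (cmod (f x))\<^sup>2)"

lemma L2_measurable: "L2 f \<Longrightarrow> f \<in> borel_measurable borel"
  by (simp add: L2_def)

lemma L2_add:
  assumes "L2 f" "L2 g"
  shows "L2 (\<lambda>x. f x + g x)"
proof -
  note assms[THEN L2_measurable, measurable]
  have "integrable lborel (\<lambda>x. (cmod (f x + g x))\<^sup>2)"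
  proof (rule Bochner_Integration.integrable_bound)
    show "integrable lborel (\<lambda>x. 2 * (cmod (f x))\<^sup>2 + 2 * (cmod (g x))\<^sup>2)"
      using assms by (auto simp: L2_def)
    show "AE x in lborel. norm ((cmod (f x + g x))\<^sup>2) \<le> norm (2 * (cmod (f x))\<^sup>2 + 2 * (cmod (g x))\<^sup>2)"
    proof (rule AE_I2)
      fix x
      have "(cmod (f x + g x))\<^sup>2 \<le> (cmod (f x) + cmod (g x))\<^sup>2"
        by (intro power_mono norm_triangle_ineq) auto
      also have "\<dots> \<le> 2 * (cmod (f x))\<^sup>2 + 2 * (cmod (g x))\<^sup>2"
        using sum_squares_bound[of "cmod (f x)" "cmod (g x)"] by (simp add: power2_sum)
      finally show "norm ((cmod (f x + g x))\<^sup>2) \<le> norm (2 * (cmod (f x))\<^sup>2 + 2 * (cmod (g x))\<^sup>2)" by simp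
    qed
  qed measurable
  then show ?thesis by (simp add: L2_def)
qed

lemma L2_cmult: "L2 f \<Longrightarrow> L2 (\<lambda>x. c * f x)"
  by (auto simp: L2_def norm_mult power_mult_distrib)

lemma L2_diff: "L2 f \<Longrightarrow> L2 g \<Longrightarrow> L2 (\<lambda>x. f x - g x)"
  using L2_add[of f "\<lambda>x. - 1 * g x"] L2_cmult[of g "- 1"] by simp

lemma L2_sum: "(\<And>i. i \<in> A \<Longrightarrow> L2 (f i)) \<Longrightarrow> L2 (\<lambda>x. \<Sum>i\<in>A. f i x)"
proof (induction A rule: infinite_finite_induct)
  case (insert i A)
  then have "L2 (\<lambda>x. f i x + (\<Sum>i\<in>A. f i x))" by (intro L2_add) auto
  with insert show ?case by simp
qed (auto simp: L2_def)

lemma L2_shift: "L2 f \<Longrightarrow> L2 (\<lambda>x. f (x + a))"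
  using lborel_shift_integrable[of "\<lambda>x. (cmod (f x))\<^sup>2" a] by (auto simp: L2_def)

lemma borel_measurable_cnj_comp [measurable (raw)]:
  "f \<in> borel_measurable M \<Longrightarrow> (\<lambda>x. cnj (f x)) \<in> borel_measurable M"
  by (rule borel_measurable_continuous_on[OF continuous_on_cnj[OF continuous_on_id]])

lemma L2_mult_cnj_integrable:
  assumes "L2 f" "L2 g"
  shows "integrable lborel (\<lambda>x. f x * cnj (g x))"
proof -
  note assms[THEN L2_measurable, measurable]
  show ?thesis
  proof (rule Bochner_Integration.integrable_bound)
    show "integrable lborel (\<lambda>x. (cmod (f x))\<^sup>2 + (cmod (g x))\<^sup>2)"
      using assms by (auto simp: L2_def)
    show "AE x in lborel. norm (f x * cnj (g x)) \<le> norm ((cmod (f x))\<^sup>2 + (cmod (g x))\<^sup>2)"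
    proof (rule AE_I2)
      fix x
      have "2 * (cmod (f x) * cmod (g x)) \<le> (cmod (f x))\<^sup>2 + (cmod (g x))\<^sup>2"
        using sum_squares_bound[of "cmod (f x)" "cmod (g x)"] by simp
      moreover have "0 \<le> cmod (f x) * cmod (g x)" by simp
      ultimately have "cmod (f x) * cmod (g x) \<le> (cmod (f x))\<^sup>2 + (cmod (g x))\<^sup>2" by linarith
      then show "norm (f x * cnj (g x)) \<le> norm ((cmod (f x))\<^sup>2 + (cmod (g x))\<^sup>2)"
        by (simp add: norm_mult)
    qed
  qed measurable
qed

text \<open>Pythagoras: the cross term drops out. When \<open>h\<close> is orthogonal to all finite
  combinations of translates, its norm is thus at most its distance to any such combination.\<close>

lemma L2_orthogonal_approx:
  assumes h: "L2 h" and s: "L2 s" and o: "(LINT x|lborel. s x * cnj (h x)) = 0"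
  shows "(LINT x|lborel. (cmod (h x))\<^sup>2) \<le> (LINT x|lborel. (cmod (h x - s x))\<^sup>2)"
proof -
  define w where "w = (\<lambda>x. Re (s x * cnj (h x)))"
  have pt: "(cmod (h x - s x))\<^sup>2 = (cmod (h x))\<^sup>2 - 2 * w x + (cmod (s x))\<^sup>2" for x
    unfolding cmod_power2 w_def by (simp add: power2_diff algebra_simps)
  have i: "integrable lborel (\<lambda>x. (cmod (h x))\<^sup>2)" "integrable lborel (\<lambda>x. (cmod (s x))\<^sup>2)"
    using h s by (auto simp: L2_def)
  have j: "integrable lborel (\<lambda>x. s x * cnj (h x))" by (rule L2_mult_cnj_integrable[OF s h])
  have k: "integrable lborel w" unfolding w_def by (rule integrable_Re[OF j])
  have z: "(LINT x|lborel. w x) = 0" unfolding w_def using integral_Re[OF j] o by simp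
  have "(LINT x|lborel. (cmod (h x - s x))\<^sup>2) =
      (LINT x|lborel. (cmod (h x))\<^sup>2) + (LINT x|lborel. (cmod (s x))\<^sup>2)"
    unfolding pt using i k z by simp
  then show ?thesis by simp
qed

text \<open>The comparison function is a product of one-variable functions 1/(1 + t^2), so its
  integral factorizes. Its reciprocal is at most \<open>(1 + norm x) ^ (2 * D)\<close>, and an
  exponential bound for a power of \<open>1 + norm x\<close> suffices.\<close>

lemma integrable_poly_exp:
  assumes c: "c > 0"
  shows "integrable lborel (\<lambda>x :: 'a::euclidean_space. (1 + norm x) ^ N * exp (- c * norm x))"
proof -
  have one: "integrable lborel (\<lambda>t :: real. inverse (1 + t\<^sup>2))"
    using integrable_inverse_1_plus_square by (simp add: set_integrable_def einterval_def)
  define P where "P = (\<lambda>x :: 'a. \<Prod>b\<in>Basis. inverse (1 + (x \<bullet> b)\<^sup>2))"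
  have P0: "P x \<ge> 0" for x unfolding P_def by (intro prod_nonneg) auto
  have Pm[measurable]: "P \<in> borel_measurable borel" unfolding P_def by measurable
  have "(\<integral>\<^sup>+x. ennreal (norm (P x)) \<partial>lborel) = (\<integral>\<^sup>+(x :: 'a). (\<Prod>b\<in>Basis. ennreal (inverse (1 + (x \<bullet> b)\<^sup>2))) \<partial>lborel)"
    using P0 by (intro nn_integral_cong) (simp add: P_def prod_ennreal)
  also have "\<dots> = (\<Prod>b\<in>(Basis :: 'a set). (\<integral>\<^sup>+t. ennreal (inverse (1 + t\<^sup>2)) \<partial>lborel))"
    by (rule nn_integral_lborel_prod) auto
  also have "\<dots> < \<infinity>"
  proof -
    have "(\<integral>\<^sup>+t. ennreal (inverse (1 + t\<^sup>2)) \<partial>lborel) < \<infinity>"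
      using one by (simp add: integrable_iff_bounded)
    then show ?thesis by (simp add: ennreal_prod_eq_top less_top[symmetric] prod_constant power_eq_top_ennreal)
  qed
  finally have Pint: "integrable lborel P" by (intro integrableI_bounded) auto
  define D where "D = DIM('a)"
  \<comment> \<open>\<open>N\<close> for the given factor and \<open>2 * D\<close> for the
    reciprocal of \<open>P\<close>; the extra 1 keeps \<open>M\<close> positive for the division by
    it below.\<close>
  define M where "M = N + 2 * D + 1"
  \<comment> \<open>The constant results from raising \<open>t \<le> exp t\<close> at
    \<open>t = c * (1 + n) / M\<close> to the power \<open>M\<close>.\<close>
  define A where "A = (M / c) ^ M * exp c"
  have A0: "A \<ge> 0" using c by (simp add: A_def)
  have bd: "(1 + n) ^ M \<le> A * exp (c * n)" if n: "n \<ge> 0" for n :: real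
  proof -
    have M: "real M > 0" by (simp add: M_def)
    have "c * (1 + n) / M \<le> exp (c * (1 + n) / M)" using exp_ge_add_one_self[of "c * (1 + n) / M"] by linarith
    then have "1 + n \<le> M / c * exp (c * (1 + n) / M)" using c M by (simp add: field_simps)
    then have "(1 + n) ^ M \<le> (M / c * exp (c * (1 + n) / M)) ^ M" using n by (intro power_mono) auto
    also have "\<dots> = (M / c) ^ M * exp (c * (1 + n))"
    proof -
      have "exp (c * (1 + n) / M) ^ M = exp (c * (1 + n))"
        using M by (simp add: exp_of_nat_mult[symmetric])
      then show ?thesis unfolding power_mult_distrib by simp
    qed
    finally show ?thesis by (simp add: A_def distrib_left exp_add mult_ac)
  qed
  show ?thesis
  proof (rule Bochner_Integration.integrable_bound)
    show "integrable lborel (\<lambda>x. A * P x)" by (intro integrable_mult_right Pint)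
    show "AE x in lborel. norm ((1 + norm x) ^ N * exp (- c * norm x)) \<le> norm (A * P x)"
    proof (rule AE_I2)
      fix x :: 'a
      let ?n = "norm x"
      have "(\<Prod>b\<in>Basis. 1 + (x \<bullet> b)\<^sup>2) \<le> (\<Prod>b\<in>(Basis :: 'a set). (1 + ?n)\<^sup>2)"
      proof (rule prod_mono)
        fix b :: 'a assume b: "b \<in> Basis"
        have "(x \<bullet> b)\<^sup>2 \<le> ?n\<^sup>2" using power_mono[OF Basis_le_norm[OF b, of x], of 2] by simp
        moreover have "(1 + ?n)\<^sup>2 = 1 + 2 * ?n + ?n\<^sup>2" by (simp add: power2_sum)
        ultimately have "1 + (x \<bullet> b)\<^sup>2 \<le> (1 + ?n)\<^sup>2" using norm_ge_zero[of x] by linarith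
        then show "0 \<le> 1 + (x \<bullet> b)\<^sup>2 \<and> 1 + (x \<bullet> b)\<^sup>2 \<le> (1 + ?n)\<^sup>2" by simp
      qed
      also have "\<dots> = (1 + ?n) ^ (2 * D)" by (simp add: D_def power_mult)
      finally have p: "(\<Prod>b\<in>Basis. 1 + (x \<bullet> b)\<^sup>2) \<le> (1 + ?n) ^ (2 * D)" .
      have pos: "(\<Prod>b\<in>Basis. 1 + (x \<bullet> b)\<^sup>2) > 0" by (intro prod_pos) (auto intro: add_pos_nonneg)
      have "(1 + ?n) ^ N * (\<Prod>b\<in>Basis. 1 + (x \<bullet> b)\<^sup>2) \<le> (1 + ?n) ^ N * (1 + ?n) ^ (2 * D)"
        using p by (intro mult_left_mono) auto
      also have "\<dots> \<le> (1 + ?n) ^ M" unfolding power_add[symmetric] M_def by (intro power_increasing) auto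
      also have "\<dots> \<le> A * exp (c * ?n)" by (rule bd) simp
      finally have *: "(1 + ?n) ^ N * (\<Prod>b\<in>Basis. 1 + (x \<bullet> b)\<^sup>2) \<le> A * exp (c * ?n)" .
      define q where "q = (\<Prod>b\<in>Basis. 1 + (x \<bullet> b)\<^sup>2)"
      have "P x = inverse q"
        using prod_inversef[of "\<lambda>b. 1 + (x \<bullet> b)\<^sup>2" Basis] by (simp add: P_def q_def o_def)
      moreover have "q \<noteq> 0" using pos unfolding q_def by (rule less_imp_neq[symmetric])
      ultimately have qP: "q * P x = 1" by simp
      have e1: "exp (c * ?n) * exp (- c * ?n) = 1" by (simp add: exp_add[symmetric])
      have "(1 + ?n) ^ N * exp (- c * ?n) = ((1 + ?n) ^ N * (q * P x)) * exp (- c * ?n)"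
        by (simp only: qP mult_1_right)
      also have "\<dots> = ((1 + ?n) ^ N * q) * (P x * exp (- c * ?n))" by (simp only: mult_ac)
      also have "\<dots> \<le> (A * exp (c * ?n)) * (P x * exp (- c * ?n))"
        using * P0[of x] unfolding q_def by (intro mult_right_mono mult_nonneg_nonneg) auto
      also have "\<dots> = A * P x * (exp (c * ?n) * exp (- c * ?n))" by (simp only: mult_ac)
      also have "\<dots> = A * P x" by (simp only: e1 mult_1_right)
      finally have "(1 + ?n) ^ N * exp (- c * ?n) \<le> A * P x" .
      then show "norm ((1 + norm x) ^ N * exp (- c * norm x)) \<le> norm (A * P x)"
        using A0 P0[of x] by simp
    qed
  qed measurable
qed

section \<open>Expansion and growth of monomials\<close>

lemma mon_add:
  assumes "finite T"
  shows "mon j T (a + b) = (\<Sum>X\<in>Pow T. mon j X a * mon j (T - X) b)"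
  unfolding mon_def using prod_add[OF assms, of "\<lambda>k. a $ j k" "\<lambda>k. b $ j k"] by simp

lemma mon_uminus: "mon j T (- b) = (- 1) ^ card T * mon j T b"
  unfolding mon_def using prod.distrib[of "\<lambda>_. - 1" "\<lambda>k. b $ j k" T] by simp

lemma mon_0: "finite T \<Longrightarrow> mon j T 0 = (if T = {} then 1 else 0)"
  by (auto simp: mon_def)

lemma mon_bound: "\<bar>mon j T x\<bar> \<le> norm x ^ card T"
proof -
  have "\<bar>mon j T x\<bar> = (\<Prod>k\<in>T. \<bar>x $ j k\<bar>)" by (simp add: mon_def abs_prod)
  also have "\<dots> \<le> (\<Prod>k\<in>T. norm x)" by (intro prod_mono) (auto simp: component_le_norm_cart)
  finally show ?thesis by simp
qed

lemma mon_shift_bound: "\<bar>mon j T (x + y)\<bar> \<le> (1 + norm x) ^ card T * (1 + norm y) ^ card T"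
proof -
  have "norm (x + y) \<le> norm x + norm y" by (rule norm_triangle_ineq)
  also have "\<dots> \<le> (1 + norm x) * (1 + norm y)" by (simp add: algebra_simps)
  finally have "norm (x + y) ^ card T \<le> ((1 + norm x) * (1 + norm y)) ^ card T" by (intro power_mono) auto
  with mon_bound[of j T "x + y"] show ?thesis by (simp add: power_mult_distrib)
qed

section \<open>Pairing with the dual generator\<close>

locale dual_box_spline = lattice_box_spline I v B
  for I :: "'i set" and v :: "'i \<Rightarrow> real ^ 'd" and B +
  fixes \<phi> :: "real ^ 'd \<Rightarrow> complex"
  assumes dual: "is_dual_generator B \<phi>"
begin

lemma L2_phi: "L2 \<phi>"
  using dual by (simp add: is_dual_generator_def in_shift_space_def L2_def)

lemma borel_measurable_phi [measurable]: "\<phi> \<in> borel_measurable borel"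
  using L2_phi by (rule L2_measurable)

lemma biorthogonal:
  "\<alpha> \<in> int_vecs \<Longrightarrow> \<gamma> \<in> int_vecs \<Longrightarrow>
    (LINT x|lborel. complex_of_real (B (x - \<alpha>)) * cnj (\<phi> (x - \<gamma>))) = (if \<alpha> = \<gamma> then 1 else 0)"
  using dual by (simp add: is_dual_generator_def)

lemma L2_B: "L2 (\<lambda>x. complex_of_real (B (x - \<alpha>)))"
proof -
  have "L2 (\<lambda>x. complex_of_real (B x))" using integrable_B_squared by (simp add: L2_def)
  from L2_shift[OF this, of "- \<alpha>"] show ?thesis by simp
qed

lemma L2_phi_shift: "L2 (\<lambda>x. \<phi> (x - \<alpha>))"
  using L2_shift[OF L2_phi, of "- \<alpha>"] by simp

lemma phi_decay:
  obtains K c where "c > 0" "K \<ge> 0" "AE x in lborel. cmod (\<phi> x) \<le> K * exp (- c * norm x)"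
proof -
  obtain K c where Kc: "c > 0" "AE x in lborel. cmod (\<phi> x) \<le> K * exp (- c * norm x)"
    using dual by (auto simp: is_dual_generator_def exponentially_decaying_def)
  have "AE x in lborel. cmod (\<phi> x) \<le> \<bar>K\<bar> * exp (- c * norm x)"
    using Kc(2)
  proof eventually_elim
    case (elim x)
    have "K * exp (- c * norm x) \<le> \<bar>K\<bar> * exp (- c * norm x)" by (intro mult_right_mono) auto
    with elim show ?case by linarith
  qed
  with Kc(1) show thesis by (intro that[of c "\<bar>K\<bar>"]) auto
qed

lemma integrable_poly_phi_norm:
  "integrable lborel (\<lambda>x. (1 + norm x) ^ N * cmod (\<phi> x))"
proof -
  obtain K c where Kc: "c > 0" "K \<ge> 0" "AE x in lborel. cmod (\<phi> x) \<le> K * exp (- c * norm x)"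
    by (rule phi_decay)
  show ?thesis
  proof (rule Bochner_Integration.integrable_bound)
    show "integrable lborel (\<lambda>x :: real ^ 'd. K * ((1 + norm x) ^ N * exp (- c * norm x)))"
      by (intro integrable_mult_right integrable_poly_exp Kc)
    show "AE x in lborel. norm ((1 + norm x) ^ N * cmod (\<phi> x)) \<le> norm (K * ((1 + norm x) ^ N * exp (- c * norm x)))"
      using Kc(3)
    proof eventually_elim
      case (elim x)
      then have "(1 + norm x) ^ N * cmod (\<phi> x) \<le> (1 + norm x) ^ N * (K * exp (- c * norm x))"
        by (intro mult_left_mono) auto
      then show ?case using Kc(2) by (simp add: mult_ac)
    qed
  qed measurable
qed

lemma integrable_poly_phi:
  assumes [measurable]: "f \<in> borel_measurable borel" and "\<And>x. cmod (f x) \<le> M * (1 + norm x) ^ N"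
  shows "integrable lborel (\<lambda>x. f x * cnj (\<phi> x))"
proof (rule Bochner_Integration.integrable_bound)
  show "integrable lborel (\<lambda>x. M * ((1 + norm x) ^ N * cmod (\<phi> x)))"
    by (intro integrable_mult_right integrable_poly_phi_norm)
  show "AE x in lborel. norm (f x * cnj (\<phi> x)) \<le> norm (M * ((1 + norm x) ^ N * cmod (\<phi> x)))"
  proof (rule AE_I2)
    fix x
    have "cmod (f x) * cmod (\<phi> x) \<le> (M * (1 + norm x) ^ N) * cmod (\<phi> x)"
      using assms(2) by (intro mult_right_mono) auto
    also have "\<dots> \<le> norm (M * ((1 + norm x) ^ N * cmod (\<phi> x)))" by (simp add: mult.assoc del: norm_mult)
    finally show "norm (f x * cnj (\<phi> x)) \<le> norm (M * ((1 + norm x) ^ N * cmod (\<phi> x)))"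
      by (simp add: norm_mult)
  qed
qed measurable

lemma integrable_mon_phi: "integrable lborel (\<lambda>y. complex_of_real (mon j X (x + y)) * cnj (\<phi> y))"
  by (rule integrable_poly_phi[where M="(1 + norm x) ^ card X" and N="card X"])
     (measurable, use mon_shift_bound[of j X x] in simp)

text \<open>The projection coefficient at \<open>\<alpha>\<close> is expanded in these functions of
  \<open>x\<close>, with the lattice point confined to monomials of \<open>x - \<alpha>\<close>; the
  sum over the lattice then produces periodizations.\<close>

definition A :: "(nat \<Rightarrow> 'd) \<Rightarrow> nat set \<Rightarrow> real ^ 'd \<Rightarrow> complex" where
  "A j X x = (LINT y|lborel. complex_of_real (mon j X (x + y)) * cnj (\<phi> y))"

text \<open>The convolution of a monomial with \<open>B\<close>, a polynomial with leading term
  \<open>mon j T\<close>. It is what the lattice sum of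
  \<open>mon j T \<gamma> * B (y - \<gamma>)\<close> becomes when every periodization is replaced by
  its mean value.\<close>

definition H :: "(nat \<Rightarrow> 'd) \<Rightarrow> nat set \<Rightarrow> real ^ 'd \<Rightarrow> complex" where
  "H j T y = (LINT z|lborel. complex_of_real (mon j T (y - z)) * of_real (B z))"

definition Mom :: "(nat \<Rightarrow> 'd) \<Rightarrow> nat set \<Rightarrow> complex" where
  "Mom j T = (LINT y|lborel. H j T y * cnj (\<phi> y))"

lemma integrable_mon_B: "integrable lborel (\<lambda>z. complex_of_real (mon j T (y - z)) * of_real (B z))"
  by (intro integrable_mult_B continuous_intros)

lemma H_add:
  assumes T: "finite T"
  shows "H j T (x + y) = (\<Sum>X\<in>Pow T. of_real (mon j X x) * H j (T - X) y)"
proof -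
  have "H j T (x + y) = (LINT z|lborel. (\<Sum>X\<in>Pow T. of_real (mon j X x) * (complex_of_real (mon j (T - X) (y - z)) * of_real (B z))))"
    unfolding H_def add_diff_eq[symmetric] mon_add[OF T] by (simp add: sum_distrib_right mult.assoc)
  also have "\<dots> = (\<Sum>X\<in>Pow T. of_real (mon j X x) * H j (T - X) y)"
    unfolding H_def
    by (subst Bochner_Integration.integral_sum) (auto intro!: integrable_mult_right integrable_mon_B)
  finally show ?thesis .
qed

lemma H_0: "H j T 0 = (- 1) ^ card T * moment j T"
  unfolding H_def moment_def by (simp add: mon_uminus mult.assoc)

lemma H_expand:
  assumes T: "finite T"
  shows "H j T y = (\<Sum>X\<in>Pow T. of_real (mon j X y) * ((- 1) ^ card (T - X) * moment j (T - X)))"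
  using H_add[OF T, of j y 0] by (simp add: H_0)

lemma integrable_H_phi:
  assumes T: "finite T"
  shows "integrable lborel (\<lambda>y. H j T y * cnj (\<phi> y))"
proof -
  have "integrable lborel (\<lambda>y. \<Sum>X\<in>Pow T. ((- 1) ^ card (T - X) * moment j (T - X)) * (complex_of_real (mon j X (0 + y)) * cnj (\<phi> y)))"
    by (intro Bochner_Integration.integrable_sum integrable_mult_right integrable_mon_phi)
  then show ?thesis unfolding H_expand[OF T] sum_distrib_right by (simp add: mult_ac)
qed

lemma moment_empty: "moment j {} = 1"
proof -
  have "moment j {} = (LINT u:(\<Pi>\<^sub>E i\<in>I. {0..1})|(\<Pi>\<^sub>M i\<in>I. lborel).
      complex_of_real (mon j {} (\<Sum>i\<in>I. u i *\<^sub>R v i)) * chi 0 (\<Sum>i\<in>I. u i *\<^sub>R v i))"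
    unfolding moment_def using box_integral[of "\<lambda>x. complex_of_real (mon j {} x)"] by simp
  also have "\<dots> = 1" by (subst box_integral_expand[OF finI]) (simp_all add: theta_0_0)
  finally show ?thesis .
qed

lemma H_empty: "H j {} y = 1"
  by (simp add: H_expand moment_empty)

lemma G_eq_sum:
  "R + norm y \<le> r \<Longrightarrow> G j S y = (\<Sum>\<gamma>\<in>lat r. complex_of_real (mon j S (y - \<gamma>)) * of_real (B (y - \<gamma>)))"
  unfolding G_def by (rule perio_eq_sum[OF mon_B_supp order_refl])

text \<open>Writing \<open>\<gamma> = y - (y - \<gamma>)\<close> leaves the lattice point only in
  functions of \<open>y - \<gamma>\<close>, whose sums are periodizations.\<close>

lemma lattice_sum_eq_G:
  assumes T: "finite T" and r: "R + norm y \<le> r"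
  shows "(\<Sum>\<gamma>\<in>lat r. of_real (mon j T \<gamma>) * complex_of_real (B (y - \<gamma>))) =
    (\<Sum>X\<in>Pow T. of_real (mon j X y) * ((- 1) ^ card (T - X) * G j (T - X) y))"
proof -
  have "mon j T \<gamma> = (\<Sum>X\<in>Pow T. mon j X y * ((- 1) ^ card (T - X) * mon j (T - X) (y - \<gamma>)))" for \<gamma>
    using mon_add[OF T, of j y "- (y - \<gamma>)"] unfolding mon_uminus by simp
  then have "(\<Sum>\<gamma>\<in>lat r. of_real (mon j T \<gamma>) * complex_of_real (B (y - \<gamma>))) =
      (\<Sum>\<gamma>\<in>lat r. \<Sum>X\<in>Pow T. of_real (mon j X y) * ((- 1) ^ card (T - X) *
        (complex_of_real (mon j (T - X) (y - \<gamma>)) * of_real (B (y - \<gamma>)))))"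
    by (simp add: sum_distrib_right mult.assoc)
  also have "\<dots> = (\<Sum>X\<in>Pow T. \<Sum>\<gamma>\<in>lat r. of_real (mon j X y) * ((- 1) ^ card (T - X) *
        (complex_of_real (mon j (T - X) (y - \<gamma>)) * of_real (B (y - \<gamma>)))))"
    by (rule sum.swap)
  also have "\<dots> = (\<Sum>X\<in>Pow T. of_real (mon j X y) * ((- 1) ^ card (T - X) * G j (T - X) y))"
    unfolding G_eq_sum[OF r] by (simp add: sum_distrib_left)
  finally show ?thesis .
qed

text \<open>
  The sums \<open>D n\<close> tend to \<open>H j T\<close>, while by biorthogonality each of them already has the stated integral
  against \<open>cnj \<phi>\<close>.
\<close>
lemma Mom_small:
  assumes T: "finite T" "card T \<le> rho v I"
  shows "Mom j T = (if T = {} then 1 else 0)"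
proof -
  define D where "D = (\<lambda>n y. \<Sum>\<gamma>\<in>lat (real n). of_real (mon j T \<gamma>) * complex_of_real (B (y - \<gamma>)))"
  have [measurable]: "D n \<in> borel_measurable borel" for n unfolding D_def by measurable
  have Gsmall: "AE y in lborel. \<forall>X\<in>Pow T. G j (T - X) y = moment j (T - X)"
  proof (rule AE_finite_allI)
    fix X assume "X \<in> Pow T"
    have "card (T - X) \<le> rho v I" using T card_mono[of T "T - X"] by auto
    then show "AE y in lborel. G j (T - X) y = moment j (T - X)" using T by (intro G_AE_small) auto
  qed (use T in auto)
  have sum1: "AE y in lborel. G j {} y = 1" using G_AE_small[of "{}" j] by (simp add: moment_empty)
  have nonneg: "AE y in lborel. \<forall>\<gamma>\<in>int_vecs. 0 \<le> B (y - \<gamma>)"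
  proof (subst AE_ball_countable)
    show "\<forall>\<gamma>\<in>int_vecs. AE y in lborel. 0 \<le> B (y - \<gamma>)"
      using AE_lborel_shift[OF B_nonneg, of "- \<gamma>" for \<gamma>] by simp
  qed simp
  have "(\<lambda>n. LINT y|lborel. D n y * cnj (\<phi> y)) \<longlonglongrightarrow> (LINT y|lborel. H j T y * cnj (\<phi> y))"
  proof (rule integral_dominated_convergence)
    show "(\<lambda>y. H j T y * cnj (\<phi> y)) \<in> borel_measurable lborel"
      using integrable_H_phi[OF T(1)] by auto
    show "integrable lborel (\<lambda>y. (1 + R) ^ card T * ((1 + norm y) ^ card T * cmod (\<phi> y)))"
      by (intro integrable_mult_right integrable_poly_phi_norm)
    show "AE y in lborel. (\<lambda>n. D n y * cnj (\<phi> y)) \<longlonglongrightarrow> H j T y * cnj (\<phi> y)"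
      using Gsmall
    proof eventually_elim
      case (elim y)
      obtain N :: nat where N: "R + norm y \<le> real N" using real_arch_simple by blast
      have "\<forall>\<^sub>F n in sequentially. D n y = H j T y"
        using eventually_ge_at_top[of N]
      proof eventually_elim
        fix n assume n: "n \<ge> N"
        have "D n y = (\<Sum>X\<in>Pow T. of_real (mon j X y) * ((- 1) ^ card (T - X) * G j (T - X) y))"
          unfolding D_def by (rule lattice_sum_eq_G[OF T(1)]) (use N n in linarith)
        also have "\<dots> = H j T y" unfolding H_expand[OF T(1)] using elim by (intro sum.cong) auto
        finally show "D n y = H j T y" .
      qed
      then show ?case by (intro tendsto_mult tendsto_const tendsto_eventually)
    qed
    \<comment> \<open>On the support \<open>norm \<gamma>\<close> is at most
      \<open>(1 + R) * (1 + norm y)\<close>. Since \<open>B\<close> is nonnegative almost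
      everywhere, its truncated lattice sums are at most the full sum, which is 1; so the bound does
      not depend on \<open>n\<close>.\<close>
    show "AE y in lborel. norm (D n y * cnj (\<phi> y)) \<le> (1 + R) ^ card T * ((1 + norm y) ^ card T * cmod (\<phi> y))" for n
      using nonneg sum1
    proof eventually_elim
      case (elim y)
      let ?m = "((1 + R) * (1 + norm y)) ^ card T"
      obtain N :: nat where N: "R + norm y \<le> real N" "n \<le> N"
      proof -
        obtain N :: nat where "R + norm y \<le> real N" using real_arch_simple by blast
        then show ?thesis by (intro that[of "max n N"]) auto
      qed
      have B0: "0 \<le> B (y - \<gamma>)" if "\<gamma> \<in> lat r" for \<gamma> r using elim(1) that lat_subset by blast
      have "cmod (D n y) \<le> (\<Sum>\<gamma>\<in>lat (real n). ?m * B (y - \<gamma>))"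
        unfolding D_def
      proof (rule sum_norm_le)
        fix \<gamma> :: "real ^ 'd" assume g: "\<gamma> \<in> lat (real n)"
        show "norm (complex_of_real (mon j T \<gamma>) * of_real (B (y - \<gamma>))) \<le> ?m * B (y - \<gamma>)"
        proof (cases "norm (y - \<gamma>) > R")
          case True
          then show ?thesis by (simp add: B_supp)
        next
          case False
          have "norm \<gamma> \<le> norm y + norm (y - \<gamma>)" by (metis norm_minus_commute norm_triangle_sub)
          also have "\<dots> \<le> (1 + R) * (1 + norm y)" 
          proof -
            have "0 \<le> R * norm y" using R_pos by simp
            moreover have "(1 + R) * (1 + norm y) = 1 + R + norm y + R * norm y" by (simp add: algebra_simps)
            ultimately show ?thesis using False by linarith
          qed
          finally have "norm \<gamma> ^ card T \<le> ?m" by (intro power_mono) auto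
          with mon_bound[of j T \<gamma>] have "\<bar>mon j T \<gamma>\<bar> \<le> ?m" by linarith
          then show ?thesis using B0[OF g] by (simp add: norm_mult mult_right_mono)
        qed
      qed
      also have "\<dots> = ?m * (\<Sum>\<gamma>\<in>lat (real n). B (y - \<gamma>))" by (simp add: sum_distrib_left)
      also have "(\<Sum>\<gamma>\<in>lat (real n). B (y - \<gamma>)) \<le> (\<Sum>\<gamma>\<in>lat (real N). B (y - \<gamma>))"
        using N(2) by (intro sum_mono2 finite_lat B0) (auto simp: lat_def)
      also have "(\<Sum>\<gamma>\<in>lat (real N). B (y - \<gamma>)) = 1"
      proof -
        have "complex_of_real (\<Sum>\<gamma>\<in>lat (real N). B (y - \<gamma>)) = 1"
          using G_eq_sum[OF N(1), of j "{}"] elim(2) by simp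
        then show ?thesis by (metis of_real_eq_1_iff)
      qed
      finally have "cmod (D n y) \<le> ?m" using R_pos by (simp add: mult_left_mono)
      then have "cmod (D n y) * cmod (\<phi> y) \<le> ?m * cmod (\<phi> y)" by (intro mult_right_mono) auto
      then show ?case by (simp add: norm_mult power_mult_distrib mult.assoc)
    qed
  qed measurable
  moreover have "(LINT y|lborel. D n y * cnj (\<phi> y)) = (if T = {} then 1 else 0)" for n
  proof -
    have i: "integrable lborel (\<lambda>y. complex_of_real (B (y - \<gamma>)) * cnj (\<phi> y))" for \<gamma>
      by (rule L2_mult_cnj_integrable[OF L2_B L2_phi])
    have "(LINT y|lborel. D n y * cnj (\<phi> y)) =
        (LINT y|lborel. (\<Sum>\<gamma>\<in>lat (real n). of_real (mon j T \<gamma>) * (complex_of_real (B (y - \<gamma>)) * cnj (\<phi> y))))"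
      by (simp add: D_def sum_distrib_right mult.assoc)
    also have "\<dots> = (\<Sum>\<gamma>\<in>lat (real n). of_real (mon j T \<gamma>) * (LINT y|lborel. complex_of_real (B (y - \<gamma>)) * cnj (\<phi> y)))"
      using i by (subst Bochner_Integration.integral_sum) auto
    also have "\<dots> = (\<Sum>\<gamma>\<in>(lat (real n) :: (real ^ 'd) set). if \<gamma> = 0 then of_real (mon j T 0) else 0)"
    proof (rule sum.cong)
      fix \<gamma> :: "real ^ 'd" assume "\<gamma> \<in> lat (real n)"
      then have "\<gamma> \<in> int_vecs" using lat_subset by blast
      from biorthogonal[OF this int_vecs_0]
      show "of_real (mon j T \<gamma>) * (LINT y|lborel. complex_of_real (B (y - \<gamma>)) * cnj (\<phi> y)) =
          (if \<gamma> = 0 then complex_of_real (mon j T 0) else 0)" by simp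
    qed simp
    also have "\<dots> = of_real (mon j T 0)"
    proof -
      have "(0 :: real ^ 'd) \<in> lat (real n)" by (simp add: lat_def)
      then show ?thesis by simp
    qed
    finally show ?thesis using T(1) by (simp add: mon_0)
  qed
  ultimately show ?thesis unfolding Mom_def by (simp add: LIMSEQ_const_iff)
qed

lemma A_empty: "A j {} x = 1"
  using Mom_small[of "{}" j] by (simp add: A_def Mom_def H_empty)

lemma projection_infsum:
  assumes "R + norm x \<le> r"
  shows "box_projection B \<phi> f x = (\<Sum>\<alpha>\<in>lat r. (LINT y|lborel. f y * cnj (\<phi> (y - \<alpha>))) * complex_of_real (B (x - \<alpha>)))"
proof -
  define t where "t = (\<lambda>\<alpha>. (LINT y|lborel. f y * cnj (\<phi> (y - \<alpha>))) * complex_of_real (B (x - \<alpha>)))"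
  have "(\<Sum>\<^sub>\<infinity>\<alpha>\<in>int_vecs. t \<alpha>) = (\<Sum>\<^sub>\<infinity>\<alpha>\<in>lat r. t \<alpha>)"
  proof (rule infsum_cong_neutral)
    fix \<alpha> :: "real ^ 'd" assume "\<alpha> \<in> int_vecs - lat r"
    then have "norm \<alpha> > R + norm x" using assms by (auto simp: lat_def)
    then have "norm (x - \<alpha>) > R" using norm_triangle_sub[of \<alpha> x] by (simp add: norm_minus_commute)
    then show "t \<alpha> = 0" by (simp add: B_supp t_def)
  qed (use lat_subset in auto)
  then show ?thesis by (simp add: box_projection_def t_def)
qed

lemma projection_mon:
  assumes K: "finite K"
  shows "box_projection B \<phi> (\<lambda>x. of_real (mon j K x)) x =
    (\<Sum>X\<in>Pow K. A j X x * ((- 1) ^ card (K - X) * G j (K - X) x))"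
proof -
  define r where "r = R + norm x"
  let ?g = "\<lambda>X \<alpha>. complex_of_real (mon j (K - X) (x - \<alpha>))"
  have c: "(LINT y|lborel. of_real (mon j K y) * cnj (\<phi> (y - \<alpha>))) =
      (\<Sum>X\<in>Pow K. A j X x * ((- 1) ^ card (K - X) * ?g X \<alpha>))" for \<alpha>
  proof -
    have "(LINT y|lborel. complex_of_real (mon j K y) * cnj (\<phi> (y - \<alpha>))) =
        (LINT y|lborel. of_real (mon j K (y + \<alpha>)) * cnj (\<phi> y))"
    proof -
      have "(\<lambda>y. complex_of_real (mon j K y) * cnj (\<phi> (y - \<alpha>))) \<in> borel_measurable borel" by measurable
      from lborel_shift_integral[OF this, of \<alpha>] show ?thesis by simp
    qed
    also have "\<dots> = (LINT y|lborel. (\<Sum>X\<in>Pow K. ((- 1) ^ card (K - X) * ?g X \<alpha>) * (of_real (mon j X (x + y)) * cnj (\<phi> y))))"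
    proof (rule Bochner_Integration.integral_cong[OF refl])
      fix y
      have "mon j K (y + \<alpha>) = (\<Sum>X\<in>Pow K. mon j X (x + y) * ((- 1) ^ card (K - X) * mon j (K - X) (x - \<alpha>)))"
        using mon_add[OF K, of j "x + y" "- (x - \<alpha>)"] unfolding mon_uminus by (simp add: add.commute)
      then show "of_real (mon j K (y + \<alpha>)) * cnj (\<phi> y) =
          (\<Sum>X\<in>Pow K. ((- 1) ^ card (K - X) * ?g X \<alpha>) * (of_real (mon j X (x + y)) * cnj (\<phi> y)))"
        by (simp add: sum_distrib_left mult_ac)
    qed
    also have "\<dots> = (\<Sum>X\<in>Pow K. ((- 1) ^ card (K - X) * ?g X \<alpha>) * A j X x)"
      unfolding A_def using integrable_mon_phi
      by (subst Bochner_Integration.integral_sum) auto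
    finally show ?thesis by (simp add: mult_ac)
  qed
  have "box_projection B \<phi> (\<lambda>x. of_real (mon j K x)) x =
      (\<Sum>\<alpha>\<in>lat r. \<Sum>X\<in>Pow K. A j X x * ((- 1) ^ card (K - X) * (?g X \<alpha> * of_real (B (x - \<alpha>)))))"
    by (subst projection_infsum[of x r]) (simp_all add: r_def c sum_distrib_right mult.assoc)
  also have "\<dots> = (\<Sum>X\<in>Pow K. \<Sum>\<alpha>\<in>lat r. A j X x * ((- 1) ^ card (K - X) * (?g X \<alpha> * of_real (B (x - \<alpha>)))))"
    by (rule sum.swap)
  also have "\<dots> = (\<Sum>X\<in>Pow K. A j X x * ((- 1) ^ card (K - X) * G j (K - X) x))"
    by (subst G_eq_sum[of x r]) (simp_all add: r_def sum_distrib_left)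
  finally show ?thesis .
qed

text \<open>This is the part of the projection left when periodizations are replaced by their means.
  It equals the integral of \<open>H j K (x + y)\<close> against \<open>cnj \<phi>\<close>, and
  expanding in monomials of \<open>x\<close> leaves pure moments.\<close>

lemma sum_A_moment:
  assumes K: "finite K"
  shows "(\<Sum>X\<in>Pow K. A j X x * ((- 1) ^ card (K - X) * moment j (K - X))) =
    (\<Sum>X\<in>Pow K. of_real (mon j X x) * Mom j (K - X))"
proof -
  have "(\<Sum>X\<in>Pow K. A j X x * ((- 1) ^ card (K - X) * moment j (K - X))) =
      (LINT y|lborel. (\<Sum>X\<in>Pow K. ((- 1) ^ card (K - X) * moment j (K - X)) * (of_real (mon j X (x + y)) * cnj (\<phi> y))))"
    unfolding A_def using integrable_mon_phi
    by (subst Bochner_Integration.integral_sum) (auto simp: mult.commute)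
  also have "\<dots> = (LINT y|lborel. H j K (x + y) * cnj (\<phi> y))"
    unfolding H_expand[OF K] sum_distrib_right by (simp add: mult_ac)
  also have "\<dots> = (LINT y|lborel. (\<Sum>X\<in>Pow K. of_real (mon j X x) * (H j (K - X) y * cnj (\<phi> y))))"
    unfolding H_add[OF K] by (simp add: sum_distrib_right mult.assoc)
  also have "\<dots> = (\<Sum>X\<in>Pow K. of_real (mon j X x) * Mom j (K - X))"
    unfolding Mom_def using K
    by (subst Bochner_Integration.integral_sum) (auto intro!: integrable_mult_right integrable_H_phi)
  finally show ?thesis .
qed

lemma projection_critical:
  assumes K: "finite K" "card K = rho v I + 1"
    and G1: "\<And>X. X \<subset> K \<Longrightarrow> G j X x = moment j X"
    and G2: "G j K x = moment j K + (- 1) ^ (rho v I + 1) * bern_comb j K x"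
  shows "box_projection B \<phi> (\<lambda>x. of_real (mon j K x)) x = of_real (mon j K x) + Mom j K + bern_comb j K x"
proof -
  have Kne: "K \<noteq> {}" using K by auto
  have sq: "((- 1) ^ (rho v I + 1) * ((- 1) ^ (rho v I + 1) * z)) = z" for z :: complex
    by (simp add: mult.assoc[symmetric] power_mult_distrib[symmetric])
  \<comment> \<open>Only the summand \<open>X = {}\<close> contains \<open>G j K\<close>; there
    \<open>A j {} x = 1\<close>, and the sign from the expansion cancels the sign of the Bernoulli
    part.\<close>
  have "box_projection B \<phi> (\<lambda>x. of_real (mon j K x)) x =
      (\<Sum>X\<in>Pow K. A j X x * ((- 1) ^ card (K - X) * moment j (K - X)) + (if X = {} then bern_comb j K x else 0))"
    unfolding projection_mon[OF K(1)]
  proof (rule sum.cong)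
    fix X assume "X \<in> Pow K"
    show "A j X x * ((- 1) ^ card (K - X) * G j (K - X) x) =
        A j X x * ((- 1) ^ card (K - X) * moment j (K - X)) + (if X = {} then bern_comb j K x else 0)"
    proof (cases "X = {}")
      case True
      then show ?thesis using K(2) by (simp only: Diff_empty G2 A_empty mult_1_left distrib_left sq simp_thms if_True)
    next
      case False
      then have "K - X \<subset> K" using \<open>X \<in> Pow K\<close> by auto
      then show ?thesis using False by (simp add: G1)
    qed
  qed simp
  also have "\<dots> = (\<Sum>X\<in>Pow K. of_real (mon j X x) * Mom j (K - X)) + bern_comb j K x"
    unfolding sum.distrib sum_A_moment[OF K(1)] using K(1) by simp
  \<comment> \<open>\<open>X = K\<close> leaves \<open>Mom j {} = 1\<close>, \<open>X = {}\<close>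
    leaves the still unknown \<open>Mom j K\<close>, and the moments in between vanish by
    \<open>Mom_small\<close>.\<close>
  also have "(\<Sum>X\<in>Pow K. of_real (mon j X x) * Mom j (K - X)) =
      (\<Sum>X\<in>Pow K. (if X = K then of_real (mon j K x) else 0) + (if X = {} then Mom j K else 0))"
  proof (rule sum.cong)
    fix X assume X: "X \<in> Pow K"
    show "of_real (mon j X x) * Mom j (K - X) = (if X = K then of_real (mon j K x) else 0) + (if X = {} then Mom j K else 0)"
    proof (cases "X = {}")
      case True
      then show ?thesis using Kne by simp
    next
      case False
      then have "card (K - X) < card K" using X K(1) by (intro psubset_card_mono) auto
      then have "Mom j (K - X) = (if K - X = {} then 1 else 0)" using K by (intro Mom_small) auto
      then show ?thesis using False X by auto
    qed
  qed simp
  also have "\<dots> = of_real (mon j K x) + Mom j K" using K(1) by (simp add: sum.distrib)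
  finally show ?thesis by simp
qed

end

section \<open>Orthogonality of the error\<close>

context dual_box_spline
begin

definition overlap :: "real ^ 'd \<Rightarrow> real" where
  "overlap \<alpha> = (LINT x|lborel. B (x - \<alpha>) * B x)"

lemma integral_B_B:
  "(LINT x|lborel. complex_of_real (B (x - \<alpha>)) * of_real (B x)) = of_real (overlap \<alpha>)"
  unfolding overlap_def of_real_mult[symmetric] by (rule integral_complex_of_real)

lemma integrable_B_B: "integrable lborel (\<lambda>x. complex_of_real (B (x - \<alpha>)) * of_real (B x))"
  using L2_mult_cnj_integrable[OF L2_B[of \<alpha>] L2_B[of 0]] by simp

lemma disjoint_translates:
  assumes "\<alpha> \<in> int_vecs" "\<alpha> \<notin> lat (2 * R)"
  shows "B (x - \<alpha>) * B x = 0"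
proof (cases "norm x > R")
  case False
  have "norm \<alpha> > 2 * R" using assms by (auto simp: lat_def)
  moreover have "norm \<alpha> \<le> norm x + norm (x - \<alpha>)" using norm_triangle_sub[of \<alpha> x] by (simp add: norm_minus_commute)
  ultimately have "norm (x - \<alpha>) > R" using False by linarith
  then show ?thesis by (simp add: B_supp)
qed (simp add: B_supp)

text \<open>
  The difference of the two sides lies in the shift space and is orthogonal to it.
\<close>
lemma B_dual_expansion:
  "AE x in lborel. complex_of_real (B x) = (\<Sum>\<alpha>\<in>lat (2 * R). of_real (overlap \<alpha>) * \<phi> (x - \<alpha>))"
proof -
  let ?L = "lat (2 * R) :: (real ^ 'd) set"
  define b where "b = (\<lambda>\<alpha>. complex_of_real (overlap \<alpha>))"
  define h where "h = (\<lambda>x. complex_of_real (B x) - (\<Sum>\<alpha>\<in>?L. b \<alpha> * \<phi> (x - \<alpha>)))"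
  have L2h: "L2 h"
    unfolding h_def using L2_B[of 0] by (intro L2_diff L2_sum L2_cmult L2_phi_shift) simp
  have orth: "(LINT x|lborel. complex_of_real (B (x - \<delta>)) * cnj (h x)) = 0" if d: "\<delta> \<in> int_vecs" for \<delta>
  proof -
    have i: "integrable lborel (\<lambda>x. b \<alpha> * (complex_of_real (B (x - \<delta>)) * cnj (\<phi> (x - \<alpha>))))" for \<alpha>
      by (intro integrable_mult_right L2_mult_cnj_integrable L2_B L2_phi_shift)
    have "(LINT x|lborel. complex_of_real (B (x - \<delta>)) * cnj (h x)) =
        (LINT x|lborel. complex_of_real (B (x - \<delta>)) * of_real (B x) -
          (\<Sum>\<alpha>\<in>?L. b \<alpha> * (complex_of_real (B (x - \<delta>)) * cnj (\<phi> (x - \<alpha>)))))"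
      by (simp add: h_def b_def right_diff_distrib sum_distrib_left mult_ac)
    also have "\<dots> = (LINT x|lborel. complex_of_real (B (x - \<delta>)) * of_real (B x)) -
          (LINT x|lborel. (\<Sum>\<alpha>\<in>?L. b \<alpha> * (complex_of_real (B (x - \<delta>)) * cnj (\<phi> (x - \<alpha>)))))"
      by (intro Bochner_Integration.integral_diff integrable_B_B Bochner_Integration.integrable_sum i)
    also have "(LINT x|lborel. (\<Sum>\<alpha>\<in>?L. b \<alpha> * (complex_of_real (B (x - \<delta>)) * cnj (\<phi> (x - \<alpha>))))) =
        (\<Sum>\<alpha>\<in>?L. LINT x|lborel. b \<alpha> * (complex_of_real (B (x - \<delta>)) * cnj (\<phi> (x - \<alpha>))))"
      by (intro Bochner_Integration.integral_sum i)
    also have "\<dots> = (\<Sum>\<alpha>\<in>?L. if \<alpha> = \<delta> then b \<alpha> else 0)"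
    proof (rule sum.cong[OF refl])
      fix \<alpha> assume "\<alpha> \<in> ?L"
      then have "\<alpha> \<in> int_vecs" using lat_subset by blast
      from biorthogonal[OF d this]
      show "(LINT x|lborel. b \<alpha> * (complex_of_real (B (x - \<delta>)) * cnj (\<phi> (x - \<alpha>)))) = (if \<alpha> = \<delta> then b \<alpha> else 0)"
        by simp
    qed
    also have "\<dots> = b \<delta>"
    proof (cases "\<delta> \<in> ?L")
      case False
      then have "overlap \<delta> = 0" unfolding overlap_def disjoint_translates[OF d False] by simp
      then show ?thesis using False by (simp add: b_def)
    qed simp
    finally show ?thesis unfolding integral_B_B b_def by simp
  qed
  \<comment> \<open>From Cauchy-Schwarz: the square of a sum over the finitely many translates is at
    most their number times the sum of the squares.\<close>
  define C where "C = real (card ?L) * (\<Sum>\<alpha>\<in>?L. (cmod (b \<alpha>))\<^sup>2)"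
  have C0: "C \<ge> 0" unfolding C_def by (intro mult_nonneg_nonneg sum_nonneg) auto
  have approx: "(LINT x|lborel. (cmod (h x))\<^sup>2) \<le> C * \<eta>" if eta: "\<eta> > 0" for \<eta>
  proof -
    obtain A c where A: "finite A" "A \<subseteq> int_vecs"
        "(LINT x|lborel. (cmod (\<phi> x - (\<Sum>\<alpha>\<in>A. c \<alpha> * complex_of_real (B (x - \<alpha>)))))\<^sup>2) < \<eta>"
      using dual eta unfolding is_dual_generator_def in_shift_space_def by blast
    define s0 where "s0 = (\<lambda>x. \<Sum>\<gamma>\<in>A. c \<gamma> * complex_of_real (B (x - \<gamma>)))"
    define w where "w = (\<lambda>x. \<phi> x - s0 x)"
    have L2s0: "L2 s0" unfolding s0_def by (intro L2_sum L2_cmult L2_B)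
    have L2w: "L2 w" unfolding w_def by (intro L2_diff L2_phi L2s0)
    have weta: "(LINT x|lborel. (cmod (w x))\<^sup>2) < \<eta>" using A(3) by (simp add: w_def s0_def)
    \<comment> \<open>The definition of \<open>h\<close> with \<open>\<phi>\<close> replaced by its
      approximation \<open>s0\<close>. The result is a finite combination of translates of
      \<open>B\<close>, to which \<open>h\<close> is orthogonal, and it differs from
      \<open>h\<close> only by translates of \<open>w\<close>.\<close>
    define s where "s = (\<lambda>x. complex_of_real (B x) - (\<Sum>\<alpha>\<in>?L. b \<alpha> * s0 (x - \<alpha>)))"
    have L2s0s: "L2 (\<lambda>x. s0 (x - \<alpha>))" for \<alpha> using L2_shift[OF L2s0, of "- \<alpha>"] by simp
    have L2ws: "L2 (\<lambda>x. w (x - \<alpha>))" for \<alpha> using L2_shift[OF L2w, of "- \<alpha>"] by simp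
    have L2s: "L2 s"
      unfolding s_def using L2_B[of 0] by (intro L2_diff L2_sum L2_cmult L2s0s) simp
    have o0: "(LINT x|lborel. s0 (x - \<alpha>) * cnj (h x)) = 0" if a: "\<alpha> \<in> int_vecs" for \<alpha>
    proof -
      have i: "integrable lborel (\<lambda>x. c \<gamma> * (complex_of_real (B (x - (\<alpha> + \<gamma>))) * cnj (h x)))" for \<gamma>
        by (intro integrable_mult_right L2_mult_cnj_integrable L2_B L2h)
      have "(LINT x|lborel. s0 (x - \<alpha>) * cnj (h x)) =
          (LINT x|lborel. (\<Sum>\<gamma>\<in>A. c \<gamma> * (complex_of_real (B (x - (\<alpha> + \<gamma>))) * cnj (h x))))"
        by (simp add: s0_def sum_distrib_right mult.assoc diff_diff_add)
      also have "\<dots> = (\<Sum>\<gamma>\<in>A. LINT x|lborel. c \<gamma> * (complex_of_real (B (x - (\<alpha> + \<gamma>))) * cnj (h x)))"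
        by (intro Bochner_Integration.integral_sum i)
      also have "\<dots> = 0"
        using A(2) orth int_vecs_add[OF a] by (intro sum.neutral) (auto simp: subset_iff)
      finally show ?thesis .
    qed
    have "(LINT x|lborel. s x * cnj (h x)) = 0"
    proof -
      have i: "integrable lborel (\<lambda>x. b \<alpha> * (s0 (x - \<alpha>) * cnj (h x)))" for \<alpha>
        by (intro integrable_mult_right L2_mult_cnj_integrable L2s0s L2h)
      have i0: "integrable lborel (\<lambda>x. complex_of_real (B x) * cnj (h x))"
        using L2_mult_cnj_integrable[OF L2_B[of 0] L2h] by simp
      have "(LINT x|lborel. s x * cnj (h x)) =
          (LINT x|lborel. complex_of_real (B x) * cnj (h x) - (\<Sum>\<alpha>\<in>?L. b \<alpha> * (s0 (x - \<alpha>) * cnj (h x))))"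
        by (simp add: s_def left_diff_distrib sum_distrib_right mult.assoc)
      also have "\<dots> = (LINT x|lborel. complex_of_real (B x) * cnj (h x)) -
          (LINT x|lborel. (\<Sum>\<alpha>\<in>?L. b \<alpha> * (s0 (x - \<alpha>) * cnj (h x))))"
        by (intro Bochner_Integration.integral_diff i0 Bochner_Integration.integrable_sum i)
      also have "(LINT x|lborel. (\<Sum>\<alpha>\<in>?L. b \<alpha> * (s0 (x - \<alpha>) * cnj (h x)))) =
          (\<Sum>\<alpha>\<in>?L. LINT x|lborel. b \<alpha> * (s0 (x - \<alpha>) * cnj (h x)))"
        by (intro Bochner_Integration.integral_sum i)
      also have "\<dots> = 0" using lat_subset o0 by (intro sum.neutral) (auto simp: subset_iff)
      finally show ?thesis using orth[of 0] by simp
    qed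
    then have "(LINT x|lborel. (cmod (h x))\<^sup>2) \<le> (LINT x|lborel. (cmod (h x - s x))\<^sup>2)"
      by (rule L2_orthogonal_approx[OF L2h L2s])
    also have "\<dots> \<le> (LINT x|lborel. real (card ?L) * (\<Sum>\<alpha>\<in>?L. (cmod (b \<alpha>))\<^sup>2 * (cmod (w (x - \<alpha>)))\<^sup>2))"
    proof (rule integral_mono)
      show "integrable lborel (\<lambda>x. (cmod (h x - s x))\<^sup>2)" using L2_diff[OF L2h L2s] by (simp add: L2_def)
      show "integrable lborel (\<lambda>x. real (card ?L) * (\<Sum>\<alpha>\<in>?L. (cmod (b \<alpha>))\<^sup>2 * (cmod (w (x - \<alpha>)))\<^sup>2))"
        using L2ws by (intro integrable_mult_right Bochner_Integration.integrable_sum) (auto simp: L2_def)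
      fix x
      have "h x - s x = - (\<Sum>\<alpha>\<in>?L. b \<alpha> * w (x - \<alpha>))"
        by (simp add: h_def s_def w_def right_diff_distrib sum_subtractf)
      then have "cmod (h x - s x) \<le> (\<Sum>\<alpha>\<in>?L. cmod (b \<alpha>) * cmod (w (x - \<alpha>)))"
        using norm_sum[of "\<lambda>\<alpha>. b \<alpha> * w (x - \<alpha>)" ?L] by (simp add: norm_mult)
      then have "(cmod (h x - s x))\<^sup>2 \<le> (\<Sum>\<alpha>\<in>?L. cmod (b \<alpha>) * cmod (w (x - \<alpha>)))\<^sup>2"
        by (intro power_mono) auto
      also have "\<dots> \<le> real (card ?L) * (\<Sum>\<alpha>\<in>?L. (cmod (b \<alpha>) * cmod (w (x - \<alpha>)))\<^sup>2)"
        using sum_squared_le_sum_of_squares[of "\<lambda>\<alpha>. cmod (b \<alpha>) * cmod (w (x - \<alpha>))" ?L] by (simp add: mult.commute)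
      finally show "(cmod (h x - s x))\<^sup>2 \<le> real (card ?L) * (\<Sum>\<alpha>\<in>?L. (cmod (b \<alpha>))\<^sup>2 * (cmod (w (x - \<alpha>)))\<^sup>2)"
        by (simp add: power_mult_distrib)
    qed
    also have "\<dots> = real (card ?L) * (\<Sum>\<alpha>\<in>?L. (cmod (b \<alpha>))\<^sup>2 * (LINT x|lborel. (cmod (w x))\<^sup>2))"
    proof -
      have "(LINT x|lborel. (cmod (w (x - \<alpha>)))\<^sup>2) = (LINT x|lborel. (cmod (w x))\<^sup>2)" for \<alpha>
        using lborel_shift_integral[of "\<lambda>x. (cmod (w x))\<^sup>2" "- \<alpha>"] L2_measurable[OF L2w] by simp
      then show ?thesis
        using L2ws by (subst integral_mult_right_zero, subst Bochner_Integration.integral_sum) (auto simp: L2_def)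
    qed
    also have "\<dots> = C * (LINT x|lborel. (cmod (w x))\<^sup>2)" by (simp add: C_def sum_distrib_right)
    also have "\<dots> \<le> C * \<eta>" using weta C0 by (intro mult_left_mono) auto
    finally show ?thesis .
  qed
  have "(LINT x|lborel. (cmod (h x))\<^sup>2) \<le> 0 + e" if "e > 0" for e
  proof -
    have "(LINT x|lborel. (cmod (h x))\<^sup>2) \<le> C * (e / (C + 1))" using that C0 by (intro approx) auto
    also have "\<dots> \<le> e" using that C0 by (simp add: field_simps)
    finally show ?thesis by simp
  qed
  then have "(LINT x|lborel. (cmod (h x))\<^sup>2) \<le> 0" by (rule field_le_epsilon)
  moreover have "0 \<le> (LINT x|lborel. (cmod (h x))\<^sup>2)" by (intro Bochner_Integration.integral_nonneg) auto
  ultimately have "(LINT x|lborel. (cmod (h x))\<^sup>2) = 0" by linarith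
  then have "AE x in lborel. (cmod (h x))\<^sup>2 = 0"
    using L2h by (subst (asm) integral_nonneg_eq_0_iff_AE) (auto simp: L2_def)
  then show ?thesis by eventually_elim (simp add: h_def b_def)
qed

text \<open>In substance the projection is self-adjoint and fixes \<open>B\<close>. For monomials
  this is checked by hand: \<open>B_dual_expansion\<close> writes \<open>B\<close> as a finite sum
  of translates of \<open>\<phi>\<close>, whose coefficients are the overlaps that also arise from
  pairing \<open>B\<close> with its translates.\<close>

lemma projection_orthogonal:
  assumes K: "finite K"
  shows "integrable lborel (\<lambda>x. box_projection B \<phi> (\<lambda>x. of_real (mon j K x)) x * of_real (B x))"
    and "(LINT x|lborel. box_projection B \<phi> (\<lambda>x. of_real (mon j K x)) x * of_real (B x)) =
      (LINT x|lborel. of_real (mon j K x) * of_real (B x))"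
proof -
  let ?L = "lat (2 * R) :: (real ^ 'd) set"
  let ?P = "box_projection B \<phi> (\<lambda>x. of_real (mon j K x))"
  define c where "c = (\<lambda>\<alpha>. LINT y|lborel. complex_of_real (mon j K y) * cnj (\<phi> (y - \<alpha>)))"
  have P: "?P x * of_real (B x) = (\<Sum>\<alpha>\<in>?L. c \<alpha> * (complex_of_real (B (x - \<alpha>)) * of_real (B x)))" for x
  proof (cases "norm x > R")
    case False
    then have "?P x = (\<Sum>\<alpha>\<in>?L. c \<alpha> * complex_of_real (B (x - \<alpha>)))"
      unfolding c_def by (intro projection_infsum) auto
    then show ?thesis by (simp add: sum_distrib_right mult.assoc)
  qed (simp add: B_supp)
  have i: "integrable lborel (\<lambda>x. c \<alpha> * (complex_of_real (B (x - \<alpha>)) * of_real (B x)))" for \<alpha>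
    by (intro integrable_mult_right integrable_B_B)
  show "integrable lborel (\<lambda>x. ?P x * of_real (B x))" unfolding P by (intro Bochner_Integration.integrable_sum i)
  have k: "integrable lborel (\<lambda>x. of_real (overlap \<alpha>) * (complex_of_real (mon j K x) * cnj (\<phi> (x - \<alpha>))))" for \<alpha>
  proof -
    have "integrable lborel (\<lambda>y. complex_of_real (mon j K (\<alpha> + y)) * cnj (\<phi> y))" by (rule integrable_mon_phi)
    from lborel_shift_integrable[OF this, of "- \<alpha>"]
    have "integrable lborel (\<lambda>x. complex_of_real (mon j K x) * cnj (\<phi> (x - \<alpha>)))" by simp
    then show ?thesis by (rule integrable_mult_right)
  qed
  have "(LINT x|lborel. ?P x * of_real (B x)) = (\<Sum>\<alpha>\<in>?L. c \<alpha> * of_real (overlap \<alpha>))"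
    unfolding P using i by (subst Bochner_Integration.integral_sum) (auto simp: integral_B_B)
  also have "\<dots> = (\<Sum>\<alpha>\<in>?L. LINT x|lborel. of_real (overlap \<alpha>) * (complex_of_real (mon j K x) * cnj (\<phi> (x - \<alpha>))))"
    by (simp add: c_def mult.commute)
  also have "\<dots> = (LINT x|lborel. (\<Sum>\<alpha>\<in>?L. of_real (overlap \<alpha>) * (complex_of_real (mon j K x) * cnj (\<phi> (x - \<alpha>)))))"
    by (intro Bochner_Integration.integral_sum[symmetric] k)
  also have "\<dots> = (LINT x|lborel. of_real (mon j K x) * of_real (B x))"
  proof (rule integral_cong_AE)
    show "AE x in lborel. (\<Sum>\<alpha>\<in>?L. of_real (overlap \<alpha>) * (complex_of_real (mon j K x) * cnj (\<phi> (x - \<alpha>)))) =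
        of_real (mon j K x) * of_real (B x)"
      using B_dual_expansion
    proof eventually_elim
      case (elim x)
      have "complex_of_real (B x) = cnj (complex_of_real (B x))" by simp
      also have "\<dots> = (\<Sum>\<alpha>\<in>?L. of_real (overlap \<alpha>) * cnj (\<phi> (x - \<alpha>)))" unfolding elim by simp
      finally show ?case by (simp add: sum_distrib_left mult_ac)
    qed
  qed measurable
  finally show "(LINT x|lborel. ?P x * of_real (B x)) = (LINT x|lborel. of_real (mon j K x) * of_real (B x))" .
qed

lemma integrable_bern_comb_B: "integrable lborel (\<lambda>x. bern_comb j S x * of_real (B x))"
proof -
  obtain K where K: "\<And>x. cmod (bern_comb j S x) \<le> K" using bounded_bern_comb by blast
  show ?thesis
  proof (rule Bochner_Integration.integrable_bound)
    show "integrable lborel (\<lambda>x. K * norm (B x))" by (intro integrable_mult_right integrable_norm integrable_B)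
    show "AE x in lborel. norm (bern_comb j S x * of_real (B x)) \<le> norm (K * norm (B x))"
    proof (rule AE_I2)
      fix x
      have "cmod (bern_comb j S x) * \<bar>B x\<bar> \<le> K * \<bar>B x\<bar>" by (intro mult_right_mono K) auto
      also have "\<dots> \<le> \<bar>K * \<bar>B x\<bar>\<bar>" by (rule abs_ge_self)
      finally show "norm (bern_comb j S x * of_real (B x)) \<le> norm (K * norm (B x))" by (simp add: norm_mult)
    qed
  qed measurable
qed

text \<open>The translates of \<open>B\<close> sum to 1 almost everywhere, so unfolding turns this
  into the mean of a periodic function, and zero is excluded from the frequencies of a Bernoulli
  spline.\<close>

lemma integral_bern_comb_B: "(LINT x|lborel. bern_comb j S x * of_real (B x)) = 0"
proof -
  let ?f = "\<lambda>x. complex_of_real (mon j {} x) * of_real (B x) * bern_comb j S x"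
  have "(LINT x|lborel. bern_comb j S x * of_real (B x)) = (LINT x|lborel. ?f x)" by (simp add: mult.commute)
  also have "\<dots> = (LINT x:qcube|lborel. perio ?f x)"
    using integrable_bern_comb_B by (intro periodization(2)[symmetric, where R=R]) (auto simp: B_supp mult.commute)
  also have "\<dots> = (LINT x:qcube|lborel. bern_comb j S x * chi 0 x)"
    unfolding set_lebesgue_integral_def
  proof (rule integral_cong_AE)
    have pf: "perio ?f x = G j {} x * bern_comb j S x" for x
      unfolding G_def by (rule perio_mult_periodic) (rule periodic_bern_comb)
    have "G j {} \<in> borel_measurable borel"
      unfolding G_def by (rule borel_measurable_perio[OF _ mon_B_supp]) measurable
    note this[measurable]
    show "(\<lambda>x. indicator qcube x *\<^sub>R perio ?f x) \<in> borel_measurable lborel" unfolding pf by measurable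
    show "AE x in lborel. indicator qcube x *\<^sub>R perio ?f x = indicator qcube x *\<^sub>R (bern_comb j S x * chi 0 x)"
      using G_AE_small[of "{}" j] unfolding pf by (auto simp: moment_empty)
  qed measurable
  also have "\<dots> = 0"
    unfolding fourier_coeff_bern_comb[OF int_vecs_0] by (auto simp: bernoulli_index_def intro!: sum.neutral)
  finally show ?thesis .
qed

lemma projection_error_AE_Mom:
  assumes K: "finite K" "card K = rho v I + 1"
  shows "AE x in lborel. box_projection B \<phi> (\<lambda>x. of_real (mon j K x)) x =
    of_real (mon j K x) + Mom j K + bern_comb j K x"
proof -
  have "AE x in lborel. \<forall>X\<in>{X. X \<subset> K}. G j X x = moment j X"
  proof (rule AE_finite_allI)
    show "finite {X. X \<subset> K}" using K(1) by (auto intro: finite_subset[of _ "Pow K"])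
    fix X assume X: "X \<in> {X. X \<subset> K}"
    then have "card X < card K" using K(1) by (intro psubset_card_mono) auto
    then show "AE x in lborel. G j X x = moment j X"
      using X K by (intro G_AE_small) (auto intro: finite_subset)
  qed
  moreover have "AE x in lborel. G j K x = moment j K + (- 1) ^ (rho v I + 1) * bern_comb j K x"
    by (rule G_AE_critical[OF K])
  ultimately show ?thesis
    by eventually_elim (rule projection_critical[OF K], auto)
qed

text \<open>In degree \<open>rho v I + 1\<close> the argument of \<open>Mom_small\<close> leaves an
  extra integral of \<open>bern_comb\<close> against \<open>cnj \<phi>\<close>. Testing against
  \<open>B\<close> instead isolates the constant \<open>Mom j K\<close>: the Bernoulli part
  integrates to zero there, and \<open>B\<close> has integral 1.\<close>

lemma Mom_critical:
  assumes K: "finite K" "card K = rho v I + 1"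
  shows "Mom j K = 0"
proof -
  let ?P = "box_projection B \<phi> (\<lambda>x. of_real (mon j K x))"
  let ?m = "\<lambda>x. complex_of_real (mon j K x) * of_real (B x)"
  have im: "integrable lborel ?m" by (intro integrable_mult_B continuous_intros)
  have iB: "integrable lborel (\<lambda>x. Mom j K * complex_of_real (B x))"
    using integrable_mult_B[of "\<lambda>_. Mom j K"] by simp
  have eB: "(LINT x|lborel. complex_of_real (B x)) = 1"
    using moment_empty[of j] by (simp add: moment_def)
  note ib = integrable_bern_comb_B[of j K]
  have "(LINT x|lborel. ?m x) = (LINT x|lborel. ?P x * of_real (B x))"
    by (rule projection_orthogonal(2)[OF K(1), symmetric])
  also have "\<dots> = (LINT x|lborel. ?m x + Mom j K * of_real (B x) + bern_comb j K x * of_real (B x))"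
  proof (rule integral_cong_AE)
    show "(\<lambda>x. ?P x * of_real (B x)) \<in> borel_measurable lborel"
      using projection_orthogonal(1)[OF K(1)] by (rule borel_measurable_integrable)
    show "AE x in lborel. ?P x * of_real (B x) = ?m x + Mom j K * of_real (B x) + bern_comb j K x * of_real (B x)"
      using projection_error_AE_Mom[OF K, of j] by eventually_elim (simp add: distrib_right)
  qed measurable
  also have "\<dots> = (LINT x|lborel. ?m x) + Mom j K"
    using im iB ib eB by (simp add: integral_bern_comb_B)
  finally show ?thesis by simp
qed

lemma projection_error_AE:
  assumes K: "finite K" "card K = rho v I + 1"
  shows "AE x in lborel. box_projection B \<phi> (\<lambda>x. of_real (mon j K x)) x - of_real (mon j K x) = bern_comb j K x"
  using projection_error_AE_Mom[OF K, of j] by eventually_elim (simp add: Mom_critical[OF K])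

lemma projection_error_everywhere:
  assumes K: "finite K" "card K = rho v I + 1" and rho: "rho v I \<ge> 1"
  shows "box_projection B \<phi> (\<lambda>x. of_real (mon j K x)) x - of_real (mon j K x) = bern_comb j K x"
proof -
  have "G j X x = moment j X" if "X \<subset> K" for X
  proof -
    have "card X < card K" using that K(1) by (intro psubset_card_mono) auto
    then show ?thesis using that K by (intro G_small rho) (auto intro: finite_subset)
  qed
  from projection_critical[OF K this G_critical[OF K(1) rho K(2)]]
  show ?thesis by (simp add: Mom_critical[OF K])
qed

end

text \<open>A closed set of full measure is the whole space, so no neighbourhood of 0 can avoid the
  zeros of \<open>D\<close>.\<close>

lemma isCont_AE_zero:
  fixes D :: "'a::euclidean_space \<Rightarrow> complex"
  assumes D: "isCont D 0" and z: "AE h in lborel. D h = 0"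
  shows "D 0 = 0"
proof (rule ccontr)
  assume "D 0 \<noteq> 0"
  with D have "\<forall>\<^sub>F h in nhds 0. D h \<noteq> 0"
    by (intro tendsto_imp_eventually_ne) (auto simp: continuous_within tendsto_nhds_iff)
  then obtain S where S: "open S" "0 \<in> S" "\<And>h. h \<in> S \<Longrightarrow> D h \<noteq> 0" unfolding eventually_nhds by blast
  have "AE h in lebesgue. h \<in> - S"
    by (rule AE_completion, rule AE_mp[OF z]) (use S(3) in auto)
  then have "0 \<in> - S" using S(1) by (intro mem_closed_if_AE_lebesgue) auto
  then show False using S(2) by simp
qed

lemma AE_lborel_reflect:
  fixes P :: "'a::euclidean_space \<Rightarrow> bool"
  assumes "AE x in lborel. P x"
  shows "AE h in lborel. P (x - h)"
proof -
  have "(lborel :: 'a measure) = density (distr lborel borel (\<lambda>h. x + (- 1) *\<^sub>R h)) (\<lambda>_. 1)"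
    using lborel_affine[of "- 1" x] by simp
  also have "\<dots> = distr lborel borel (\<lambda>h. x - h)" by (simp add: density_1)
  finally have eq: "distr lborel borel (\<lambda>h. x - h) = (lborel :: 'a measure)" ..
  have "AE y in distr lborel borel (\<lambda>h. x - h). P y" unfolding eq by (rule assms)
  from AE_distrD[OF _ this] show ?thesis by simp
qed

text \<open>
  At a jump the symmetric partial sums pick the mean of the one-sided limits, which is why \<open>F\<close> is only
  assumed to be continuous after symmetrization.
\<close>
lemma eq_at_continuity_point:
  fixes L F :: "'a::euclidean_space \<Rightarrow> complex"
  assumes L: "isCont L x" and F: "isCont (\<lambda>h. F (x + h) + F (x - h)) 0"
    and ae: "AE y in lborel. L y = F y"
  shows "L x = F x"
proof -
  define D where "D = (\<lambda>h. (L (x + h) + L (x - h)) - (F (x + h) + F (x - h)))"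
  have "isCont (\<lambda>h. L (x + h)) 0" "isCont (\<lambda>h. L (x - h)) 0"
    using isCont_o2[of 0 "\<lambda>h. x + h" L] isCont_o2[of 0 "\<lambda>h. x - h" L] L by simp_all
  then have "isCont D 0" unfolding D_def using F by (intro continuous_diff continuous_add[of _ "\<lambda>h. L (x + h)"]) 
  moreover have "AE h in lborel. D h = 0"
    using AE_lborel_shift[OF ae, of x] AE_lborel_reflect[OF ae, of x]
    by eventually_elim (simp add: D_def add.commute)
  ultimately have "D 0 = 0" by (rule isCont_AE_zero)
  then have "2 * (L x - F x) = 0" unfolding D_def by (simp add: algebra_simps)
  then show ?thesis by simp
qed

theorem theorem2p5:
  fixes I :: "'i set" and v :: "'i \<Rightarrow> real ^ 'd" and \<beta> :: "nat ^ 'd"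
    and B :: "real ^ 'd \<Rightarrow> real" and \<phi> :: "real ^ 'd \<Rightarrow> complex"
  assumes "finite I"
    and "\<forall>i\<in>I. v i \<in> int_vecs - {0}"
    and "admissible_family v I"
    and "unimodular_family v I"
    and "is_box_spline v I B"
    and "is_dual_generator B \<phi>"
    and "(\<Sum>j\<in>UNIV. \<beta> $ j) = rho v I + 1"
  shows "(\<forall>U\<in>Lambda_sets v I. \<forall>y.
            multi_deriv \<beta> (\<lambda>x. \<Prod>i\<in>U. x \<bullet> v i) y = bernoulli_coeff v \<beta> U) \<and>
         (rho v I \<ge> 1 \<longrightarrow> (\<forall>x. proj_error B \<phi> \<beta> x =
            (\<Sum>U\<in>Lambda_sets v I. complex_of_real (bernoulli_coeff v \<beta> U) * bernoulli_spline v I U x))) \<and>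
         (rho v I = 0 \<longrightarrow> (\<forall>x. isCont (proj_error B \<phi> \<beta>) x \<longrightarrow> proj_error B \<phi> \<beta> x =
            (\<Sum>U\<in>Lambda_sets v I. complex_of_real (bernoulli_coeff v \<beta> U) * bernoulli_spline v I U x)))"
proof -
  interpret dual_box_spline I v B \<phi>
    using assms by unfold_locales auto
  define K where "K = {..<\<Sum>j\<in>UNIV. \<beta> $ j}"
  define j where "j = (!) (multi_list \<beta>)"
  have K: "finite K" "card K = rho v I + 1" by (simp_all add: K_def assms(7))
  have U: "finite U" "card U = (\<Sum>j\<in>UNIV. \<beta> $ j)" if "U \<in> Lambda_sets v I" for U
    using that assms(1,7) by (auto simp: Lambda_sets_def intro: finite_subset)
  have error: "proj_error B \<phi> \<beta> = (\<lambda>x. box_projection B \<phi> (\<lambda>x. of_real (mon j K x)) x - of_real (mon j K x))"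
    by (simp add: fun_eq_iff proj_error_def monomial_eq_mon[abs_def] K_def j_def)
  have comb: "bern_comb j K x =
      (\<Sum>U\<in>Lambda_sets v I. complex_of_real (bernoulli_coeff v \<beta> U) * bernoulli_spline v I U x)" for x
    unfolding bern_comb_def j_def K_def using bernoulli_coeff_eq(2)[OF U] by (intro sum.cong) auto
  have "multi_deriv \<beta> (\<lambda>x. \<Prod>i\<in>U. x \<bullet> v i) y = bernoulli_coeff v \<beta> U" if "U \<in> Lambda_sets v I" for U y
    using bernoulli_coeff_eq[OF U[OF that]] by simp
  moreover have "proj_error B \<phi> \<beta> x = bern_comb j K x" if "rho v I \<ge> 1" for x
    unfolding error by (rule projection_error_everywhere[OF K that])
  moreover have "proj_error B \<phi> \<beta> x = bern_comb j K x" if "rho v I = 0" "isCont (proj_error B \<phi> \<beta>) x" for x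
  proof (rule eq_at_continuity_point[OF that(2) symmetric_limit_bern_comb[OF that(1)]])
    show "AE y in lborel. proj_error B \<phi> \<beta> y = bern_comb j K y"
      unfolding error by (rule projection_error_AE[OF K])
  qed
  ultimately show ?thesis unfolding comb by blast
qed

end
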